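(* Let $\delta\ge0$ be a fixed integer and let $0\le t,\tilde t<1$ be fixed. As $N_c\to\infty$, the unrefined Hilbert series of $SU(N_c)$ SQCD with $N_f=N_c+\delta$ flavours satisfies $$g_{N_c+\delta,SU(N_c)}(t,\tilde t)\sim\frac{1}{(1-t\tilde t)^{(N_c+\delta)^2}}\left[1+\binom{N_c+\delta}{N_c}(1-t\tilde t)^{\delta}\big(t^{N_c}+\tilde t^{N_c}\big)-\binom{N_c+\delta}{N_c+1}^2(1-t\tilde t)^{2(\delta-1)}(t\tilde t)^{N_c+1}\right].$$
   Context: The unrefined Hilbert series of $SU(N_c)$ SQCD with $N_f$ flavours is $$g_{N_f,SU(N_c)}(t,\tilde t)=\int_{SU(N_c)}\prod_{a=1}^{N_c}\frac{1}{(1-t/z_a)^{N_f}(1-\tilde t z_a)^{N_f}}\,d\mu,$$ where $\mu$ is the normalised Haar measure on $SU(N_c)$ and $z_1,\dots,z_{N_c}$ are the eigenvalues of the group element. The notation $A\sim B$ means that the ratio $A/B$ tends to $1$ in the stated limit. Binomial coefficients $\binom{n}{k}$ with $k>n\ge0$ are zero. *)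

theory Defs
  imports
    "HOL-Probability.Probability"
    "HOL-Computational_Algebra.Polynomial"
    "Jordan_Normal_Form.Char_Poly"
    "Jordan_Normal_Form.Schur_Decomposition"
begin

definition SU :: "nat \<Rightarrow> complex mat set" where
  "SU n = {A \<in> carrier_mat n n. mat_adjoint A * A = 1\<^sub>m n \<and> Determinant.det A = 1}"

text \<open>
  The type of matrices carries no topology. The following is the Borel \<open>\<sigma>\<close>-algebra
  that \<open>SU n\<close> inherits from the space of its \<open>n \<times> n\<close> complex entries.
\<close>

definition SU_borel :: "nat \<Rightarrow> complex mat measure" where
  "SU_borel n = vimage_algebra (SU n)
     (\<lambda>A. \<lambda>ij\<in>{..<n} \<times> {..<n}. A $$ ij)
     (PiM ({..<n} \<times> {..<n}) (\<lambda>_. borel))"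

text \<open>
  Left-invariant Borel probability measures: by uniqueness of Haar measure on the compact
  group \<open>SU n\<close> there is exactly one such measure on \<open>sets (SU_borel n)\<close>.
\<close>

definition normalised_haar_SU :: "nat \<Rightarrow> complex mat measure \<Rightarrow> bool" where
  "normalised_haar_SU n M \<longleftrightarrow>
     prob_space M \<and> sets M = sets (SU_borel n) \<and>
     (\<forall>g\<in>SU n. \<forall>S\<in>sets M. emeasure M ((\<lambda>h. g * h) ` S) = emeasure M S)"

text \<open>
  The eigenvalues are the roots of the characteristic polynomial, listed with algebraic
  multiplicity.
\<close>

definition eigenvalue_mset :: "complex mat \<Rightarrow> complex multiset" where
  "eigenvalue_mset A = proots (char_poly A)"

text \<open>
  The integral is taken with respect to an arbitrary measure \<open>M\<close>, to be instantiated with the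
  normalised Haar measure on \<open>SU N\<^sub>c\<close>; the rank \<open>N\<^sub>c\<close> enters only through \<open>M\<close>.
\<close>

definition hilbert_series ::
    "complex mat measure \<Rightarrow> nat \<Rightarrow> real \<Rightarrow> real \<Rightarrow> complex" where
  "hilbert_series M Nf t t' =
     (LINT A|M. (\<Prod>z\<in>#eigenvalue_mset A.
        1 / ((1 - of_real t / z) ^ Nf * (1 - of_real t' * z) ^ Nf)))"

end

(*
  The bracket tends to 1 because t^N and (tt')^N beat the binomials, which are polynomial in N.
  It remains to see that g (1 - tt')^(a^2) tends to 1, where a = N + delta.

  Differentiating the translation invariance of Haar measure along one-parameter curves gives an
  integration by parts formula, hence loop equations for the complete homogeneous functions h_m of
  the eigenvalues. Comparing Casimir eigenvalues in them shows that the integral of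
  h_{m_1} ... h_{m_N} vanishes unless all m_j are equal. By Newton's identities the product of f(z)
  over the eigenvalues z is the determinant of the matrix with entries sum_m f_{m-j+l} h_m, so its
  integral is a combination of the Toeplitz determinants D_k = det (f_{k-j+l}); testing with f = X^k,
  where the product is 1, shows that all coefficients are 1. By approximation g is the sum over all
  integers k of the Toeplitz determinants D_k of the symbol (1 - t/z)^(-a) (1 - t' z)^(-a).

  Andreief's identity writes D_k as a sum of products of two determinants of binomial coefficients,
  each a Vandermonde determinant times a product. This gives D_k <= (C t'^N)^k D_0 and
  D_(-k) <= (C t^N)^k D_0 with C = binomial(N + delta, delta), so only D_0 matters. The same
  determinant of size a instead of N is exactly (1 - tt')^(-a^2), and passing from size a down to
  N costs a factor 1 - O(N^(2 delta) (tt')^N) in each of the delta steps.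
*)
theory Submission
  imports Defs "HOL-Computational_Algebra.Polynomial_FPS"
begin

section \<open>Unitary matrices\<close>

text \<open>The Haar measure is known only through its invariance, so there is no density on the
  eigenvalues to start from. Only traceless directions can be differentiated, so the diagonal
  derivatives have equal integrals instead of vanishing ones, and the loop equations carry the
  degree s of the integrand on the right. For a product of n functions h_m, summing over the rows
  compares s^2 with a number that exceeds n times the sum of the m_j^2 unless the m_j agree;
  Cauchy-Schwarz then forces the integral to be 0. The Toeplitz determinants have size N but a
  symbol with exponent a = N + delta. An exact value is available only when size and exponent agree,
  because then the binomial determinants are, up to sign, pure Vandermonde determinants. Lowering
  the size at fixed exponent costs a determinant in which both series are shifted by one. A common
  shift changes only the product in front of the Vandermonde determinant, so all comparisons can be
  made term by term between sums of nonnegative terms.\<close>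

lemma mat_adjoint_index:
  assumes "A \<in> carrier_mat n m" "i < m" "j < n"
  shows "mat_adjoint A $$ (i, j) = conjugate (A $$ (j, i))"
  using assms by (simp add: mat_adjoint_def mat_of_rows_def)

lemma mat_adjoint_carrier: "A \<in> carrier_mat n m \<Longrightarrow> mat_adjoint A \<in> carrier_mat m n"
  by (auto simp: mat_adjoint_def mat_of_rows_def)

lemma mat_mult_index:
  assumes "A \<in> carrier_mat n m" "B \<in> carrier_mat m l" "i < n" "j < l"
  shows "(A * B) $$ (i, j) = (\<Sum>k<m. A $$ (i, k) * B $$ (k, j))"
  using assms by (auto simp: scalar_prod_def lessThan_atLeast0 intro!: sum.cong)

lemma SU_carrier: "A \<in> SU n \<Longrightarrow> A \<in> carrier_mat n n"
  by (simp add: SU_def)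

lemma SU_unitary_iff:
  assumes "A \<in> carrier_mat n n"
  shows "mat_adjoint A * A = 1\<^sub>m n \<longleftrightarrow>
    (\<forall>i<n. \<forall>j<n. (\<Sum>k<n. cnj (A $$ (k, i)) * A $$ (k, j)) = (if i = j then 1 else 0))"
proof -
  have *: "(mat_adjoint A * A) $$ (i, j) = (\<Sum>k<n. cnj (A $$ (k, i)) * A $$ (k, j))"
    if "i < n" "j < n" for i j
    using mat_mult_index[OF mat_adjoint_carrier[OF assms] assms that] assms that
    by (simp add: mat_adjoint_index[OF assms])
  show ?thesis
    using assms mat_adjoint_carrier[OF assms]
    by (auto simp: mat_eq_iff * simp del: index_mult_mat(1))
qed

lemma SU_row_sum:
  assumes "A \<in> SU n" "i < n" "j < n"
  shows "(\<Sum>k<n. cnj (A $$ (k, i)) * A $$ (k, j)) = (if i = j then 1 else 0)"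
  using assms SU_unitary_iff[OF SU_carrier[OF assms(1)]] by (auto simp: SU_def)

lemma SU_entry_le_1:
  assumes "A \<in> SU n" "i < n" "j < n"
  shows "norm (A $$ (i, j)) \<le> 1"
proof -
  have "complex_of_real (\<Sum>k<n. (norm (A $$ (k, j)))\<^sup>2) = (\<Sum>k<n. cnj (A $$ (k, j)) * A $$ (k, j))"
    unfolding of_real_sum by (intro sum.cong refl) (metis complex_norm_square mult.commute)
  also have "\<dots> = 1" using SU_row_sum[OF assms(1,3,3)] by simp
  finally have "complex_of_real (\<Sum>k<n. (norm (A $$ (k, j)))\<^sup>2) = 1" .
  hence "(\<Sum>k<n. (norm (A $$ (k, j)))\<^sup>2) = 1"
    using of_real_eq_1_iff by blast
  hence "(norm (A $$ (i, j)))\<^sup>2 \<le> 1"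
    using member_le_sum[of i "{..<n}" "\<lambda>k. (norm (A $$ (k, j)))\<^sup>2"] assms by auto
  thus ?thesis by (simp add: power_le_one_iff)
qed

lemma SU_mult:
  assumes "A \<in> SU n" "B \<in> SU n" shows "A * B \<in> SU n"
proof -
  note [simp] = SU_carrier[OF assms(1)] SU_carrier[OF assms(2)]
  have AB: "A * B \<in> carrier_mat n n" by (rule mult_carrier_mat[of _ n n]) simp_all
  have "(\<Sum>k<n. cnj ((A * B) $$ (k, i)) * (A * B) $$ (k, j)) = (if i = j then 1 else 0)"
    if ij: "i < n" "j < n" for i j
  proof -
    have "(\<Sum>k<n. cnj ((A * B) $$ (k, i)) * (A * B) $$ (k, j)) =
      (\<Sum>k<n. \<Sum>p<n. \<Sum>q<n. cnj (A $$ (k, p)) * cnj (B $$ (p, i)) * (A $$ (k, q) * B $$ (q, j)))"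
      using ij by (intro sum.cong refl) (simp add: mat_mult_index[of _ n n _ n] sum_product del: index_mult_mat(1))
    also have "\<dots> = (\<Sum>p<n. \<Sum>q<n. \<Sum>k<n. cnj (A $$ (k, p)) * cnj (B $$ (p, i)) * (A $$ (k, q) * B $$ (q, j)))"
      by (subst sum.swap, rule sum.cong[OF refl], subst sum.swap) simp
    also have "\<dots> = (\<Sum>p<n. \<Sum>q<n. cnj (B $$ (p, i)) * B $$ (q, j) * (\<Sum>k<n. cnj (A $$ (k, p)) * A $$ (k, q)))"
      by (simp add: sum_distrib_left mult_ac)
    also have "\<dots> = (\<Sum>p<n. cnj (B $$ (p, i)) * B $$ (p, j))"
    proof (rule sum.cong[OF refl])
      fix p assume p: "p \<in> {..<n}"
      have "(\<Sum>q<n. cnj (B $$ (p, i)) * B $$ (q, j) * (\<Sum>k<n. cnj (A $$ (k, p)) * A $$ (k, q)))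
         = (\<Sum>q<n. if p = q then cnj (B $$ (p, i)) * B $$ (q, j) else 0)"
        using SU_row_sum[OF assms(1)] p by (intro sum.cong refl) simp
      also have "\<dots> = cnj (B $$ (p, i)) * B $$ (p, j)" using p by simp
      finally show "(\<Sum>q<n. cnj (B $$ (p, i)) * B $$ (q, j) * (\<Sum>k<n. cnj (A $$ (k, p)) * A $$ (k, q)))
        = cnj (B $$ (p, i)) * B $$ (p, j)" .
    qed
    also have "\<dots> = (if i = j then 1 else 0)"
      using SU_row_sum[OF assms(2)] ij by simp
    finally show ?thesis .
  qed
  moreover have "Determinant.det (A * B) = 1"
    using assms by (simp add: Determinant.det_mult[of A n B] SU_def)
  ultimately show ?thesis using AB SU_unitary_iff[OF AB] by (auto simp: SU_def)
qed

lemma SU_adjoint: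
  assumes "A \<in> SU n"
  shows "mat_adjoint A \<in> SU n" "A * mat_adjoint A = 1\<^sub>m n"
proof -
  note A = SU_carrier[OF assms]
  note Aa = mat_adjoint_carrier[OF A]
  have 1: "mat_adjoint A * A = 1\<^sub>m n" using assms by (simp add: SU_def)
  show 2: "A * mat_adjoint A = 1\<^sub>m n"
    using mat_mult_left_right_inverse[OF Aa A 1] .
  have 3: "mat_adjoint (mat_adjoint A) = A"
    using A Aa mat_adjoint_carrier[OF Aa]
    by (auto simp: mat_eq_iff mat_adjoint_index[OF A] mat_adjoint_index[OF Aa])
  \<comment> \<open>The adjoint is an inverse, so multiplicativity gives its determinant without
    computing that of a conjugate transpose.\<close>
  have "Determinant.det (mat_adjoint A) * Determinant.det A = 1"
    using Determinant.det_mult[OF Aa A] 1 by simp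
  hence "Determinant.det (mat_adjoint A) = 1" using assms by (simp add: SU_def)
  thus "mat_adjoint A \<in> SU n" using 2 3 Aa by (simp add: SU_def)
qed

section \<open>Integration by parts for the Haar measure\<close>

definition dev1 :: "complex mat \<Rightarrow> nat \<times> nat \<Rightarrow> complex" where
  "dev1 g ij = g $$ ij - (if fst ij = snd ij then 1 else 0)"

text \<open>The entrywise l1-norm of g - 1: a common bound on the gradient components bounds the
  linear term of an expansion with no further constant.\<close>

definition dist1 :: "nat \<Rightarrow> complex mat \<Rightarrow> real" where
  "dist1 n g = (\<Sum>ij\<in>{..<n} \<times> {..<n}. norm (dev1 g ij))"

text \<open>\<open>G (i, j)\<close> is the derivative of \<open>F\<close> at \<open>A\<close> along \<open>E\<^sub>i\<^sub>j A\<close>; the error is uniform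
  over the group.\<close>

definition grad_bound ::
  "nat \<Rightarrow> (complex mat \<Rightarrow> complex) \<Rightarrow> (nat \<times> nat \<Rightarrow> complex mat \<Rightarrow> complex) \<Rightarrow> real \<Rightarrow> bool" where
  "grad_bound n F G C \<longleftrightarrow> (\<forall>A\<in>SU n. norm (F A) \<le> C \<and>
     (\<forall>ij\<in>{..<n} \<times> {..<n}. norm (G ij A) \<le> C) \<and>
     (\<forall>g\<in>SU n. norm (F (g * A) - F A - (\<Sum>ij\<in>{..<n} \<times> {..<n}. dev1 g ij * G ij A))
       \<le> C * (dist1 n g)\<^sup>2))"

text \<open>Measurability is included because a function and its gradient components all have to be
  integrable.\<close>

definition has_grad ::
  "nat \<Rightarrow> (complex mat \<Rightarrow> complex) \<Rightarrow> (nat \<times> nat \<Rightarrow> complex mat \<Rightarrow> complex) \<Rightarrow> bool" where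
  "has_grad n F G \<longleftrightarrow> F \<in> borel_measurable (SU_borel n) \<and>
     (\<forall>ij\<in>{..<n} \<times> {..<n}. G ij \<in> borel_measurable (SU_borel n)) \<and>
     (\<exists>C\<ge>0. grad_bound n F G C)"

lemma grad_boundD:
  assumes "grad_bound n F G C" "A \<in> SU n"
  shows "norm (F A) \<le> C" and "ij \<in> {..<n} \<times> {..<n} \<Longrightarrow> norm (G ij A) \<le> C"
    and "g \<in> SU n \<Longrightarrow> norm (F (g * A) - F A - (\<Sum>ij\<in>{..<n} \<times> {..<n}. dev1 g ij * G ij A))
       \<le> C * (dist1 n g)\<^sup>2"
  using assms unfolding grad_bound_def by blast+

lemma has_grad_measurable:
  assumes "has_grad n F G"
  shows "F \<in> borel_measurable (SU_borel n)"
    and "ij \<in> {..<n} \<times> {..<n} \<Longrightarrow> G ij \<in> borel_measurable (SU_borel n)"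
  using assms unfolding has_grad_def by blast+

lemma has_gradE:
  assumes "has_grad n F G"
  obtains C where "C \<ge> 0" "grad_bound n F G C"
  using assms unfolding has_grad_def by blast

lemma dist1_nonneg: "0 \<le> dist1 n g"
  unfolding dist1_def by (intro sum_nonneg) simp

lemma dist1_le:
  assumes "g \<in> SU n" shows "dist1 n g \<le> 2 * real n * real n"
proof -
  have "norm (dev1 g ij) \<le> 2" if "ij \<in> {..<n} \<times> {..<n}" for ij
  proof -
    have "norm (dev1 g ij) \<le> norm (g $$ ij) + norm (if fst ij = snd ij then 1 else (0::complex))"
      unfolding dev1_def by (rule norm_triangle_ineq4)
    also have "\<dots> \<le> 1 + 1"
      using that SU_entry_le_1[OF assms] by (intro add_mono) auto
    finally show ?thesis by simp
  qed
  hence "dist1 n g \<le> (\<Sum>ij\<in>{..<n} \<times> {..<n}. 2)"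
    unfolding dist1_def by (intro sum_mono)
  thus ?thesis by simp
qed

lemma has_grad_const: "has_grad n (\<lambda>_. c) (\<lambda>_ _. 0)"
  unfolding has_grad_def grad_bound_def by (auto intro!: exI[of _ "norm c"])

lemma measurable_SU_entry:
  assumes "i < n" "j < n"
  shows "(\<lambda>A. A $$ (i, j)) \<in> borel_measurable (SU_borel n)"
proof -
  let ?f = "\<lambda>A::complex mat. \<lambda>ij\<in>{..<n} \<times> {..<n}. A $$ ij"
  have 1: "?f \<in> SU_borel n \<rightarrow>\<^sub>M PiM ({..<n} \<times> {..<n}) (\<lambda>_. borel)"
    unfolding SU_borel_def
    by (rule measurable_vimage_algebra1) (auto simp: space_PiM)
  have 2: "(\<lambda>x. x (i, j)) \<in> PiM ({..<n} \<times> {..<n}) (\<lambda>_. borel :: complex measure) \<rightarrow>\<^sub>M borel"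
    by (rule measurable_component_singleton) (use assms in auto)
  show ?thesis using measurable_comp[OF 1 2] assms by (simp add: comp_def)
qed

text \<open>The product g * A is linear in g, so the first-order expansion is exact; the constant 1
  bounds the entries of A.\<close>

lemma has_grad_entry:
  assumes "k < n" "l < n"
  shows "has_grad n (\<lambda>A. A $$ (k, l)) (\<lambda>ij A. if fst ij = k then A $$ (snd ij, l) else 0)"
proof -
  have "(g * A) $$ (k, l) - A $$ (k, l) = (\<Sum>ij\<in>{..<n} \<times> {..<n}. dev1 g ij * (if fst ij = k then A $$ (snd ij, l) else 0))"
    if "g \<in> SU n" "A \<in> SU n" for g A
  proof -
    have "(\<Sum>ij\<in>{..<n} \<times> {..<n}. dev1 g ij * (if fst ij = k then A $$ (snd ij, l) else 0))
      = (\<Sum>i<n. \<Sum>j<n. if i = k then dev1 g (i, j) * A $$ (j, l) else 0)"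
      by (subst sum.cartesian_product) (auto intro!: sum.cong)
    also have "\<dots> = (\<Sum>j<n. dev1 g (k, j) * A $$ (j, l))"
      using assms by (subst sum.swap) simp
    also have "\<dots> = (\<Sum>j<n. g $$ (k, j) * A $$ (j, l) - (if k = j then A $$ (j, l) else 0))"
      by (intro sum.cong refl) (auto simp: dev1_def algebra_simps)
    also have "\<dots> = (g * A) $$ (k, l) - A $$ (k, l)"
      using assms that by (simp add: sum_subtractf mat_mult_index[OF SU_carrier SU_carrier] del: index_mult_mat(1))
    finally show ?thesis by simp
  qed
  thus ?thesis unfolding has_grad_def grad_bound_def
    using assms by (auto intro!: exI[of _ 1] measurable_If measurable_SU_entry SU_entry_le_1 simp del: index_mult_mat(1))
qed

lemma has_grad_add:
  assumes "has_grad n F1 G1" "has_grad n F2 G2"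
  shows "has_grad n (\<lambda>A. F1 A + F2 A) (\<lambda>ij A. G1 ij A + G2 ij A)"
proof -
  obtain C1 where C1: "C1 \<ge> 0" "grad_bound n F1 G1 C1"
    using assms(1) unfolding has_grad_def by blast
  obtain C2 where C2: "C2 \<ge> 0" "grad_bound n F2 G2 C2"
    using assms(2) unfolding has_grad_def by blast
  note C = C1(1) C2(1)
  note 1 = C1(2)[unfolded grad_bound_def, THEN bspec]
  note 2 = C2(2)[unfolded grad_bound_def, THEN bspec]
  have "norm (F1 (g * A) + F2 (g * A) - (F1 A + F2 A) - (\<Sum>ij\<in>{..<n} \<times> {..<n}. dev1 g ij * (G1 ij A + G2 ij A)))
     \<le> (C1 + C2) * (dist1 n g)\<^sup>2" if "A \<in> SU n" "g \<in> SU n" for g A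
  proof -
    have "F1 (g * A) + F2 (g * A) - (F1 A + F2 A) - (\<Sum>ij\<in>{..<n} \<times> {..<n}. dev1 g ij * (G1 ij A + G2 ij A))
      = (F1 (g * A) - F1 A - (\<Sum>ij\<in>{..<n} \<times> {..<n}. dev1 g ij * G1 ij A)) + (F2 (g * A) - F2 A - (\<Sum>ij\<in>{..<n} \<times> {..<n}. dev1 g ij * G2 ij A))"
      by (simp add: algebra_simps sum.distrib)
    also have "norm \<dots> \<le> C1 * (dist1 n g)\<^sup>2 + C2 * (dist1 n g)\<^sup>2"
      using 1[OF that(1)] 2[OF that(1)] that(2) by (intro norm_triangle_mono) auto
    finally show ?thesis by (simp add: algebra_simps)
  qed
  moreover have "norm (F1 A + F2 A) \<le> C1 + C2" if "A \<in> SU n" for A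
    using 1[OF that] 2[OF that] by (intro norm_triangle_mono) auto
  moreover have "norm (G1 ij A + G2 ij A) \<le> C1 + C2" if "A \<in> SU n" "ij \<in> {..<n} \<times> {..<n}" for A ij
    using 1[OF that(1)] 2[OF that(1)] that(2) by (intro norm_triangle_mono) auto
  ultimately have "grad_bound n (\<lambda>A. F1 A + F2 A) (\<lambda>ij A. G1 ij A + G2 ij A) (C1 + C2)"
    unfolding grad_bound_def by blast
  moreover have "0 \<le> C1 + C2" using C by simp
  ultimately show ?thesis
    using assms unfolding has_grad_def by (blast intro: borel_measurable_add)
qed

text \<open>In the Leibniz rule the new error is the product of the two increments, so a Lipschitz
  bound is needed for each factor. It follows from the expansion itself, since the group is
  bounded.\<close>

lemma has_grad_mult:
  assumes "has_grad n F1 G1" "has_grad n F2 G2"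
  shows "has_grad n (\<lambda>A. F1 A * F2 A) (\<lambda>ij A. G1 ij A * F2 A + F1 A * G2 ij A)"
proof -
  let ?P = "{..<n} \<times> {..<n}"
  obtain C1 where C1: "C1 \<ge> 0" "grad_bound n F1 G1 C1"
    using assms(1) unfolding has_grad_def by blast
  obtain C2 where C2: "C2 \<ge> 0" "grad_bound n F2 G2 C2"
    using assms(2) unfolding has_grad_def by blast
  note C = C1(1) C2(1)
  note 1 = C1(2)[unfolded grad_bound_def, THEN bspec]
  note 2 = C2(2)[unfolded grad_bound_def, THEN bspec]
  \<comment> \<open>An upper bound for \<open>dist1\<close> on the group: it turns the quadratic
    remainder into a linear one.\<close>
  define W where "W = 2 * real n * real n"
  have W: "W \<ge> 0" by (simp add: W_def)
  have lip: "norm (F (g * A) - F A) \<le> K * (1 + W) * dist1 n g"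
    if A: "A \<in> SU n" and g: "g \<in> SU n" and K: "K \<ge> 0"
      "\<forall>ij\<in>?P. norm (G ij A) \<le> K" "norm (F (g * A) - F A - (\<Sum>ij\<in>?P. dev1 g ij * G ij A)) \<le> K * (dist1 n g)\<^sup>2"
    for F :: "complex mat \<Rightarrow> complex" and G K A g
  proof -
    have "norm (F (g * A) - F A) \<le> norm (F (g * A) - F A - (\<Sum>ij\<in>?P. dev1 g ij * G ij A)) + norm (\<Sum>ij\<in>?P. dev1 g ij * G ij A)"
      using norm_triangle_ineq[of "F (g * A) - F A - (\<Sum>ij\<in>?P. dev1 g ij * G ij A)" "\<Sum>ij\<in>?P. dev1 g ij * G ij A"]
      by simp
    also have "norm (\<Sum>ij\<in>?P. dev1 g ij * G ij A) \<le> (\<Sum>ij\<in>?P. norm (dev1 g ij) * K)"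
      using K by (intro sum_norm_le) (auto simp: norm_mult intro!: mult_left_mono)
    also have "\<dots> = K * dist1 n g" by (simp add: dist1_def sum_distrib_left mult.commute)
    also have "norm (F (g * A) - F A - (\<Sum>ij\<in>?P. dev1 g ij * G ij A)) \<le> K * (W * dist1 n g)"
      using K(1) dist1_le[OF g] dist1_nonneg[of n g] unfolding power2_eq_square W_def
      by (intro order_trans[OF K(3)[unfolded power2_eq_square]] mult_left_mono mult_right_mono)
    finally show ?thesis by (simp add: algebra_simps)
  qed
  define C where "C = C1 * C2 * (2 + (1 + W)\<^sup>2)"
  have Cge: "C1 * C2 * 2 \<le> C" "0 \<le> C"
    unfolding C_def using C W by (auto intro!: mult_left_mono mult_nonneg_nonneg add_nonneg_nonneg)
  have "norm (F1 (g * A) * F2 (g * A) - (F1 A * F2 A) - (\<Sum>ij\<in>?P. dev1 g ij * (G1 ij A * F2 A + F1 A * G2 ij A)))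
     \<le> C * (dist1 n g)\<^sup>2" if A: "A \<in> SU n" "g \<in> SU n" for g A
  proof -
    let ?L1 = "\<Sum>ij\<in>?P. dev1 g ij * G1 ij A" and ?L2 = "\<Sum>ij\<in>?P. dev1 g ij * G2 ij A"
    have s: "(\<Sum>ij\<in>?P. dev1 g ij * (G1 ij A * F2 A + F1 A * G2 ij A)) = ?L1 * F2 A + F1 A * ?L2"
      by (simp add: algebra_simps sum.distrib sum_distrib_left sum_distrib_right)
    have "F1 (g * A) * F2 (g * A) - (F1 A * F2 A) - (\<Sum>ij\<in>?P. dev1 g ij * (G1 ij A * F2 A + F1 A * G2 ij A))
      = (F1 (g * A) - F1 A - ?L1) * F2 A + F1 A * (F2 (g * A) - F2 A - ?L2) + (F1 (g * A) - F1 A) * (F2 (g * A) - F2 A)"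
      unfolding s by (simp add: algebra_simps)
    also have "norm \<dots> \<le> (C1 * (dist1 n g)\<^sup>2) * C2 + C1 * (C2 * (dist1 n g)\<^sup>2) + (C1 * (1 + W) * dist1 n g) * (C2 * (1 + W) * dist1 n g)"
      using 1[OF A(1)] 2[OF A(1)] A C W dist1_nonneg[of n g]
      by (intro norm_triangle_mono; unfold norm_mult; intro mult_mono lip[of A g C1 G1] lip[of A g C2 G2]; auto)
    also have "\<dots> = C * (dist1 n g)\<^sup>2" by (simp add: C_def algebra_simps power2_eq_square)
    finally show ?thesis .
  qed
  moreover have "norm (F1 A * F2 A) \<le> C" if "A \<in> SU n" for A
  proof -
    have "norm (F1 A * F2 A) \<le> C1 * C2"
      using 1[OF that] 2[OF that] C unfolding norm_mult by (intro mult_mono) auto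
    also have "\<dots> \<le> C1 * C2 * 2" using C by simp
    finally show ?thesis using Cge by simp
  qed
  moreover have "norm (G1 ij A * F2 A + F1 A * G2 ij A) \<le> C" if "A \<in> SU n" "ij \<in> ?P" for A ij
  proof -
    have "norm (G1 ij A * F2 A + F1 A * G2 ij A) \<le> C1 * C2 + C1 * C2"
      using 1[OF that(1)] 2[OF that(1)] C that(2)
      by (intro norm_triangle_mono; unfold norm_mult; intro mult_mono) auto
    thus ?thesis using Cge by simp
  qed
  ultimately have "grad_bound n (\<lambda>A. F1 A * F2 A) (\<lambda>ij A. G1 ij A * F2 A + F1 A * G2 ij A) C"
    unfolding grad_bound_def by blast
  thus ?thesis
    using assms Cge unfolding has_grad_def by (intro conjI ballI borel_measurable_add borel_measurable_times) blast+
qed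

lemma has_grad_sum:
  assumes "finite I" "\<And>x. x \<in> I \<Longrightarrow> has_grad n (F x) (G x)"
  shows "has_grad n (\<lambda>A. \<Sum>x\<in>I. F x A) (\<lambda>ij A. \<Sum>x\<in>I. G x ij A)"
  using assms by (induction I rule: finite_induct) (auto intro!: has_grad_const has_grad_add)

text \<open>Only values on \<open>SU n\<close> are constrained, so formulas that need the matrix to
  be in the group may be substituted freely.\<close>

lemma has_grad_cong:
  assumes "has_grad n F G" "\<And>A. A \<in> SU n \<Longrightarrow> F A = F' A"
    "\<And>A i j. A \<in> SU n \<Longrightarrow> i < n \<Longrightarrow> j < n \<Longrightarrow> G (i, j) A = G' (i, j) A"
  shows "has_grad n F' G'"
proof -
  have sp: "space (SU_borel n) = SU n" by (simp add: SU_borel_def)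
  have 1: "F \<in> borel_measurable (SU_borel n) \<longleftrightarrow> F' \<in> borel_measurable (SU_borel n)"
    by (rule measurable_cong) (simp add: assms sp)
  have 2: "G ij \<in> borel_measurable (SU_borel n) \<longleftrightarrow> G' ij \<in> borel_measurable (SU_borel n)"
    if "ij \<in> {..<n} \<times> {..<n}" for ij
    by (rule measurable_cong) (use that in \<open>auto simp: assms sp\<close>)
  have 3: "(\<Sum>ij\<in>{..<n} \<times> {..<n}. dev1 g ij * G ij A) = (\<Sum>ij\<in>{..<n} \<times> {..<n}. dev1 g ij * G' ij A)"
    if "A \<in> SU n" for A g
    by (intro sum.cong refl) (use that in \<open>auto simp: assms\<close>)
  have 4: "grad_bound n F G C \<longleftrightarrow> grad_bound n F' G' C" for C
    unfolding grad_bound_def by (intro ball_cong refl) (auto simp: 3 assms(2,3) SU_mult)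
  show ?thesis
    using assms(1) unfolding has_grad_def 1 4 by (simp add: 2)
qed

section \<open>Translation invariance of integrals and its derivative\<close>

locale haar =
  fixes n :: nat and M :: "complex mat measure"
  assumes haar: "normalised_haar_SU n M"
begin

sublocale prob_space M
  using haar by (simp add: normalised_haar_SU_def)

lemma sets_M: "sets M = sets (SU_borel n)"
  using haar by (simp add: normalised_haar_SU_def)

lemma space_M: "space M = SU n"
  using sets_eq_imp_space_eq[OF sets_M] by (simp add: SU_borel_def)

lemma measurable_M: "borel_measurable M = borel_measurable (SU_borel n)"
  by (rule measurable_cong_sets[OF sets_M refl])

lemma has_grad_integrable:
  assumes "has_grad n F G"
  shows "integrable M F" and "ij \<in> {..<n} \<times> {..<n} \<Longrightarrow> integrable M (G ij)"
proof -
  obtain C where C: "grad_bound n F G C" using assms by (rule has_gradE)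
  show "integrable M F"
    using grad_boundD(1)[OF C] has_grad_measurable(1)[OF assms]
    by (intro integrable_const_bound[where B = C] AE_I2) (simp_all add: measurable_M space_M)
  show "integrable M (G ij)" if "ij \<in> {..<n} \<times> {..<n}"
    using grad_boundD(2)[OF C _ that] has_grad_measurable(2)[OF assms that]
    by (intro integrable_const_bound[where B = C] AE_I2) (simp_all add: measurable_M space_M)
qed

lemma measurable_translate:
  assumes g: "g \<in> SU n"
  shows "(\<lambda>A. g * A) \<in> M \<rightarrow>\<^sub>M M"
proof -
  have sp: "space (SU_borel n) = SU n" by (simp add: SU_borel_def)
  have e: "(\<lambda>A. (g * A) $$ ij) \<in> borel_measurable (SU_borel n)" if "ij \<in> {..<n} \<times> {..<n}" for ij
  proof -
    obtain i j where ij: "ij = (i, j)" "i < n" "j < n" using \<open>ij \<in> _\<close> by auto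
    have "(\<lambda>A. \<Sum>k<n. g $$ (i, k) * A $$ (k, j)) \<in> borel_measurable (SU_borel n)"
      using ij by (intro borel_measurable_sum borel_measurable_times measurable_SU_entry) auto
    thus ?thesis
      by (rule iffD2[OF measurable_cong, rotated])
        (use ij g in \<open>auto simp: sp mat_mult_index[OF SU_carrier SU_carrier] simp del: index_mult_mat(1)\<close>)
  qed
  have "(\<lambda>A. g * A) \<in> SU_borel n \<rightarrow>\<^sub>M vimage_algebra (SU n)
     (\<lambda>A. \<lambda>ij\<in>{..<n} \<times> {..<n}. A $$ ij)
     (PiM ({..<n} \<times> {..<n}) (\<lambda>_. borel :: complex measure))"
    using g e by (intro measurable_vimage_algebra2 measurable_restrict) (auto simp: sp SU_mult)
  thus ?thesis
    using measurable_cong_sets[OF sets_M sets_M] by (simp add: SU_borel_def)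
qed

lemma integral_translate:
  fixes f :: "complex mat \<Rightarrow> complex"
  assumes g: "g \<in> SU n" and f: "f \<in> borel_measurable M"
  shows "(LINT A|M. f (g * A)) = (LINT A|M. f A)"
proof -
  have g': "mat_adjoint g \<in> SU n" "mat_adjoint g * g = 1\<^sub>m n" "g * mat_adjoint g = 1\<^sub>m n"
    using SU_adjoint[OF g] g by (auto simp: SU_def)
  note c = SU_carrier[OF g] SU_carrier[OF g'(1)]
  have inv: "mat_adjoint g * (g * A) = A" "g * (mat_adjoint g * A) = A" if "A \<in> SU n" for A
    using g' c SU_carrier[OF that]
    by (simp_all flip: assoc_mult_mat[of _ n n _ n _ n])
  \<comment> \<open>Invariance is stated for images of sets; a preimage under translation by g is
    the image under translation by the adjoint of g.\<close>
  have "distr M M (\<lambda>A. g * A) = M"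
  proof (rule measure_eqI)
    fix S assume "S \<in> sets (distr M M (\<lambda>A. g * A))"
    hence S: "S \<in> sets M" by simp
    have sub: "S \<subseteq> SU n" using sets.sets_into_space[OF S] space_M by simp
    have "(\<lambda>A. g * A) -` S \<inter> space M = (\<lambda>h. mat_adjoint g * h) ` S"
    proof (intro equalityI subsetI)
      fix A assume "A \<in> (\<lambda>A. g * A) -` S \<inter> space M"
      hence "A = mat_adjoint g * (g * A)" "g * A \<in> S" using inv by (auto simp: space_M)
      thus "A \<in> (\<lambda>h. mat_adjoint g * h) ` S" by blast
    next
      fix A assume "A \<in> (\<lambda>h. mat_adjoint g * h) ` S"
      then obtain h where h: "h \<in> S" "A = mat_adjoint g * h" by auto
      thus "A \<in> (\<lambda>A. g * A) -` S \<inter> space M"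
        using inv sub SU_mult[OF g'(1)] by (auto simp: space_M)
    qed
    thus "emeasure (distr M M (\<lambda>A. g * A)) S = emeasure M S"
      using S haar g'(1) by (simp add: emeasure_distr measurable_translate[OF g] normalised_haar_SU_def)
  qed simp
  hence "(LINT A|M. f A) = (LINT A|distr M M (\<lambda>A. g * A). f A)" by simp
  also have "\<dots> = (LINT A|M. f (g * A))"
    using f by (intro integral_distr measurable_translate g)
  finally show ?thesis by simp
qed

text \<open>Differentiating \<open>\<integral> F (g s * A) d\<mu> = \<integral> F A d\<mu>\<close> along a curve \<open>g\<close> through \<open>1\<close> with velocity \<open>X\<close>.\<close>

lemma grad_curve:
  assumes F: "has_grad n F G" and c: "c \<ge> 0" "d \<ge> 0"
    and g: "\<And>s. 0 < s \<Longrightarrow> s \<le> 1 \<Longrightarrow> g s \<in> SU n"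
    and dist: "\<And>s. 0 < s \<Longrightarrow> s \<le> 1 \<Longrightarrow> dist1 n (g s) \<le> c * s"
    and approx: "\<And>s ij. 0 < s \<Longrightarrow> s \<le> 1 \<Longrightarrow> ij \<in> {..<n} \<times> {..<n} \<Longrightarrow>
      norm (dev1 (g s) ij - of_real s * X ij) \<le> d * s\<^sup>2"
  shows "(\<Sum>ij\<in>{..<n} \<times> {..<n}. X ij * (LINT A|M. G ij A)) = 0"
proof -
  let ?P = "{..<n} \<times> {..<n}"
  obtain C where C: "C \<ge> 0" "grad_bound n F G C" using F by (rule has_gradE)
  define I where "I = (\<Sum>ij\<in>?P. X ij * (LINT A|M. G ij A))"
  \<comment> \<open>The first summand accounts for the quadratic remainder of F, the second for the
    deviation of the curve from its tangent.\<close>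
  define K where "K = C * c\<^sup>2 + real (card ?P) * (d * C)"
  have "norm I \<le> K * s" if s: "0 < s" "s \<le> 1" for s
  proof -
    note gs = g[OF s]
    have Fm: "F \<in> borel_measurable M" using has_grad_measurable(1)[OF F] by (simp add: measurable_M)
    have iFg: "integrable M (\<lambda>A. F (g s * A))"
    proof (rule integrable_const_bound[where B = C])
      show "AE A in M. norm (F (g s * A)) \<le> C"
        using grad_boundD(1)[OF C(2) SU_mult[OF gs]] by (intro AE_I2) (simp add: space_M)
      show "(\<lambda>A. F (g s * A)) \<in> borel_measurable M"
        using measurable_comp[OF measurable_translate[OF gs] Fm] by (simp add: comp_def)
    qed
    define R where "R A = F (g s * A) - F A - (\<Sum>ij\<in>?P. dev1 (g s) ij * G ij A)" for A
    have "(LINT A|M. R A) = - (\<Sum>ij\<in>?P. dev1 (g s) ij * (LINT A|M. G ij A))"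
      unfolding R_def
      using iFg has_grad_integrable[OF F] integral_translate[OF gs Fm]
      by (simp add: Bochner_Integration.integral_sum)
    hence 1: "of_real s * I = - (LINT A|M. R A) - (\<Sum>ij\<in>?P. (dev1 (g s) ij - of_real s * X ij) * (LINT A|M. G ij A))"
      by (simp add: I_def sum_distrib_left algebra_simps sum_subtractf)
    have "norm (R A) \<le> C * (c * s)\<^sup>2" if "A \<in> SU n" for A
    proof -
      have "norm (R A) \<le> C * (dist1 n (g s))\<^sup>2"
        using grad_boundD(3)[OF C(2) that gs] by (simp add: R_def)
      also have "\<dots> \<le> C * (c * s)\<^sup>2"
        using C dist[OF s] dist1_nonneg by (intro mult_left_mono power_mono) auto
      finally show ?thesis .
    qed
    moreover have "integrable M R"
      unfolding R_def using iFg has_grad_integrable[OF F] by (intro Bochner_Integration.integrable_diff Bochner_Integration.integrable_sum integrable_mult_right)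
    ultimately have 2: "norm (LINT A|M. R A) \<le> C * (c * s)\<^sup>2"
      by (intro order_trans[OF integral_norm_bound] integral_le_const integrable_norm AE_I2) (simp_all add: space_M)
    have Gb: "norm (LINT A|M. G ij A) \<le> C" if "ij \<in> ?P" for ij
      using grad_boundD(2)[OF C(2) _ that] has_grad_integrable(2)[OF F that]
      by (intro order_trans[OF integral_norm_bound] integral_le_const integrable_norm AE_I2) (simp_all add: space_M)
    have 3: "norm (\<Sum>ij\<in>?P. (dev1 (g s) ij - of_real s * X ij) * (LINT A|M. G ij A)) \<le> (\<Sum>ij\<in>?P. (d * s\<^sup>2) * C)"
      using approx[OF s] Gb C c by (intro sum_norm_le; unfold norm_mult; intro mult_mono) auto
    have "s * norm I = norm (of_real s * I)" using s by (simp add: norm_mult)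
    also have "\<dots> \<le> C * (c * s)\<^sup>2 + (\<Sum>ij\<in>?P. (d * s\<^sup>2) * C)"
      unfolding 1 using 2 3 by (intro order_trans[OF norm_triangle_ineq4] add_mono) simp_all
    also have "\<dots> = s * (K * s)" by (simp add: K_def power2_eq_square algebra_simps)
    finally show ?thesis using s by simp
  qed
  hence "norm I \<le> 0"
  proof (intro tendsto_lowerbound[of "\<lambda>s. K * s" _ "at_right 0"])
    show "((\<lambda>s. K * s) \<longlongrightarrow> 0) (at_right 0)" by (auto intro!: tendsto_eq_intros)
    show "\<forall>\<^sub>F s in at_right 0. norm I \<le> K * s" if "\<And>s. 0 < s \<Longrightarrow> s \<le> 1 \<Longrightarrow> norm I \<le> K * s"
      using that by (auto simp: eventually_at_right_field intro!: exI[of _ 1])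
  qed simp
  thus ?thesis by (simp add: I_def)
qed

end

text \<open>A copy of SU(2) in the rows and columns i and j. The tangent vectors of these subgroups
  at 1 span the Lie algebra, so explicit curves inside them replace the matrix exponential.\<close>

definition SU2_block :: "nat \<Rightarrow> nat \<Rightarrow> nat \<Rightarrow> complex \<Rightarrow> complex \<Rightarrow> complex mat" where
  "SU2_block n i j a b = mat n n (\<lambda>(k, l). if k = i \<and> l = i then a else if k = j \<and> l = j then cnj a
     else if k = i \<and> l = j then b else if k = j \<and> l = i then - cnj b else if k = l then 1 else 0)"

lemma SU2_block_carrier: "SU2_block n i j a b \<in> carrier_mat n n"
  by (simp add: SU2_block_def)

lemma SU2_block_index:
  assumes "i < j" "j < n"
  shows "SU2_block n i j a b $$ (i, i) = a" "SU2_block n i j a b $$ (j, j) = cnj a"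
    "SU2_block n i j a b $$ (i, j) = b" "SU2_block n i j a b $$ (j, i) = - cnj b"
    "k < n \<Longrightarrow> l < n \<Longrightarrow> k \<noteq> i \<Longrightarrow> k \<noteq> j \<Longrightarrow> SU2_block n i j a b $$ (k, l) = (if k = l then 1 else 0)"
    "k < n \<Longrightarrow> l < n \<Longrightarrow> l \<noteq> i \<Longrightarrow> l \<noteq> j \<Longrightarrow> SU2_block n i j a b $$ (k, l) = (if k = l then 1 else 0)"
  using assms by (simp_all add: SU2_block_def)

lemma SU2_block_SU:
  assumes ij: "i < j" "j < n" and a: "a \<noteq> 0" and ab: "a * cnj a + b * cnj b = 1"
  shows "SU2_block n i j a b \<in> SU n"
proof -
  define g where "g = SU2_block n i j a b"
  note ix = SU2_block_index[OF ij, where a = a and b = b, folded g_def]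
  have gc: "g \<in> carrier_mat n n" by (simp add: g_def SU2_block_carrier)
  have ij': "i < n" "i \<noteq> j" using ij by auto
  have "(\<Sum>r<n. cnj (g $$ (r, k)) * g $$ (r, l)) = (if k = l then 1 else 0)" if kl: "k < n" "l < n" for k l
  proof (cases "k = i \<or> k = j")
    case True
    have "cnj (g $$ (r, k)) * g $$ (r, l) = 0" if "r < n" "r \<noteq> i" "r \<noteq> j" for r
      using ix(5)[OF that(1) kl(1) that(2,3)] True that by auto
    hence "(\<Sum>r<n. cnj (g $$ (r, k)) * g $$ (r, l)) = (\<Sum>r\<in>{i, j}. cnj (g $$ (r, k)) * g $$ (r, l))"
      using ij ij' by (intro sum.mono_neutral_right) auto
    also have "\<dots> = cnj (g $$ (i, k)) * g $$ (i, l) + cnj (g $$ (j, k)) * g $$ (j, l)"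
      using ij' by simp
    also have "\<dots> = (if k = l then 1 else 0)"
    proof (cases "l = i \<or> l = j")
      case l: True
      show ?thesis using ab True l ij' by (auto simp: ix(1-4) algebra_simps)
    next
      case False
      thus ?thesis using True kl ij ij' by (auto simp: ix(6))
    qed
    finally show ?thesis .
  next
    case False
    have "cnj (g $$ (r, k)) * g $$ (r, l) = (if r = k then (if k = l then 1 else 0) else 0)" if "r < n" for r
      using ix(6)[OF that kl(1)] ix(5)[OF kl] False by auto
    thus ?thesis using kl by simp
  qed
  hence 1: "mat_adjoint g * g = 1\<^sub>m n"
    using SU_unitary_iff[OF gc] by blast
  \<comment> \<open>Adding \<open>cnj b / a\<close> times row i to row j clears the only entry below
    the diagonal; this is where a must be nonzero.\<close>
  define u where "u = addrow (cnj b / a) j i g"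
  have uc: "u \<in> carrier_mat n n" using gc by (simp add: u_def)
  have u: "u $$ (k, l) = (if k = j then cnj b / a * g $$ (i, l) + g $$ (j, l) else g $$ (k, l))"
    if "k < n" "l < n" for k l using that gc by (simp add: u_def)
  have "Determinant.det g = Determinant.det u"
    using ij ij' det_addrow[OF _ _ gc, of i j] by (simp add: u_def)
  also have "upper_triangular u"
  proof (rule upper_triangularI)
    fix k l assume "l < k" "k < dim_row u"
    hence kl: "l < k" "k < n" "l < n" using uc by auto
    show "u $$ (k, l) = 0"
    proof (cases "k = j")
      case True
      thus ?thesis using kl ij ij' a u[of j l] by (cases "l = i") (auto simp: ix)
    next
      case False
      thus ?thesis using kl ij ij' u[of k l] by (cases "k = i") (auto simp: ix)
    qed
  qed
  hence "Determinant.det u = (\<Prod>k<n. u $$ (k, k))"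
    using det_upper_triangular[OF _ uc] uc
    by (simp add: diag_mat_def prod.list_conv_set_nth lessThan_atLeast0)
  also have "\<dots> = (\<Prod>k\<in>{i, j}. u $$ (k, k))"
    using ij ij' u ix(5) by (intro prod.mono_neutral_right) auto
  also have "\<dots> = u $$ (i, i) * u $$ (j, j)" using ij' by simp
  also have "\<dots> = 1"
    using ij ij' a ab by (simp add: u ix field_simps)
  finally show ?thesis using 1 gc by (simp add: SU_def g_def)
qed

lemma sum_block:
  assumes "i \<noteq> j"
  shows "(\<Sum>kl\<in>{(i,i),(j,j),(i,j),(j,i)}. f kl) = f (i, i) + f (j, j) + f (i, j) + (f (j, i) :: complex)"
  using assms by (simp add: add.assoc)

lemma block_halve:
  fixes p b g1 g2 g3 g4 c :: complex
  assumes "\<i> * p / 2 * g1 + - \<i> * p / 2 * g2 + b / 2 * g3 + - c / 2 * g4 = 0"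
  shows "\<i> * p * (g1 - g2) + b * g3 - c * g4 = 0"
proof -
  have "\<i> * p * (g1 - g2) + b * g3 - c * g4 =
      2 * (\<i> * p / 2 * g1 + - \<i> * p / 2 * g2 + b / 2 * g3 + - c / 2 * g4)"
    by (simp add: distrib_left right_diff_distrib)
  thus ?thesis unfolding assms by simp
qed

context haar begin

text \<open>This is the derivative in the direction with diagonal entries \<open>\<i> * p\<close>,
  \<open>- \<i> * p\<close> and off-diagonal entries b, \<open>- cnj b\<close>. The normalisation of
  p and b allows a curve with an explicit square root.\<close>

lemma grad_SU2:
  assumes F: "has_grad n F G" and ij: "i < j" "j < n" and ab: "p\<^sup>2 + (norm b)\<^sup>2 = 1"
  shows "\<i> * of_real p * ((LINT A|M. G (i, i) A) - (LINT A|M. G (j, j) A))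
    + b * (LINT A|M. G (i, j) A) - cnj b * (LINT A|M. G (j, i) A) = 0"
proof -
  \<comment> \<open>The square root keeps the block determinant equal to 1, and halving s keeps it
    away from 0 up to s = 1, so that \<open>SU2_block_SU\<close> applies.\<close>
  define al where "al s = of_real (sqrt (1 - (s/2)\<^sup>2)) + \<i> * of_real (p * (s/2))" for s
  define g where "g s = SU2_block n i j (al s) (b * of_real (s/2))" for s
  define X where "X kl = (if kl = (i, i) then \<i> * of_real p / 2 else if kl = (j, j) then - \<i> * of_real p / 2
     else if kl = (i, j) then b / 2 else if kl = (j, i) then - cnj b / 2 else 0)" for kl
  have "p\<^sup>2 \<le> 1" "(norm b)\<^sup>2 \<le> 1"
    using ab zero_le_power2[of p] zero_le_power2[of "norm b"] by linarith+
  hence p1: "\<bar>p\<bar> \<le> 1" "norm b \<le> 1"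
    by (simp_all add: abs_square_le_1 power_le_one_iff)
  have sq: "\<bar>sqrt (1 - (s/2)\<^sup>2) - 1\<bar> \<le> s\<^sup>2" if "0 < s" "s \<le> 1" for s :: real
  proof -
    have "(s/2)\<^sup>2 \<le> 1" using that by (simp add: power_le_one)
    hence u: "0 \<le> 1 - (s/2)\<^sup>2" "1 - (s/2)\<^sup>2 \<le> 1" by auto
    have "1 - (s/2)\<^sup>2 \<le> sqrt (1 - (s/2)\<^sup>2)"
      using u by (intro real_le_rsqrt) (simp add: power2_eq_square mult_left_le)
    moreover have "sqrt (1 - (s/2)\<^sup>2) \<le> 1" using u by simp
    moreover have "(s/2)\<^sup>2 \<le> s\<^sup>2" by (simp add: power_divide)
    ultimately show ?thesis by linarith
  qed
  have cn: "cnj (al s) = of_real (sqrt (1 - (s/2)\<^sup>2)) - \<i> * of_real (p * (s/2))" for s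
    by (simp add: al_def)
  have gSU: "g s \<in> SU n" if s: "0 < s" "s \<le> 1" for s
    unfolding g_def
  proof (rule SU2_block_SU[OF ij])
    have "(s/2)\<^sup>2 < 1" using s by (simp add: power_less_one_iff)
    hence "Re (al s) > 0" by (simp add: al_def)
    thus "al s \<noteq> 0" by auto
    have "al s * cnj (al s) = of_real ((norm (al s))\<^sup>2)" by (rule complex_norm_square[symmetric])
    also have "(norm (al s))\<^sup>2 = 1 - (s/2)\<^sup>2 + (p * (s/2))\<^sup>2"
      using \<open>(s/2)\<^sup>2 < 1\<close> by (simp add: al_def cmod_power2)
    finally have 1: "al s * cnj (al s) = of_real (1 - (s/2)\<^sup>2 + (p * (s/2))\<^sup>2)" .
    have "b * of_real (s/2) * cnj (b * of_real (s/2)) = of_real ((norm b)\<^sup>2 * (s/2)\<^sup>2)"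
      using complex_norm_square[of "b * of_real (s/2)"] by (simp add: norm_mult power_mult_distrib power_divide)
    hence "al s * cnj (al s) + b * of_real (s/2) * cnj (b * of_real (s/2)) =
      of_real (1 - (s/2)\<^sup>2 + (p * (s/2))\<^sup>2 + (norm b)\<^sup>2 * (s/2)\<^sup>2)" unfolding 1 by simp
    also have "1 - (s/2)\<^sup>2 + (p * (s/2))\<^sup>2 + (norm b)\<^sup>2 * (s/2)\<^sup>2 = 1 - (s/2)\<^sup>2 + (p\<^sup>2 + (norm b)\<^sup>2) * (s/2)\<^sup>2"
      unfolding power_mult_distrib distrib_right by simp
    also have "\<dots> = 1" using ab by simp
    finally show "al s * cnj (al s) + b * of_real (s/2) * cnj (b * of_real (s/2)) = 1" by simp
  qed
  have approx: "norm (dev1 (g s) kl - of_real s * X kl) \<le> 1 * s\<^sup>2"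
    if s: "0 < s" "s \<le> 1" and kl: "kl \<in> {..<n} \<times> {..<n}" for s kl
  proof -
    obtain k l where kl': "kl = (k, l)" "k < n" "l < n" using kl by auto
    have ne: "i \<noteq> j" "j \<noteq> i" using ij by auto
    have Xs: "X (i, i) = \<i> * of_real p / 2" "X (j, j) = - \<i> * of_real p / 2"
      "X (i, j) = b / 2" "X (j, i) = - cnj b / 2"
      "k \<noteq> i \<Longrightarrow> k \<noteq> j \<Longrightarrow> X (k, l) = 0" "l \<noteq> i \<Longrightarrow> l \<noteq> j \<Longrightarrow> X (k, l) = 0"
      using ne by (simp_all add: X_def)
    note gs = SU2_block_index[OF ij, where a = "al s" and b = "b * of_real (s/2)", folded g_def]
    \<comment> \<open>The off-diagonal entries are linear in s, so the error of the square root is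
      the only deviation from the tangent.\<close>
    define e where "e = complex_of_real (sqrt (1 - (s/2)\<^sup>2) - 1)"
    have al_e: "al s = 1 + e + \<i> * of_real (p * (s/2))" "cnj (al s) = 1 + e - \<i> * of_real (p * (s/2))"
      by (simp_all add: e_def al_def)
    consider "k = i" "l = i" | "k = j" "l = j" | "k = i" "l = j" | "k = j" "l = i"
        | "k \<noteq> i" "k \<noteq> j" | "l \<noteq> i" "l \<noteq> j" by blast
    hence "dev1 (g s) kl - of_real s * X kl = e \<or> dev1 (g s) kl - of_real s * X kl = 0"
    proof cases
      case 1 thus ?thesis by (simp add: kl' dev1_def gs Xs al_e)
    next
      case 2 thus ?thesis by (simp add: kl' dev1_def gs Xs al_e e_def)
    next
      case 3 thus ?thesis using ne by (simp add: kl' dev1_def gs Xs)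
    next
      case 4 thus ?thesis using ne by (simp add: kl' dev1_def gs Xs)
    next
      case 5 thus ?thesis using kl' by (simp add: kl' dev1_def gs(5) Xs(5))
    next
      case 6 thus ?thesis using kl' by (simp add: kl' dev1_def gs(6) Xs(6))
    qed
    moreover have "norm e \<le> s\<^sup>2"
      using sq[OF s] unfolding e_def norm_of_real .
    ultimately show ?thesis by auto
  qed
  have dist: "dist1 n (g s) \<le> (2 * real (card ({..<n} \<times> {..<n}))) * s" if s: "0 < s" "s \<le> 1" for s
  proof -
    have "norm (dev1 (g s) kl) \<le> 2 * s" if kl: "kl \<in> {..<n} \<times> {..<n}" for kl
    proof -
      consider "X kl = \<i> * of_real p / 2" | "X kl = - \<i> * of_real p / 2" | "X kl = b / 2" | "X kl = - cnj b / 2" | "X kl = 0"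
        unfolding X_def by metis
      hence "norm (X kl) \<le> 1"
      proof cases
        case 1
        have "norm (X kl) = \<bar>p\<bar> / 2" unfolding 1 by (simp add: norm_mult norm_divide)
        thus ?thesis using p1(1) by simp
      next
        case 2
        have "norm (X kl) = \<bar>p\<bar> / 2" unfolding 2 by (simp add: norm_mult norm_divide)
        thus ?thesis using p1(1) by simp
      next
        case 3
        have "norm (X kl) = norm b / 2" unfolding 3 by (simp add: norm_mult norm_divide)
        thus ?thesis using p1(2) by simp
      next
        case 4
        have "norm (X kl) = norm b / 2" unfolding 4 by (simp add: norm_mult norm_divide)
        thus ?thesis using p1(2) by simp
      qed simp
      hence "norm (of_real s * X kl) \<le> s * 1"
        using s unfolding norm_mult by (intro mult_mono) simp_all
      moreover have "s\<^sup>2 \<le> s * 1" using s unfolding power2_eq_square by (intro mult_left_mono) simp_all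
      moreover note approx[OF s kl]
      moreover have "norm (dev1 (g s) kl) \<le> norm (dev1 (g s) kl - of_real s * X kl) + norm (of_real s * X kl)"
        using norm_triangle_ineq[of "dev1 (g s) kl - of_real s * X kl" "of_real s * X kl"]
        by (simp only: diff_add_cancel)
      ultimately show ?thesis by linarith
    qed
    hence "dist1 n (g s) \<le> (\<Sum>kl\<in>{..<n} \<times> {..<n}. 2 * s)"
      unfolding dist1_def by (intro sum_mono)
    thus ?thesis by simp
  qed
  have "(\<Sum>kl\<in>{..<n} \<times> {..<n}. X kl * (LINT A|M. G kl A)) = 0"
  proof (rule grad_curve[OF F, where g = g and c = "2 * real (card ({..<n} \<times> {..<n}))" and d = 1])
    show "g s \<in> SU n" if "0 < s" "s \<le> 1" for s using gSU[OF that] .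
    show "dist1 n (g s) \<le> 2 * real (card ({..<n} \<times> {..<n})) * s" if "0 < s" "s \<le> 1" for s
      using dist[OF that] .
    show "norm (dev1 (g s) kl - of_real s * X kl) \<le> 1 * s\<^sup>2"
      if "0 < s" "s \<le> 1" "kl \<in> {..<n} \<times> {..<n}" for s kl
      using approx[OF that] .
  qed simp_all
  moreover have "(\<Sum>kl\<in>{..<n} \<times> {..<n}. X kl * (LINT A|M. G kl A)) = (\<Sum>kl\<in>{(i,i),(j,j),(i,j),(j,i)}. X kl * (LINT A|M. G kl A))"
  proof (rule sum.mono_neutral_right)
    show "{(i,i),(j,j),(i,j),(j,i)} \<subseteq> {..<n} \<times> {..<n}" using ij by simp
    have "X kl = 0" if "kl \<notin> {(i,i),(j,j),(i,j),(j,i)}" for kl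
      using that unfolding X_def by simp
    thus "\<forall>kl\<in>{..<n} \<times> {..<n} - {(i,i),(j,j),(i,j),(j,i)}. X kl * (LINT A|M. G kl A) = 0"
      by simp
  qed simp
  ultimately have "(\<Sum>kl\<in>{(i,i),(j,j),(i,j),(j,i)}. X kl * (LINT A|M. G kl A)) = 0" by simp
  hence z: "X (i, i) * (LINT A|M. G (i, i) A) + X (j, j) * (LINT A|M. G (j, j) A)
      + X (i, j) * (LINT A|M. G (i, j) A) + X (j, i) * (LINT A|M. G (j, i) A) = 0"
    using sum_block[of i j] ij by (simp add: add.assoc)
  have Xv: "X (i, i) = \<i> * of_real p / 2" "X (j, j) = - \<i> * of_real p / 2"
      "X (i, j) = b / 2" "X (j, i) = - cnj b / 2"
    using ij by (simp_all add: X_def)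
  show ?thesis by (rule block_halve[OF z[unfolded Xv]])
qed

text \<open>With p = 0, the choices b = 1 and b = \<open>\<i>\<close> kill the difference and the
  sum of the two integrals belonging to (i, j) and (j, i).\<close>

lemma integral_grad_offdiag:
  assumes F: "has_grad n F G" and "i < n" "j < n" "i \<noteq> j"
  shows "(LINT A|M. G (i, j) A) = 0"
proof -
  have *: "(LINT A|M. G (i, j) A) = 0 \<and> (LINT A|M. G (j, i) A) = 0" if "i < j" "j < n" for i j
  proof -
    have 1: "(LINT A|M. G (i, j) A) - (LINT A|M. G (j, i) A) = 0"
      using grad_SU2[OF F that, of 0 1] by simp
    have "\<i> * ((LINT A|M. G (i, j) A) + (LINT A|M. G (j, i) A)) = 0"
      using grad_SU2[OF F that, of 0 \<i>] by (simp add: distrib_left)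
    hence 2: "(LINT A|M. G (i, j) A) + (LINT A|M. G (j, i) A) = 0" by simp
    have e: "(LINT A|M. G (i, j) A) = (LINT A|M. G (j, i) A)" using 1 by (simp only: right_minus_eq)
    have "2 * (LINT A|M. G (j, i) A) = 0" using 2 unfolding e by (simp only: mult_2)
    thus ?thesis unfolding e by simp
  qed
  show ?thesis using *[of i j] *[of j i] assms(2-) by (metis linorder_neqE_nat)
qed

text \<open>The direction with p = 1 and b = 0 is traceless, so only differences of diagonal
  derivatives are seen. The common value may be nonzero; this is what separates SU(n) from
  U(n).\<close>

lemma integral_grad_diag:
  assumes F: "has_grad n F G" and "i < n" "j < n"
  shows "(LINT A|M. G (i, i) A) = (LINT A|M. G (j, j) A)"
proof -
  have *: "(LINT A|M. G (i, i) A) = (LINT A|M. G (j, j) A)" if "i < j" "j < n" for i j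
    using grad_SU2[OF F that, of 1 0] by simp
  show ?thesis using *[of i j] *[of j i] assms(2-) by (metis linorder_neqE_nat)
qed

end

section \<open>Complete homogeneous functions in terms of power sums\<close>

text \<open>Newton's identity serves as the definition. Thus h_m is a polynomial in arbitrary power
  sums and can be differentiated through traces of powers, without choosing eigenvalues.\<close>

fun hsym :: "(nat \<Rightarrow> 'a) \<Rightarrow> nat \<Rightarrow> 'a :: field_char_0" where
  "hsym p 0 = 1"
| "hsym p (Suc m) = (\<Sum>k\<le>m. p (Suc k) * hsym p (m - k)) / of_nat (Suc m)"

declare hsym.simps(2) [simp del]

lemma sum_from_1_Suc:
  fixes g :: "nat \<Rightarrow> 'a :: comm_monoid_add"
  shows "(\<Sum>r=1..Suc c. g r) = g 1 + (\<Sum>r=1..c. g (Suc r))"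
  by (induction c) (simp_all add: add.assoc)

lemma hsym_newton: "of_nat m * hsym p m = (\<Sum>k=1..m. p k * hsym p (m - k))"
proof (cases m)
  case (Suc l)
  have "of_nat m * hsym p m = (\<Sum>k\<le>l. p (Suc k) * hsym p (l - k))"
    unfolding Suc hsym.simps(2) using of_nat_neq_0[of l, where 'a = 'a] by (simp del: of_nat_Suc)
  also have "\<dots> = (\<Sum>k=1..m. p k * hsym p (m - k))"
    unfolding Suc by (rule sum.reindex_bij_witness[of _ "\<lambda>k. k - 1" Suc]) auto
  finally show ?thesis .
qed simp

lemma sum_triangle:
  fixes f :: "nat \<Rightarrow> nat \<Rightarrow> 'a :: comm_monoid_add"
  shows "(\<Sum>k=1..m. \<Sum>r=1..m-k. f k r) = (\<Sum>k=1..m. \<Sum>r=1..m. if k + r \<le> m then f k r else 0)"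
proof (rule sum.cong[OF refl])
  fix k assume "k \<in> {1..m}"
  show "(\<Sum>r=1..m-k. f k r) = (\<Sum>r=1..m. if k + r \<le> m then f k r else 0)"
    by (rule sum.mono_neutral_cong_left) auto
qed

lemma sum_triangle_swap:
  fixes f :: "nat \<Rightarrow> nat \<Rightarrow> 'a :: comm_monoid_add"
  shows "(\<Sum>k=1..m. \<Sum>r=1..m-k. f k r) = (\<Sum>r=1..m. \<Sum>k=1..m-r. f k r)"
  unfolding sum_triangle sum_triangle[of "\<lambda>r k. f k r"]
  by (subst sum.swap) (simp add: add.commute)

lemma sum_triangle_antidiagonal:
  fixes f :: "nat \<Rightarrow> nat \<Rightarrow> 'a :: comm_monoid_add"
  shows "(\<Sum>k=1..m. \<Sum>r=1..m-k. f k r) = (\<Sum>s=1..m. \<Sum>a=1..<s. f a (s - a))"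
proof -
  have "(\<Sum>s=1..m. \<Sum>a=1..<s. f a (s - a)) = (\<Sum>s=1..m. \<Sum>a=1..m. if a < s then f a (s - a) else 0)"
  proof (rule sum.cong[OF refl])
    fix s assume "s \<in> {1..m}"
    thus "(\<Sum>a=1..<s. f a (s - a)) = (\<Sum>a=1..m. if a < s then f a (s - a) else 0)"
      by (intro sum.mono_neutral_cong_left) auto
  qed
  also have "\<dots> = (\<Sum>a=1..m. \<Sum>s=1..m. if a < s then f a (s - a) else 0)"
    by (rule sum.swap)
  also have "\<dots> = (\<Sum>k=1..m. \<Sum>r=1..m-k. f k r)"
  proof (rule sum.cong[OF refl])
    fix k assume k: "k \<in> {1..m}"
    have "(\<Sum>s=1..m. if k < s then f k (s - k) else 0) = (\<Sum>s\<in>{k<..m}. f k (s - k))"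
      using k by (intro sum.mono_neutral_cong_right) auto
    also have "\<dots> = (\<Sum>r=1..m-k. f k r)"
      by (rule sum.reindex_bij_witness[of _ "\<lambda>r. r + k" "\<lambda>s. s - k"]) auto
    finally show "(\<Sum>s=1..m. if k < s then f k (s - k) else 0) = (\<Sum>r=1..m-k. f k r)" .
  qed
  finally show ?thesis by simp
qed

text \<open>The Casimir operator acts on a single \<open>h\<^sub>m\<close> by its eigenvalue on the \<open>m\<close>-th symmetric power.\<close>

lemma hsym_casimir:
  fixes p :: "nat \<Rightarrow> 'a :: field_char_0"
  shows "(\<Sum>k=1..m. (\<Sum>r=1..m-k. hsym p (m - k - r) * p (r + k)) + hsym p (m - k) * (\<Sum>a<k. p a * p (k - a)))
    = (of_nat m * of_nat m + (p 0 - 1) * of_nat m) * hsym p m"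
proof -
  let ?h = "hsym p"
  \<comment> \<open>This sum occurs with opposite signs in the two halves of the identity and
    cancels.\<close>
  define S where "S = (\<Sum>s=1..m. of_nat s * p s * ?h (m - s))"
  have "(\<Sum>k=1..m. \<Sum>r=1..m-k. ?h (m - k - r) * p (r + k)) = (\<Sum>s=1..m. \<Sum>a=1..<s. ?h (m - a - (s - a)) * p (s - a + a))"
    by (rule sum_triangle_antidiagonal)
  also have "\<dots> = (\<Sum>s=1..m. (of_nat s - 1) * p s * ?h (m - s))"
  proof (rule sum.cong[OF refl])
    fix s assume s: "s \<in> {1..m}"
    have "(\<Sum>a=1..<s. ?h (m - a - (s - a)) * p (s - a + a)) = (\<Sum>a=1..<s. ?h (m - s) * p s)"
      using s by (intro sum.cong refl) simp
    also have "\<dots> = (of_nat s - 1) * p s * ?h (m - s)"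
      using s by (simp add: of_nat_diff)
    finally show "(\<Sum>a=1..<s. ?h (m - a - (s - a)) * p (s - a + a)) = (of_nat s - 1) * p s * ?h (m - s)" .
  qed
  also have "\<dots> = S - of_nat m * ?h m"
    unfolding S_def hsym_newton by (simp add: algebra_simps sum_subtractf)
  finally have 1: "(\<Sum>k=1..m. \<Sum>r=1..m-k. ?h (m - k - r) * p (r + k)) = S - of_nat m * ?h m" .
  have "(\<Sum>k=1..m. ?h (m - k) * (\<Sum>a<k. p a * p (k - a)))
    = (\<Sum>k=1..m. p 0 * (p k * ?h (m - k)) + (\<Sum>a=1..<k. p a * p (k - a) * ?h (m - a - (k - a))))"
  proof (rule sum.cong[OF refl])
    fix k assume k: "k \<in> {1..m}"
    have "{..<k} = insert 0 {1..<k}" using k by auto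
    hence "(\<Sum>a<k. p a * p (k - a)) = p 0 * p k + (\<Sum>a=1..<k. p a * p (k - a))" by simp
    moreover have "(\<Sum>a=1..<k. p a * p (k - a) * ?h (m - a - (k - a))) = (\<Sum>a=1..<k. p a * p (k - a)) * ?h (m - k)"
      unfolding sum_distrib_right using k by (intro sum.cong refl) simp
    ultimately show "?h (m - k) * (\<Sum>a<k. p a * p (k - a)) = p 0 * (p k * ?h (m - k)) + (\<Sum>a=1..<k. p a * p (k - a) * ?h (m - a - (k - a)))"
      by (simp add: algebra_simps)
  qed
  also have "\<dots> = p 0 * (of_nat m * ?h m) + (\<Sum>k=1..m. \<Sum>a=1..<k. p a * p (k - a) * ?h (m - a - (k - a)))"
    unfolding hsym_newton by (simp add: sum.distrib sum_distrib_left)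
  also have "(\<Sum>k=1..m. \<Sum>a=1..<k. p a * p (k - a) * ?h (m - a - (k - a))) = (\<Sum>a=1..m. \<Sum>r=1..m-a. p a * p r * ?h (m - a - r))"
    by (rule sum_triangle_antidiagonal[symmetric])
  also have "\<dots> = (\<Sum>a=1..m. p a * (of_nat (m - a) * ?h (m - a)))"
    unfolding hsym_newton by (simp add: sum_distrib_left mult.assoc)
  also have "\<dots> = (\<Sum>a=1..m. of_nat m * (p a * ?h (m - a)) - of_nat a * p a * ?h (m - a))"
    by (intro sum.cong refl) (simp add: of_nat_diff algebra_simps)
  also have "\<dots> = of_nat m * (of_nat m * ?h m) - S"
    unfolding S_def hsym_newton by (simp add: sum_subtractf sum_distrib_left)
  finally have 2: "(\<Sum>k=1..m. ?h (m - k) * (\<Sum>a<k. p a * p (k - a))) = p 0 * (of_nat m * ?h m) + (of_nat m * (of_nat m * ?h m) - S)" .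
  show ?thesis unfolding sum.distrib 1 2 by (simp add: algebra_simps)
qed

text \<open>The pairing of the gradients of h_a and h_b: the matrix powers in them multiply to k +
  r, and the trace produces \<open>p (k + r)\<close>.\<close>

definition hcross :: "(nat \<Rightarrow> 'a :: field_char_0) \<Rightarrow> nat \<Rightarrow> nat \<Rightarrow> 'a" where
  "hcross p a b = (\<Sum>k=1..a. \<Sum>r=1..b. p (k + r) * hsym p (a - k) * hsym p (b - r))"

lemma hcross_commute: "hcross p a b = hcross p b a"
  unfolding hcross_def by (subst sum.swap) (simp add: add.commute mult.assoc mult.left_commute mult.commute)

text \<open>Splitting off k = 1 on one side and r = 1 on the other leaves the same double sum;
  Newton's identity evaluates the two strips.\<close>

lemma hcross_shift:
  fixes p :: "nat \<Rightarrow> 'a :: field_char_0"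
  shows "hcross p a (Suc b) = hcross p (Suc a) b + of_nat (Suc a) * hsym p (Suc a) * hsym p b
     - of_nat (Suc b) * hsym p a * hsym p (Suc b)"
proof -
  let ?h = "hsym p"
  define f where "f k r = p (k + r) * ?h (a - k) * ?h (Suc b - r)" for k r
  define W where "W = (\<Sum>k=1..a. \<Sum>r=1..b. f k (Suc r))"
  note ss = sum_from_1_Suc
  have N1: "of_nat (Suc a) * ?h (Suc a) = p 1 * ?h a + (\<Sum>k=1..a. p (Suc k) * ?h (a - k))"
    unfolding hsym_newton ss by simp
  have N2: "of_nat (Suc b) * ?h (Suc b) = p 1 * ?h b + (\<Sum>k=1..b. p (Suc k) * ?h (b - k))"
    unfolding hsym_newton ss by simp
  have 1: "hcross p a (Suc b) = (\<Sum>k=1..a. p (Suc k) * ?h (a - k)) * ?h b + W"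
    unfolding hcross_def ss W_def f_def by (simp add: sum.distrib sum_distrib_right)
  have 2: "hcross p (Suc a) b = (\<Sum>r=1..b. p (Suc r) * ?h a * ?h (b - r)) + W"
    unfolding hcross_def ss W_def f_def by (simp add: sum.distrib)
  have 3: "(\<Sum>r=1..b. p (Suc r) * ?h a * ?h (b - r)) = ?h a * (\<Sum>k=1..b. p (Suc k) * ?h (b - k))"
    by (simp add: sum_distrib_left mult_ac)
  have 4: "of_nat (Suc b) * ?h a * ?h (Suc b) = ?h a * (p 1 * ?h b + (\<Sum>k=1..b. p (Suc k) * ?h (b - k)))"
    unfolding N2[symmetric] by (simp only: mult_ac)
  show ?thesis unfolding 1 2 3 4 N1 by (simp add: algebra_simps)
qed

text \<open>Shifting until the smaller index is 0 leaves only products of two h. All of them except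
  the original pair are more unbalanced, and this triangular shape drives the induction in
  \<open>integral_prod_hsym_eq_0\<close>.\<close>

lemma hcross_expand:
  fixes p :: "nat \<Rightarrow> 'a :: field_char_0"
  shows "hcross p (b + c) b = (\<Sum>j=1..b. of_nat (c + 2 * j) * hsym p (b + c + j) * hsym p (b - j))
     - of_nat b * hsym p (b + c) * hsym p b"
proof (induction b arbitrary: c)
  case 0
  show ?case by (simp add: hcross_def)
next
  case (Suc b)
  let ?h = "hsym p"
  note ss = sum_from_1_Suc
  have "hcross p (Suc b + c) (Suc b) = hcross p (b + (c + 2)) b + of_nat (b + c + 2) * ?h (b + c + 2) * ?h b
     - of_nat (Suc b) * ?h (Suc b + c) * ?h (Suc b)"
    using hcross_shift[of p "Suc b + c" b] by (simp add: algebra_simps)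
  also have "hcross p (b + (c + 2)) b = (\<Sum>j=1..b. of_nat (c + 2 + 2 * j) * ?h (b + (c + 2) + j) * ?h (b - j))
     - of_nat b * ?h (b + c + 2) * ?h b" using Suc.IH[of "c + 2"] by simp
  finally show ?case unfolding ss by (simp add: algebra_simps)
qed

section \<open>Loop equations\<close>

lemma has_grad_prod:
  assumes "finite I" "\<And>x. x \<in> I \<Longrightarrow> has_grad n (F x) (G x)"
  shows "has_grad n (\<lambda>A. \<Prod>x\<in>I. F x A) (\<lambda>ij A. \<Sum>x\<in>I. G x ij A * (\<Prod>y\<in>I - {x}. F y A))"
  using assms
proof (induction I rule: finite_induct)
  case (insert z I)
  have IH: "has_grad n (\<lambda>A. \<Prod>x\<in>I. F x A) (\<lambda>ij A. \<Sum>x\<in>I. G x ij A * (\<Prod>y\<in>I - {x}. F y A))"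
    using insert by blast
  have e: "G z ij A * (\<Prod>x\<in>I. F x A) + F z A * (\<Sum>x\<in>I. G x ij A * (\<Prod>y\<in>I - {x}. F y A))
     = (\<Sum>x\<in>insert z I. G x ij A * (\<Prod>y\<in>insert z I - {x}. F y A))" for ij A
  proof -
    have "F z A * (\<Sum>x\<in>I. G x ij A * (\<Prod>y\<in>I - {x}. F y A)) = (\<Sum>x\<in>I. G x ij A * (\<Prod>y\<in>insert z I - {x}. F y A))"
      unfolding sum_distrib_left
    proof (rule sum.cong[OF refl])
      fix x assume x: "x \<in> I"
      have "insert z I - {x} = insert z (I - {x})" using x insert.hyps by auto
      thus "F z A * (G x ij A * (\<Prod>y\<in>I - {x}. F y A)) = G x ij A * (\<Prod>y\<in>insert z I - {x}. F y A)"
        using insert.hyps by (simp add: mult_ac)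
    qed
    moreover have "insert z I - {z} = I" using insert.hyps by auto
    ultimately show ?thesis using insert.hyps by simp
  qed
  show ?case
    by (rule has_grad_cong[OF has_grad_mult[OF insert.prems[of z] IH]])
      (use insert.hyps in \<open>simp_all add: e\<close>)
qed (simp add: has_grad_const)

lemma mat_pow_carrier: "A \<in> SU n \<Longrightarrow> A ^\<^sub>m k \<in> carrier_mat n n"
  by (rule pow_carrier_mat[OF SU_carrier])

lemma mat_pow_add_index:
  assumes "A \<in> carrier_mat n n" "i < n" "j < n"
  shows "(\<Sum>r<n. (A ^\<^sub>m k) $$ (i, r) * (A ^\<^sub>m l) $$ (r, j)) = (A ^\<^sub>m (k + l)) $$ (i, j)"
proof -
  have "A ^\<^sub>m (k + l) = A ^\<^sub>m k * A ^\<^sub>m l"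
  proof (induction l)
    case 0
    show ?case using assms(1) pow_carrier_mat[OF assms(1), of k] by simp
  next
    case (Suc l)
    thus ?case
      using assoc_mult_mat[OF pow_carrier_mat[OF assms(1), of k] pow_carrier_mat[OF assms(1), of l] assms(1)] by simp
  qed
  thus ?thesis
    using mat_mult_index[OF pow_carrier_mat[OF assms(1), of k] pow_carrier_mat[OF assms(1), of l] assms(2,3)] by simp
qed

text \<open>The product rule: one of the m factors A is replaced by E_ij A, which splits the power
  at that place.\<close>

lemma has_grad_pow_entry:
  assumes "k < n" "l < n"
  shows "has_grad n (\<lambda>A. (A ^\<^sub>m m) $$ (k, l))
    (\<lambda>ij A. \<Sum>a<m. (A ^\<^sub>m a) $$ (k, fst ij) * (A ^\<^sub>m (m - a)) $$ (snd ij, l))"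
  using assms
proof (induction m arbitrary: l)
  case 0
  show ?case
    by (rule has_grad_cong[OF has_grad_const[of n "if k = l then 1 else 0"]])
      (use 0 SU_carrier in force)+
next
  case (Suc m)
  let ?G = "\<lambda>r ij A. (\<Sum>a<m. (A ^\<^sub>m a) $$ (k, fst ij) * (A ^\<^sub>m (m - a)) $$ (snd ij, r)) * A $$ (r, l)
     + (A ^\<^sub>m m) $$ (k, r) * (if fst ij = r then A $$ (snd ij, l) else 0)"
  have "has_grad n (\<lambda>A. \<Sum>r<n. (A ^\<^sub>m m) $$ (k, r) * A $$ (r, l)) (\<lambda>ij A. \<Sum>r<n. ?G r ij A)"
  proof (rule has_grad_sum)
    fix r assume "r \<in> {..<n}"
    hence r: "r < n" by simp
    show "has_grad n (\<lambda>A. (A ^\<^sub>m m) $$ (k, r) * A $$ (r, l)) (?G r)"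
      by (rule has_grad_mult[OF Suc.IH[OF Suc.prems(1) r] has_grad_entry[OF r Suc.prems(2)]])
  qed simp
  thus ?case
  proof (rule has_grad_cong)
    fix A assume A: "A \<in> SU n"
    note Ac = SU_carrier[OF A]
    show "(\<Sum>r<n. (A ^\<^sub>m m) $$ (k, r) * A $$ (r, l)) = (A ^\<^sub>m Suc m) $$ (k, l)"
      using mat_mult_index[OF mat_pow_carrier[OF A, of m] Ac Suc.prems] by simp
    fix i j assume ij: "i < n" "j < n"
    have 1: "(\<Sum>r<n. (A ^\<^sub>m (m - a)) $$ (j, r) * A $$ (r, l)) = (A ^\<^sub>m (Suc m - a)) $$ (j, l)" if "a < m" for a
      using mat_pow_add_index[OF Ac ij(2) Suc.prems(2), of "m - a" 1] that Ac by (simp add: Suc_diff_le)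
    have "(\<Sum>r<n. ?G r (i, j) A) = (\<Sum>r<n. \<Sum>a<m. (A ^\<^sub>m a) $$ (k, i) * ((A ^\<^sub>m (m - a)) $$ (j, r) * A $$ (r, l)))
       + (\<Sum>r<n. if r = i then (A ^\<^sub>m m) $$ (k, i) * A $$ (j, l) else 0)"
      unfolding sum.distrib sum_distrib_right
      by (intro arg_cong2[of _ _ _ _ "(+)"] sum.cong refl) (auto simp: mult.assoc)
    also have "(\<Sum>r<n. \<Sum>a<m. (A ^\<^sub>m a) $$ (k, i) * ((A ^\<^sub>m (m - a)) $$ (j, r) * A $$ (r, l)))
      = (\<Sum>a<m. (A ^\<^sub>m a) $$ (k, i) * (A ^\<^sub>m (Suc m - a)) $$ (j, l))"
      by (subst sum.swap, intro sum.cong refl) (simp add: 1 flip: sum_distrib_left)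
    also have "(\<Sum>r<n. if r = i then (A ^\<^sub>m m) $$ (k, i) * A $$ (j, l) else 0) = (A ^\<^sub>m m) $$ (k, i) * A $$ (j, l)"
      using ij by simp
    also have "A $$ (j, l) = (A ^\<^sub>m (Suc m - m)) $$ (j, l)" using Ac by simp
    finally show "(\<Sum>r<n. ?G r (i, j) A) = (\<Sum>a<Suc m. (A ^\<^sub>m a) $$ (k, fst (i, j)) * (A ^\<^sub>m (Suc m - a)) $$ (snd (i, j), l))"
      by simp
  qed
qed

definition ptr :: "complex mat \<Rightarrow> nat \<Rightarrow> complex" where
  "ptr A k = (\<Sum>i<dim_row A. (A ^\<^sub>m k) $$ (i, i))"

lemma ptr_SU: "A \<in> SU n \<Longrightarrow> ptr A k = (\<Sum>i<n. (A ^\<^sub>m k) $$ (i, i))"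
  using SU_carrier by (auto simp: ptr_def)

lemma ptr_0: "A \<in> SU n \<Longrightarrow> ptr A 0 = of_nat n"
  using SU_carrier by (auto simp: ptr_def)

lemma has_grad_ptr: "has_grad n (\<lambda>A. ptr A m) (\<lambda>ij A. of_nat m * (A ^\<^sub>m m) $$ (snd ij, fst ij))"
proof (rule has_grad_cong)
  show "has_grad n (\<lambda>A. \<Sum>k<n. (A ^\<^sub>m m) $$ (k, k))
    (\<lambda>ij A. \<Sum>k<n. \<Sum>a<m. (A ^\<^sub>m a) $$ (k, fst ij) * (A ^\<^sub>m (m - a)) $$ (snd ij, k))"
    by (intro has_grad_sum has_grad_pow_entry) auto
  fix A assume A: "A \<in> SU n"
  show "(\<Sum>k<n. (A ^\<^sub>m m) $$ (k, k)) = ptr A m" using ptr_SU[OF A] by simp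
  fix i j assume ij: "i < n" "j < n"
  have "(\<Sum>k<n. \<Sum>a<m. (A ^\<^sub>m a) $$ (k, i) * (A ^\<^sub>m (m - a)) $$ (j, k))
    = (\<Sum>a<m. \<Sum>k<n. (A ^\<^sub>m (m - a)) $$ (j, k) * (A ^\<^sub>m a) $$ (k, i))"
    by (subst sum.swap) (simp add: mult.commute)
  also have "\<dots> = (\<Sum>a<m. (A ^\<^sub>m m) $$ (j, i))"
    by (intro sum.cong refl) (simp add: mat_pow_add_index[OF SU_carrier[OF A] ij(2,1)])
  finally show "(\<Sum>k<n. \<Sum>a<m. (A ^\<^sub>m a) $$ (k, fst (i, j)) * (A ^\<^sub>m (m - a)) $$ (snd (i, j), k))
     = of_nat m * (A ^\<^sub>m m) $$ (snd (i, j), fst (i, j))" by simp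
qed

text \<open>For the generating function H = exp (sum of p_k x^k / k) the derivative is H times the
  sum of the derivatives of p_k x^k / k. The induction does this coefficientwise: the weights k and
  m - k add up to m, which cancels the denominator in \<open>hsym\<close>.\<close>

lemma has_grad_hsym:
  "has_grad n (\<lambda>A. hsym (ptr A) m) (\<lambda>ij A. \<Sum>k=1..m. hsym (ptr A) (m - k) * (A ^\<^sub>m k) $$ (snd ij, fst ij))"
proof (induction m rule: less_induct)
  case (less m)
  show ?case
  proof (cases "m = 0")
    case True
    thus ?thesis using has_grad_const[of n 1] by simp
  next
    case False
    let ?G = "\<lambda>m ij A. \<Sum>k=1..m. hsym (ptr A) (m - k) * (A ^\<^sub>m k) $$ (snd ij, fst ij)"
    have "has_grad n (\<lambda>A. (\<Sum>k=1..m. ptr A k * hsym (ptr A) (m - k)))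
      (\<lambda>ij A. (\<Sum>k=1..m. of_nat k * (A ^\<^sub>m k) $$ (snd ij, fst ij) * hsym (ptr A) (m - k) + ptr A k * ?G (m - k) ij A))"
    proof (rule has_grad_sum)
      fix k assume k: "k \<in> {1..m}"
      hence "m - k < m" by auto
      from has_grad_mult[OF has_grad_ptr less.IH[OF this]]
      show "has_grad n (\<lambda>A. ptr A k * hsym (ptr A) (m - k))
        (\<lambda>ij A. of_nat k * (A ^\<^sub>m k) $$ (snd ij, fst ij) * hsym (ptr A) (m - k) + ptr A k * ?G (m - k) ij A)" .
    qed simp
    from has_grad_mult[OF has_grad_const[of n "1 / of_nat m"] this] show ?thesis
    proof (rule has_grad_cong)
      fix A assume "A \<in> SU n"
      show "1 / of_nat m * (\<Sum>k=1..m. ptr A k * hsym (ptr A) (m - k)) = hsym (ptr A) m"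
        using False unfolding hsym_newton[symmetric] by simp
      fix i j
      let ?a = "\<lambda>k. (A ^\<^sub>m k) $$ (j, i)"
      have "(\<Sum>k=1..m. ptr A k * ?G (m - k) (i, j) A) = (\<Sum>k=1..m. \<Sum>r=1..m - k. ptr A k * (hsym (ptr A) (m - k - r) * ?a r))"
        by (simp add: sum_distrib_left)
      also have "\<dots> = (\<Sum>r=1..m. \<Sum>k=1..m - r. ptr A k * (hsym (ptr A) (m - k - r) * ?a r))"
        by (rule sum_triangle_swap)
      also have "\<dots> = (\<Sum>r=1..m. of_nat (m - r) * hsym (ptr A) (m - r) * ?a r)"
      proof (rule sum.cong[OF refl])
        fix r
        show "(\<Sum>k=1..m - r. ptr A k * (hsym (ptr A) (m - k - r) * ?a r)) = of_nat (m - r) * hsym (ptr A) (m - r) * ?a r"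
          unfolding hsym_newton sum_distrib_right by (intro sum.cong refl) (simp add: add.commute)
      qed
      finally have 1: "(\<Sum>k=1..m. ptr A k * ?G (m - k) (i, j) A) = (\<Sum>r=1..m. of_nat (m - r) * hsym (ptr A) (m - r) * ?a r)" .
      have "(\<Sum>k=1..m. of_nat k * ?a k * hsym (ptr A) (m - k) + ptr A k * ?G (m - k) (i, j) A)
         = (\<Sum>k=1..m. of_nat m * (hsym (ptr A) (m - k) * ?a k))"
      proof -
        have "(\<Sum>k=1..m. of_nat k * ?a k * hsym (ptr A) (m - k) + ptr A k * ?G (m - k) (i, j) A)
           = (\<Sum>k=1..m. of_nat k * ?a k * hsym (ptr A) (m - k) + of_nat (m - k) * hsym (ptr A) (m - k) * ?a k)"
          unfolding sum.distrib 1 ..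
        also have "\<dots> = (\<Sum>k=1..m. of_nat m * (hsym (ptr A) (m - k) * ?a k))"
          by (intro sum.cong refl) (simp add: of_nat_diff algebra_simps)
        finally show ?thesis .
      qed
      also have "\<dots> = of_nat m * ?G m (i, j) A" by (simp add: sum_distrib_left)
      finally have 2: "(\<Sum>k=1..m. of_nat k * ?a k * hsym (ptr A) (m - k) + ptr A k * ?G (m - k) (i, j) A) = of_nat m * ?G m (i, j) A" .
      show "0 * (\<Sum>k=1..m. ptr A k * hsym (ptr A) (m - k)) + 1 / of_nat m *
         (\<Sum>k=1..m. of_nat k * (A ^\<^sub>m k) $$ (snd (i, j), fst (i, j)) * hsym (ptr A) (m - k) + ptr A k * ?G (m - k) (i, j) A)
         = ?G m (i, j) A"
        unfolding fst_conv snd_conv using False 2[unfolded fst_conv snd_conv] by simp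
    qed
  qed
qed

context haar begin

text \<open>Integration by parts for f times the (i, j) entry of A^k in the direction E_ij, summed
  over i and j. Off-diagonal directions contribute nothing. Each diagonal term equals its average
  over all diagonal directions, which gives the factor n and, on the right, the derivative in the
  direction of the identity.\<close>

lemma loop_equation:
  assumes F: "has_grad n f G"
  shows "of_nat n * (LINT A|M. (\<Sum>i<n. \<Sum>j<n. G (i, j) A * (A ^\<^sub>m k) $$ (i, j))
       + f A * (\<Sum>a<k. ptr A a * ptr A (k - a)))
    = (LINT A|M. ((\<Sum>l<n. G (l, l) A) + of_nat k * f A) * ptr A k)"
proof -
  define D where "D i j = (\<lambda>ij A. G ij A * (A ^\<^sub>m k) $$ (i, j)
    + f A * (\<Sum>a<k. (A ^\<^sub>m a) $$ (i, fst ij) * (A ^\<^sub>m (k - a)) $$ (snd ij, j)))" for i j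
  have D: "has_grad n (\<lambda>A. f A * (A ^\<^sub>m k) $$ (i, j)) (D i j)" if "i < n" "j < n" for i j
    unfolding D_def by (rule has_grad_mult[OF F has_grad_pow_entry[OF that]])
  have D1: "(\<Sum>i<n. \<Sum>j<n. D i j (i, j) A) = (\<Sum>i<n. \<Sum>j<n. G (i, j) A * (A ^\<^sub>m k) $$ (i, j))
       + f A * (\<Sum>a<k. ptr A a * ptr A (k - a))" if A: "A \<in> SU n" for A
  proof -
    have "(\<Sum>a<k. ptr A a * ptr A (k - a)) = (\<Sum>a<k. \<Sum>i<n. \<Sum>j<n. (A ^\<^sub>m a) $$ (i, i) * (A ^\<^sub>m (k - a)) $$ (j, j))"
      unfolding ptr_SU[OF A] sum_product ..
    also have "\<dots> = (\<Sum>i<n. \<Sum>j<n. \<Sum>a<k. (A ^\<^sub>m a) $$ (i, i) * (A ^\<^sub>m (k - a)) $$ (j, j))"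
      by (subst sum.swap, rule sum.cong[OF refl], rule sum.swap)
    finally have e: "(\<Sum>a<k. ptr A a * ptr A (k - a)) = (\<Sum>i<n. \<Sum>j<n. \<Sum>a<k. (A ^\<^sub>m a) $$ (i, i) * (A ^\<^sub>m (k - a)) $$ (j, j))" .
    show ?thesis unfolding D_def fst_conv snd_conv sum.distrib e sum_distrib_left ..
  qed
  have D2: "(\<Sum>i<n. \<Sum>l<n. D i i (l, l) A) = ((\<Sum>l<n. G (l, l) A) + of_nat k * f A) * ptr A k"
    if A: "A \<in> SU n" for A
  proof -
    have 1: "(\<Sum>l<n. \<Sum>a<k. (A ^\<^sub>m a) $$ (i, l) * (A ^\<^sub>m (k - a)) $$ (l, i)) = of_nat k * (A ^\<^sub>m k) $$ (i, i)"
      if "i < n" for i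
    proof -
      have "(\<Sum>l<n. \<Sum>a<k. (A ^\<^sub>m a) $$ (i, l) * (A ^\<^sub>m (k - a)) $$ (l, i)) =
        (\<Sum>a<k. \<Sum>l<n. (A ^\<^sub>m a) $$ (i, l) * (A ^\<^sub>m (k - a)) $$ (l, i))" by (rule sum.swap)
      also have "\<dots> = (\<Sum>a<k. (A ^\<^sub>m k) $$ (i, i))"
        by (intro sum.cong refl) (simp add: mat_pow_add_index[OF SU_carrier[OF A] that that])
      finally show ?thesis by simp
    qed
    have "(\<Sum>i<n. \<Sum>l<n. D i i (l, l) A) = (\<Sum>i<n. (\<Sum>l<n. G (l, l) A) * (A ^\<^sub>m k) $$ (i, i)
       + f A * (\<Sum>l<n. \<Sum>a<k. (A ^\<^sub>m a) $$ (i, l) * (A ^\<^sub>m (k - a)) $$ (l, i)))"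
      unfolding D_def fst_conv snd_conv sum.distrib sum_distrib_left sum_distrib_right ..
    also have "\<dots> = (\<Sum>i<n. (\<Sum>l<n. G (l, l) A) * (A ^\<^sub>m k) $$ (i, i) + f A * (of_nat k * (A ^\<^sub>m k) $$ (i, i)))"
      by (intro sum.cong refl) (simp add: 1)
    also have "\<dots> = ((\<Sum>l<n. G (l, l) A) + of_nat k * f A) * ptr A k"
      unfolding ptr_SU[OF A] sum_distrib_left by (intro sum.cong refl) (simp add: algebra_simps)
    finally show ?thesis .
  qed
  note int = has_grad_integrable(2)[OF D]
  have "(LINT A|M. (\<Sum>i<n. \<Sum>j<n. D i j (i, j) A)) = (\<Sum>i<n. \<Sum>j<n. (LINT A|M. D i j (i, j) A))"
    using int by (subst Bochner_Integration.integral_sum, force intro!: Bochner_Integration.integrable_sum)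
      (intro sum.cong refl Bochner_Integration.integral_sum, force)
  also have "\<dots> = (\<Sum>i<n. \<Sum>j<n. if j = i then (LINT A|M. D i i (i, i) A) else 0)"
    by (intro sum.cong refl) (auto intro!: integral_grad_offdiag D)
  also have "\<dots> = (\<Sum>i<n. (LINT A|M. D i i (i, i) A))" by simp
  finally have L: "(LINT A|M. (\<Sum>i<n. \<Sum>j<n. D i j (i, j) A)) = (\<Sum>i<n. (LINT A|M. D i i (i, i) A))" .
  have "(LINT A|M. (\<Sum>i<n. \<Sum>l<n. D i i (l, l) A)) = (\<Sum>i<n. \<Sum>l<n. (LINT A|M. D i i (l, l) A))"
    using int by (subst Bochner_Integration.integral_sum, force intro!: Bochner_Integration.integrable_sum)
      (intro sum.cong refl Bochner_Integration.integral_sum, force)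
  also have "\<dots> = (\<Sum>i<n. \<Sum>l<n. (LINT A|M. D i i (i, i) A))"
    by (intro sum.cong refl) (auto intro!: integral_grad_diag D)
  also have "\<dots> = of_nat n * (\<Sum>i<n. (LINT A|M. D i i (i, i) A))"
    by (simp add: sum_distrib_left)
  finally have R: "(LINT A|M. (\<Sum>i<n. \<Sum>l<n. D i i (l, l) A)) = of_nat n * (LINT A|M. (\<Sum>i<n. \<Sum>j<n. D i j (i, j) A))"
    unfolding L .
  have "(LINT A|M. (\<Sum>i<n. \<Sum>j<n. D i j (i, j) A)) = (LINT A|M. (\<Sum>i<n. \<Sum>j<n. G (i, j) A * (A ^\<^sub>m k) $$ (i, j))
       + f A * (\<Sum>a<k. ptr A a * ptr A (k - a)))"
    by (rule Bochner_Integration.integral_cong[OF refl]) (simp add: space_M D1)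
  moreover have "(LINT A|M. (\<Sum>i<n. \<Sum>l<n. D i i (l, l) A)) = (LINT A|M. ((\<Sum>l<n. G (l, l) A) + of_nat k * f A) * ptr A k)"
    by (rule Bochner_Integration.integral_cong[OF refl]) (simp add: space_M D2)
  ultimately show ?thesis using R by metis
qed

text \<open>The identity direction multiplies a homogeneous function by its degree, whence the
  scalar on the right.\<close>

lemma loop_equation_hsym:
  assumes I: "finite I"
  shows "of_nat n * (LINT A|M. (\<Sum>q\<in>I. (\<Sum>r=1..m q. hsym (ptr A) (m q - r) * ptr A (r + k)) * (\<Prod>x\<in>I - {q}. hsym (ptr A) (m x)))
       + (\<Prod>x\<in>I. hsym (ptr A) (m x)) * (\<Sum>a<k. ptr A a * ptr A (k - a)))
    = of_nat ((\<Sum>q\<in>I. m q) + k) * (LINT A|M. (\<Prod>x\<in>I. hsym (ptr A) (m x)) * ptr A k)"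
proof -
  let ?G = "\<lambda>ij A. \<Sum>q\<in>I. (\<Sum>r=1..m q. hsym (ptr A) (m q - r) * (A ^\<^sub>m r) $$ (snd ij, fst ij)) * (\<Prod>x\<in>I - {q}. hsym (ptr A) (m x))"
  have F: "has_grad n (\<lambda>A. \<Prod>x\<in>I. hsym (ptr A) (m x)) ?G"
    by (rule has_grad_prod[OF I has_grad_hsym])
  have 1: "(\<Sum>i<n. \<Sum>j<n. ?G (i, j) A * (A ^\<^sub>m k) $$ (i, j)) =
     (\<Sum>q\<in>I. (\<Sum>r=1..m q. hsym (ptr A) (m q - r) * ptr A (r + k)) * (\<Prod>x\<in>I - {q}. hsym (ptr A) (m x)))"
    if A: "A \<in> SU n" for A
  proof -
    have tr: "(\<Sum>i<n. \<Sum>j<n. (A ^\<^sub>m r) $$ (j, i) * (A ^\<^sub>m k) $$ (i, j)) = ptr A (r + k)" for r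
    proof -
      have "(\<Sum>i<n. \<Sum>j<n. (A ^\<^sub>m r) $$ (j, i) * (A ^\<^sub>m k) $$ (i, j)) = (\<Sum>j<n. \<Sum>i<n. (A ^\<^sub>m r) $$ (j, i) * (A ^\<^sub>m k) $$ (i, j))"
        by (rule sum.swap)
      also have "\<dots> = (\<Sum>j<n. (A ^\<^sub>m (r + k)) $$ (j, j))"
        by (intro sum.cong refl) (simp add: mat_pow_add_index[OF SU_carrier[OF A]])
      finally show ?thesis unfolding ptr_SU[OF A] .
    qed
    have "(\<Sum>i<n. \<Sum>j<n. ?G (i, j) A * (A ^\<^sub>m k) $$ (i, j)) =
      (\<Sum>i<n. \<Sum>j<n. \<Sum>q\<in>I. \<Sum>r=1..m q. (hsym (ptr A) (m q - r) * (\<Prod>x\<in>I - {q}. hsym (ptr A) (m x))) * ((A ^\<^sub>m r) $$ (j, i) * (A ^\<^sub>m k) $$ (i, j)))"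
      unfolding fst_conv snd_conv sum_distrib_right by (intro sum.cong refl) (simp only: mult_ac)
    also have "\<dots> = (\<Sum>i<n. \<Sum>q\<in>I. \<Sum>j<n. \<Sum>r=1..m q. (hsym (ptr A) (m q - r) * (\<Prod>x\<in>I - {q}. hsym (ptr A) (m x))) * ((A ^\<^sub>m r) $$ (j, i) * (A ^\<^sub>m k) $$ (i, j)))"
      by (rule sum.cong[OF refl], rule sum.swap)
    also have "\<dots> = (\<Sum>q\<in>I. \<Sum>i<n. \<Sum>j<n. \<Sum>r=1..m q. (hsym (ptr A) (m q - r) * (\<Prod>x\<in>I - {q}. hsym (ptr A) (m x))) * ((A ^\<^sub>m r) $$ (j, i) * (A ^\<^sub>m k) $$ (i, j)))"
      by (rule sum.swap)
    also have "\<dots> = (\<Sum>q\<in>I. \<Sum>i<n. \<Sum>r=1..m q. \<Sum>j<n. (hsym (ptr A) (m q - r) * (\<Prod>x\<in>I - {q}. hsym (ptr A) (m x))) * ((A ^\<^sub>m r) $$ (j, i) * (A ^\<^sub>m k) $$ (i, j)))"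
      by (rule sum.cong[OF refl], rule sum.cong[OF refl], rule sum.swap)
    also have "\<dots> = (\<Sum>q\<in>I. \<Sum>r=1..m q. \<Sum>i<n. \<Sum>j<n. (hsym (ptr A) (m q - r) * (\<Prod>x\<in>I - {q}. hsym (ptr A) (m x))) * ((A ^\<^sub>m r) $$ (j, i) * (A ^\<^sub>m k) $$ (i, j)))"
      by (rule sum.cong[OF refl], rule sum.swap)
    also have "\<dots> = (\<Sum>q\<in>I. \<Sum>r=1..m q. (hsym (ptr A) (m q - r) * (\<Prod>x\<in>I - {q}. hsym (ptr A) (m x))) * ptr A (r + k))"
      unfolding sum_distrib_left[symmetric] tr ..
    also have "\<dots> = (\<Sum>q\<in>I. (\<Sum>r=1..m q. hsym (ptr A) (m q - r) * ptr A (r + k)) * (\<Prod>x\<in>I - {q}. hsym (ptr A) (m x)))"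
      unfolding sum_distrib_right by (intro sum.cong refl) (simp only: mult_ac)
    finally show ?thesis .
  qed
  have 2: "(\<Sum>l<n. ?G (l, l) A) = of_nat (\<Sum>q\<in>I. m q) * (\<Prod>x\<in>I. hsym (ptr A) (m x))"
    if A: "A \<in> SU n" for A
  proof -
    have "(\<Sum>l<n. ?G (l, l) A) = (\<Sum>q\<in>I. (\<Sum>l<n. \<Sum>r=1..m q. hsym (ptr A) (m q - r) * (A ^\<^sub>m r) $$ (l, l)) * (\<Prod>x\<in>I - {q}. hsym (ptr A) (m x)))"
      unfolding fst_conv snd_conv sum_distrib_right by (rule sum.swap)
    also have "\<dots> = (\<Sum>q\<in>I. of_nat (m q) * (\<Prod>x\<in>I. hsym (ptr A) (m x)))"
    proof (rule sum.cong[OF refl])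
      fix q assume q: "q \<in> I"
      have "(\<Sum>l<n. \<Sum>r=1..m q. hsym (ptr A) (m q - r) * (A ^\<^sub>m r) $$ (l, l)) = (\<Sum>r=1..m q. \<Sum>l<n. hsym (ptr A) (m q - r) * (A ^\<^sub>m r) $$ (l, l))"
        by (rule sum.swap)
      also have "\<dots> = of_nat (m q) * hsym (ptr A) (m q)"
        unfolding hsym_newton ptr_SU[OF A] sum_distrib_right by (intro sum.cong refl) (simp only: mult.commute)
      finally have e: "(\<Sum>l<n. \<Sum>r=1..m q. hsym (ptr A) (m q - r) * (A ^\<^sub>m r) $$ (l, l)) = of_nat (m q) * hsym (ptr A) (m q)" .
      show "(\<Sum>l<n. \<Sum>r=1..m q. hsym (ptr A) (m q - r) * (A ^\<^sub>m r) $$ (l, l)) * (\<Prod>x\<in>I - {q}. hsym (ptr A) (m x))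
         = of_nat (m q) * (\<Prod>x\<in>I. hsym (ptr A) (m x))"
        unfolding e prod.remove[OF I q, of "\<lambda>x. hsym (ptr A) (m x)"] by (simp only: mult.assoc)
    qed
    also have "\<dots> = of_nat (\<Sum>q\<in>I. m q) * (\<Prod>x\<in>I. hsym (ptr A) (m x))"
      by (simp add: sum_distrib_right)
    finally show ?thesis .
  qed
  have "(LINT A|M. (\<Sum>q\<in>I. (\<Sum>r=1..m q. hsym (ptr A) (m q - r) * ptr A (r + k)) * (\<Prod>x\<in>I - {q}. hsym (ptr A) (m x)))
       + (\<Prod>x\<in>I. hsym (ptr A) (m x)) * (\<Sum>a<k. ptr A a * ptr A (k - a)))
    = (LINT A|M. (\<Sum>i<n. \<Sum>j<n. ?G (i, j) A * (A ^\<^sub>m k) $$ (i, j)) + (\<Prod>x\<in>I. hsym (ptr A) (m x)) * (\<Sum>a<k. ptr A a * ptr A (k - a)))"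
    by (rule Bochner_Integration.integral_cong[OF refl]) (simp only: space_M 1)
  moreover have "(LINT A|M. ((\<Sum>l<n. ?G (l, l) A) + of_nat k * (\<Prod>x\<in>I. hsym (ptr A) (m x))) * ptr A k)
    = (LINT A|M. of_nat ((\<Sum>q\<in>I. m q) + k) * ((\<Prod>x\<in>I. hsym (ptr A) (m x)) * ptr A k))"
    by (rule Bochner_Integration.integral_cong[OF refl]) (simp only: space_M 2 of_nat_add distrib_right mult.assoc)
  ultimately show ?thesis
    using loop_equation[OF F, of k] by (simp only: integral_mult_right_zero)
qed


end

section \<open>Integrability of the moments and vanishing of the unbalanced ones\<close>

definition smooth_on_SU :: "nat \<Rightarrow> (complex mat \<Rightarrow> complex) \<Rightarrow> bool" where
  "smooth_on_SU n F \<longleftrightarrow> (\<exists>G. has_grad n F G)"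

lemma smooth_on_SU_intros:
  "smooth_on_SU n (\<lambda>_. c)"
  "smooth_on_SU n (\<lambda>A. ptr A k)"
  "smooth_on_SU n (\<lambda>A. hsym (ptr A) k)"
  "smooth_on_SU n F1 \<Longrightarrow> smooth_on_SU n F2 \<Longrightarrow> smooth_on_SU n (\<lambda>A. F1 A + F2 A)"
  "smooth_on_SU n F1 \<Longrightarrow> smooth_on_SU n F2 \<Longrightarrow> smooth_on_SU n (\<lambda>A. F1 A * F2 A)"
  unfolding smooth_on_SU_def
  using has_grad_const has_grad_ptr has_grad_hsym has_grad_add has_grad_mult by blast+

lemma smooth_on_SU_sum:
  assumes "finite I" "\<And>x. x \<in> I \<Longrightarrow> smooth_on_SU n (F x)"
  shows "smooth_on_SU n (\<lambda>A. \<Sum>x\<in>I. F x A)"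
  using assms by (induction I rule: finite_induct) (simp_all add: smooth_on_SU_intros)

lemma smooth_on_SU_prod:
  assumes "finite I" "\<And>x. x \<in> I \<Longrightarrow> smooth_on_SU n (F x)"
  shows "smooth_on_SU n (\<lambda>A. \<Prod>x\<in>I. F x A)"
  using assms by (induction I rule: finite_induct) (simp_all add: smooth_on_SU_intros)

lemma smooth_on_SU_hcross: "smooth_on_SU n (\<lambda>A. hcross (ptr A) a b)"
  unfolding hcross_def by (intro smooth_on_SU_sum smooth_on_SU_intros finite_atLeastAtMost)

context haar begin

lemma smooth_integrable: "smooth_on_SU n F \<Longrightarrow> integrable M F"
  using has_grad_integrable(1) unfolding smooth_on_SU_def by blast

text \<open>Summing the loop equations for \<open>k = 1, \<dots>, m p\<close>, weighted by \<open>h\<^bsub>m p - k\<^esub>\<close>, produces the Casimir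
  eigenvalue of the row \<open>p\<close> and a cross term for each other row.\<close>

lemma casimir_row:
  assumes I: "finite I" and p: "p \<in> I" and n: "n > 0"
  shows "of_nat n * (of_nat (m p * m p + (n - 1) * m p) * (LINT A|M. (\<Prod>x\<in>I. hsym (ptr A) (m x)))
      + (\<Sum>q\<in>I - {p}. (LINT A|M. hcross (ptr A) (m p) (m q) * (\<Prod>x\<in>I - {p} - {q}. hsym (ptr A) (m x)))))
    = of_nat ((\<Sum>q\<in>I. m q) * m p) * (LINT A|M. (\<Prod>x\<in>I. hsym (ptr A) (m x)))"
proof -
  let ?h = "\<lambda>A. hsym (ptr A)"
  define P where "P A = (\<Prod>x\<in>I - {p}. ?h A (m x))" for A
  define Q where "Q q A = (\<Prod>x\<in>I - {p} - {q}. ?h A (m x))" for q A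
  define S where "S k A = (\<Sum>r=1..m p - k. ?h A (m p - k - r) * ptr A (r + k)) + ?h A (m p - k) * (\<Sum>a<k. ptr A a * ptr A (k - a))" for k A
  define U where "U k q A = (\<Sum>r=1..m q. ?h A (m q - r) * ptr A (r + k)) * (?h A (m p - k) * Q q A)" for k q A
  have sP: "smooth_on_SU n P" unfolding P_def by (intro smooth_on_SU_prod smooth_on_SU_intros) (use I in simp)
  have sQ: "smooth_on_SU n (Q q)" for q unfolding Q_def by (intro smooth_on_SU_prod smooth_on_SU_intros) (use I in simp)
  have sS: "smooth_on_SU n (S k)" for k unfolding S_def by (intro smooth_on_SU_sum smooth_on_SU_intros) simp_all
  have sU: "smooth_on_SU n (U k q)" for k q unfolding U_def
    by (intro smooth_on_SU_sum smooth_on_SU_intros(1-3) smooth_on_SU_intros(4,5) sQ) simp_all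
  have 1: "of_nat n * (LINT A|M. S k A * P A + (\<Sum>q\<in>I - {p}. U k q A))
    = of_nat (\<Sum>q\<in>I. m q) * (LINT A|M. ?h A (m p - k) * P A * ptr A k)" if k: "k \<in> {1..m p}" for k
  proof -
    \<comment> \<open>Lowering row p by k compensates the factor \<open>ptr A k\<close>, so the
      degree on the right is the same for every k.\<close>
    define m' where "m' = m(p := m p - k)"
    have m': "m' p = m p - k" "\<And>x. x \<noteq> p \<Longrightarrow> m' x = m x" by (simp_all add: m'_def)
    have pr: "(\<Prod>x\<in>I - {p}. ?h A (m' x)) = P A" for A
      unfolding P_def by (intro prod.cong refl) (simp add: m')
    have prI: "(\<Prod>x\<in>I. ?h A (m' x)) = ?h A (m p - k) * P A" for A
      unfolding prod.remove[OF I p] pr by (simp add: m')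
    have prq: "(\<Prod>x\<in>I - {q}. ?h A (m' x)) = ?h A (m p - k) * Q q A" if "q \<in> I - {p}" for q A
    proof -
      have e: "I - {q} - {p} = I - {p} - {q}" by auto
      have "p \<in> I - {q}" "finite (I - {q})" using that p I by auto
      moreover have "(\<Prod>x\<in>I - {p} - {q}. ?h A (m' x)) = Q q A"
        unfolding Q_def by (intro prod.cong refl) (simp add: m')
      ultimately show ?thesis
        using prod.remove[of "I - {q}" p "\<lambda>x. ?h A (m' x)"] unfolding e by (simp add: m')
    qed
    have sm: "(\<Sum>q\<in>I. m' q) + k = (\<Sum>q\<in>I. m q)"
    proof -
      have "(\<Sum>q\<in>I - {p}. m' q) = (\<Sum>q\<in>I - {p}. m q)" by (intro sum.cong refl) (simp add: m')
      thus ?thesis using k sum.remove[OF I p, of m'] sum.remove[OF I p, of m] by (simp add: m')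
    qed
    have L: "(\<Sum>q\<in>I. (\<Sum>r=1..m' q. ?h A (m' q - r) * ptr A (r + k)) * (\<Prod>x\<in>I - {q}. ?h A (m' x)))
       + (\<Prod>x\<in>I. ?h A (m' x)) * (\<Sum>a<k. ptr A a * ptr A (k - a)) = S k A * P A + (\<Sum>q\<in>I - {p}. U k q A)" for A
    proof -
      have "(\<Sum>q\<in>I - {p}. (\<Sum>r=1..m' q. ?h A (m' q - r) * ptr A (r + k)) * (\<Prod>x\<in>I - {q}. ?h A (m' x)))
        = (\<Sum>q\<in>I - {p}. U k q A)"
        by (intro sum.cong refl) (simp add: prq U_def m')
      thus ?thesis
        unfolding prI sum.remove[OF I p, of "\<lambda>q. (\<Sum>r=1..m' q. ?h A (m' q - r) * ptr A (r + k)) * (\<Prod>x\<in>I - {q}. ?h A (m' x))"] pr m'(1)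
        by (simp add: S_def algebra_simps)
    qed
    show ?thesis
      using loop_equation_hsym[OF I, of m' k] unfolding L sm unfolding prI .
  qed
  have 2: "(\<Sum>k=1..m p. S k A * P A + (\<Sum>q\<in>I - {p}. U k q A)) =
     of_nat (m p * m p + (n - 1) * m p) * (\<Prod>x\<in>I. ?h A (m x)) + (\<Sum>q\<in>I - {p}. hcross (ptr A) (m p) (m q) * Q q A)"
    if A: "A \<in> SU n" for A
  proof -
    have "(\<Sum>k=1..m p. S k A * P A) = (\<Sum>k=1..m p. S k A) * P A" by (simp only: sum_distrib_right)
    also have "(\<Sum>k=1..m p. S k A) = (of_nat (m p) * of_nat (m p) + (ptr A 0 - 1) * of_nat (m p)) * ?h A (m p)"
      unfolding S_def by (rule hsym_casimir)
    also have "of_nat (m p) * of_nat (m p) + (ptr A 0 - 1) * of_nat (m p) = (of_nat (m p * m p + (n - 1) * m p) :: complex)"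
      using n ptr_0[OF A] by (simp add: of_nat_diff)
    finally have a: "(\<Sum>k=1..m p. S k A * P A) = of_nat (m p * m p + (n - 1) * m p) * (\<Prod>x\<in>I. ?h A (m x))"
      unfolding prod.remove[OF I p] P_def by (simp only: mult.assoc)
    have "(\<Sum>k=1..m p. \<Sum>q\<in>I - {p}. U k q A) = (\<Sum>q\<in>I - {p}. \<Sum>k=1..m p. U k q A)" by (rule sum.swap)
    also have "\<dots> = (\<Sum>q\<in>I - {p}. hcross (ptr A) (m p) (m q) * Q q A)"
    proof (rule sum.cong[OF refl])
      fix q
      show "(\<Sum>k=1..m p. U k q A) = hcross (ptr A) (m p) (m q) * Q q A"
        unfolding U_def hcross_def sum_distrib_right
        by (intro sum.cong refl) (simp add: mult_ac add.commute)
    qed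
    finally show ?thesis unfolding sum.distrib a by simp
  qed
  have 3: "(\<Sum>k=1..m p. ?h A (m p - k) * P A * ptr A k) = of_nat (m p) * (\<Prod>x\<in>I. ?h A (m x))" for A
    unfolding prod.remove[OF I p] mult.assoc[symmetric] hsym_newton P_def sum_distrib_right
    by (intro sum.cong refl) (simp only: mult_ac)
  have "(\<Sum>k=1..m p. of_nat n * (LINT A|M. S k A * P A + (\<Sum>q\<in>I - {p}. U k q A)))
    = of_nat n * (LINT A|M. (\<Sum>k=1..m p. S k A * P A + (\<Sum>q\<in>I - {p}. U k q A)))"
    unfolding sum_distrib_left[symmetric]
    by (subst Bochner_Integration.integral_sum)
      (auto intro!: smooth_integrable smooth_on_SU_intros(4,5) smooth_on_SU_sum sS sU sP simp: I)
  also have "(LINT A|M. (\<Sum>k=1..m p. S k A * P A + (\<Sum>q\<in>I - {p}. U k q A))) =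
    (LINT A|M. of_nat (m p * m p + (n - 1) * m p) * (\<Prod>x\<in>I. ?h A (m x)) + (\<Sum>q\<in>I - {p}. hcross (ptr A) (m p) (m q) * Q q A))"
    by (rule Bochner_Integration.integral_cong[OF refl]) (simp only: space_M 2)
  also have "\<dots> = of_nat (m p * m p + (n - 1) * m p) * (LINT A|M. (\<Prod>x\<in>I. ?h A (m x))) + (\<Sum>q\<in>I - {p}. (LINT A|M. hcross (ptr A) (m p) (m q) * Q q A))"
  proof -
    have i1: "integrable M (\<lambda>A. \<Prod>x\<in>I. ?h A (m x))"
      by (intro smooth_integrable smooth_on_SU_prod smooth_on_SU_intros I)
    have i2: "integrable M (\<lambda>A. hcross (ptr A) (m p) (m q) * Q q A)" for q
      by (intro smooth_integrable smooth_on_SU_intros(5) smooth_on_SU_hcross sQ)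
    show ?thesis using i1 i2
      by (subst Bochner_Integration.integral_add)
        (auto intro!: Bochner_Integration.integrable_sum Bochner_Integration.integral_sum)
  qed
  finally have 4: "(\<Sum>k=1..m p. of_nat n * (LINT A|M. S k A * P A + (\<Sum>q\<in>I - {p}. U k q A))) = of_nat n *
    (of_nat (m p * m p + (n - 1) * m p) * (LINT A|M. (\<Prod>x\<in>I. ?h A (m x))) + (\<Sum>q\<in>I - {p}. (LINT A|M. hcross (ptr A) (m p) (m q) * Q q A)))" .
  have "(\<Sum>k=1..m p. of_nat (\<Sum>q\<in>I. m q) * (LINT A|M. ?h A (m p - k) * P A * ptr A k)) =
    of_nat (\<Sum>q\<in>I. m q) * (LINT A|M. (\<Sum>k=1..m p. ?h A (m p - k) * P A * ptr A k))"
    unfolding sum_distrib_left[symmetric]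
    by (subst Bochner_Integration.integral_sum)
      (auto intro!: smooth_integrable smooth_on_SU_intros(2,3) smooth_on_SU_intros(5) sP)
  also have "\<dots> = of_nat ((\<Sum>q\<in>I. m q) * m p) * (LINT A|M. (\<Prod>x\<in>I. ?h A (m x)))"
    unfolding 3 by simp
  finally have 5: "(\<Sum>k=1..m p. of_nat (\<Sum>q\<in>I. m q) * (LINT A|M. ?h A (m p - k) * P A * ptr A k)) =
    of_nat ((\<Sum>q\<in>I. m q) * m p) * (LINT A|M. (\<Prod>x\<in>I. ?h A (m x)))" .
  have "(\<Sum>k=1..m p. of_nat n * (LINT A|M. S k A * P A + (\<Sum>q\<in>I - {p}. U k q A))) =
    (\<Sum>k=1..m p. of_nat (\<Sum>q\<in>I. m q) * (LINT A|M. ?h A (m p - k) * P A * ptr A k))"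
    by (intro sum.cong refl 1)
  thus ?thesis unfolding 4 5 Q_def .
qed

text \<open>Induction towards more unbalanced exponents of the same total: each cross term expands
  into more unbalanced products, whose integrals vanish, and a multiple of the integral itself.
  Every row then gives a scalar equation for that integral. The sum of these equations has different
  scalars on its two sides, by Cauchy-Schwarz and because some two exponents differ.\<close>

lemma integral_prod_hsym_eq_0:
  assumes I: "finite I" "card I = n" and "p \<in> I" "q \<in> I" "m p \<noteq> m q"
  shows "(LINT A|M. (\<Prod>x\<in>I. hsym (ptr A) (m x))) = 0"
  using assms(3-)
proof (induction "(\<Sum>x\<in>I. m x)\<^sup>2 - (\<Sum>x\<in>I. (m x)\<^sup>2)" arbitrary: m p q rule: less_induct)
  case less
  define T where "T m = (LINT A|M. (\<Prod>x\<in>I. hsym (ptr A) (m x)))" for m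
  have n: "n > 0" using I less.prems(1) card_gt_0_iff by blast
  \<comment> \<open>The induction measure is a difference of natural numbers; this bound excludes
    truncation, so that a larger sum of squares really lowers it.\<close>
  have sq_le: "(\<Sum>x\<in>I. (m x)\<^sup>2) \<le> (\<Sum>x\<in>I. m x)\<^sup>2" for m :: "'a \<Rightarrow> nat"
  proof -
    have "(\<Sum>x\<in>I. (m x)\<^sup>2) \<le> (\<Sum>x\<in>I. m x * (\<Sum>x\<in>I. m x))"
      unfolding power2_eq_square using I by (intro sum_mono mult_left_mono member_le_sum) auto
    thus ?thesis by (simp add: power2_eq_square sum_distrib_right)
  qed
  have prodI: "(\<Prod>x\<in>I. f x) = f r * (f s * (\<Prod>x\<in>I - {r} - {s}. f x))" if "r \<in> I" "s \<in> I" "r \<noteq> s" for f :: "'a \<Rightarrow> complex" and r s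
    using that I prod.remove[of I r f] prod.remove[of "I - {r}" s f] by simp
  have sumI: "(\<Sum>x\<in>I. f x) = f r + (f s + (\<Sum>x\<in>I - {r} - {s}. f x))" if "r \<in> I" "s \<in> I" "r \<noteq> s" for f :: "'a \<Rightarrow> nat" and r s
    using that I sum.remove[of I r f] sum.remove[of "I - {r}" s f] by simp
  have cross_le: "(LINT A|M. hcross (ptr A) (m r) (m s) * (\<Prod>x\<in>I - {r} - {s}. hsym (ptr A) (m x))) = - of_nat (m s) * T m"
    if rs: "r \<in> I" "s \<in> I" "r \<noteq> s" "m s \<le> m r" for r s
  proof -
    define b c where "b = m s" and "c = m r - m s"
    have bc: "m s = b" "m r = b + c" using rs by (auto simp: b_def c_def)
    define Q where "Q A = (\<Prod>x\<in>I - {r} - {s}. hsym (ptr A) (m x))" for A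
    define m' where "m' j = m(r := b + c + j, s := b - j)" for j
    have pm: "(\<Prod>x\<in>I. hsym (ptr A) (m' j x)) = hsym (ptr A) (b + c + j) * (hsym (ptr A) (b - j) * Q A)" for j A
    proof -
      have "(\<Prod>x\<in>I - {r} - {s}. hsym (ptr A) (m' j x)) = Q A"
        unfolding Q_def m'_def by (intro prod.cong refl) auto
      thus ?thesis unfolding prodI[OF rs(1-3)] using rs by (simp add: m'_def)
    qed
    have T0: "T (m' j) = 0" if j: "j \<in> {1..b}" for j
      unfolding T_def
    proof (rule less.hyps[of _ r s])
      have eq: "(\<Sum>x\<in>I - {r} - {s}. g (m' j x)) = (\<Sum>x\<in>I - {r} - {s}. g (m x))" for g :: "nat \<Rightarrow> nat"
        unfolding m'_def by (intro sum.cong refl) auto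
      have s1: "(\<Sum>x\<in>I. m' j x) = (\<Sum>x\<in>I. m x)"
        unfolding sumI[OF rs(1-3), of "\<lambda>x. m' j x"] sumI[OF rs(1-3), of m] eq[of "\<lambda>x. x"]
        using rs j by (simp add: m'_def bc)
      have "(b + c)\<^sup>2 + b\<^sup>2 < (b + c + j)\<^sup>2 + (b - j)\<^sup>2"
      proof -
        obtain d where d: "b = j + d" using j by (metis atLeastAtMost_iff le_Suc_ex)
        show ?thesis using j unfolding d by (simp add: power2_eq_square algebra_simps)
      qed
      hence s2: "(\<Sum>x\<in>I. (m x)\<^sup>2) < (\<Sum>x\<in>I. (m' j x)\<^sup>2)"
        unfolding sumI[OF rs(1-3), of "\<lambda>x. (m' j x)\<^sup>2"] sumI[OF rs(1-3), of "\<lambda>x. (m x)\<^sup>2"] eq[of "\<lambda>x. x\<^sup>2"]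
        using rs by (simp add: m'_def bc)
      show "(\<Sum>x\<in>I. m' j x)\<^sup>2 - (\<Sum>x\<in>I. (m' j x)\<^sup>2) < (\<Sum>x\<in>I. m x)\<^sup>2 - (\<Sum>x\<in>I. (m x)\<^sup>2)"
        using s2 sq_le[of "m' j"] unfolding s1 by linarith
      have "b + c + j \<noteq> b - j" using j by auto
      thus "m' j r \<noteq> m' j s" using rs by (simp add: m'_def)
    qed (use rs in auto)
    have T00: "T m = (LINT A|M. hsym (ptr A) (b + c) * (hsym (ptr A) b * Q A))"
      unfolding T_def prodI[OF rs(1-3)] Q_def bc ..
    have smooth: "integrable M (\<lambda>A. \<Prod>x\<in>I. hsym (ptr A) (m' j x))" for j
      by (intro smooth_integrable smooth_on_SU_prod smooth_on_SU_intros I)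
    have smooth0: "integrable M (\<lambda>A. hsym (ptr A) (b + c) * (hsym (ptr A) b * Q A))"
      unfolding Q_def by (intro smooth_integrable smooth_on_SU_prod smooth_on_SU_intros) (use I in auto)
    have "(LINT A|M. hcross (ptr A) (m r) (m s) * Q A) =
      (LINT A|M. (\<Sum>j=1..b. of_nat (c + 2 * j) * (\<Prod>x\<in>I. hsym (ptr A) (m' j x))) - of_nat b * (hsym (ptr A) (b + c) * (hsym (ptr A) b * Q A)))"
      unfolding bc hcross_expand pm left_diff_distrib sum_distrib_right by (simp only: mult.assoc)
    also have "\<dots> = (\<Sum>j=1..b. of_nat (c + 2 * j) * T (m' j)) - of_nat b * T m"
      using smooth smooth0 unfolding T00 T_def[of "m' _"]
      by (subst Bochner_Integration.integral_diff)
        (auto intro!: Bochner_Integration.integrable_sum Bochner_Integration.integral_sum)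
    also have "\<dots> = - of_nat (m s) * T m" using T0 by (simp add: bc)
    finally show ?thesis unfolding Q_def .
  qed
  have cross: "(LINT A|M. hcross (ptr A) (m r) (m s) * (\<Prod>x\<in>I - {r} - {s}. hsym (ptr A) (m x))) = - of_nat (min (m r) (m s)) * T m"
    if rs: "r \<in> I" "s \<in> I - {r}" for r s
  proof (cases "m s \<le> m r")
    case True
    hence "min (m r) (m s) = m s" by simp
    moreover have "r \<noteq> s" using rs by auto
    ultimately show ?thesis using cross_le[of r s] rs True by simp
  next
    case False
    have e: "I - {r} - {s} = I - {s} - {r}" by auto
    have "min (m r) (m s) = m r" using False by simp
    thus ?thesis using cross_le[of s r] rs False unfolding e hcross_commute[of _ "m r"] by simp
  qed
  define s where "s = (\<Sum>x\<in>I. m x)"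
  \<comment> \<open>The n - 1 copies of \<open>m r\<close> from the Casimir eigenvalue are shared
    out among the other rows, so that every summand is nonnegative and is positive where the other
    row is shorter.\<close>
  define K where "K r = (real (m r))\<^sup>2 + (\<Sum>x\<in>I - {r}. real (m r) - real (min (m r) (m x)))" for r
  have row: "complex_of_real (real n * K r) * T m = complex_of_real (real s * real (m r)) * T m" if r: "r \<in> I" for r
  proof -
    have "(\<Sum>x\<in>I - {r}. (LINT A|M. hcross (ptr A) (m r) (m x) * (\<Prod>y\<in>I - {r} - {x}. hsym (ptr A) (m y)))) =
      (\<Sum>x\<in>I - {r}. - of_nat (min (m r) (m x)) * T m)"
      by (intro sum.cong refl cross r)
    hence "of_nat n * (of_nat (m r * m r + (n - 1) * m r) * T m + (\<Sum>x\<in>I - {r}. - of_nat (min (m r) (m x)) * T m))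
      = of_nat (s * m r) * T m"
      using casimir_row[OF I(1) r n, of m] unfolding T_def s_def by simp
    also have "of_nat (m r * m r + (n - 1) * m r) * T m + (\<Sum>x\<in>I - {r}. - of_nat (min (m r) (m x)) * T m)
      = complex_of_real (K r) * T m"
    proof -
      have "card (I - {r}) = n - 1" using I r by simp
      hence "K r = real (m r * m r + (n - 1) * m r) + (\<Sum>x\<in>I - {r}. - real (min (m r) (m x)))"
        unfolding K_def sum_subtractf by (simp add: power2_eq_square sum_negf)
      thus ?thesis by (simp only: of_real_add of_real_sum of_real_minus of_real_of_nat_eq distrib_right sum_distrib_right)
    qed
    finally show ?thesis by simp
  qed
  have "complex_of_real (\<Sum>r\<in>I. real n * K r) * T m = complex_of_real (\<Sum>r\<in>I. real s * real (m r)) * T m"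
    unfolding of_real_sum sum_distrib_right by (intro sum.cong refl row)
  moreover have "(\<Sum>r\<in>I. real s * real (m r)) < (\<Sum>r\<in>I. real n * K r)"
  proof -
    have "(\<Sum>r\<in>I. real s * real (m r)) = (\<Sum>r\<in>I. real (m r))\<^sup>2"
      by (simp add: s_def sum_distrib_left[symmetric] power2_eq_square)
    also have "\<dots> \<le> (\<Sum>r\<in>I. (real (m r))\<^sup>2) * real n"
      using sum_squared_le_sum_of_squares[of "\<lambda>r. real (m r)" I] I by simp
    also have "(\<Sum>r\<in>I. (real (m r))\<^sup>2) < (\<Sum>r\<in>I. K r)"
    proof -
      obtain r x where rx: "r \<in> I" "x \<in> I" "m x < m r"
        using less.prems by (metis linorder_neqE_nat)
      show ?thesis
      proof (rule sum_strict_mono_ex1[OF I(1)])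
        have nn: "0 \<le> real (m y) - real (min (m y) (m z))" for y z by simp
        show "\<forall>y\<in>I. (real (m y))\<^sup>2 \<le> K y"
          unfolding K_def using nn by (auto intro!: sum_nonneg)
        have "0 < (\<Sum>z\<in>I - {r}. real (m r) - real (min (m r) (m z)))"
          using I rx nn by (intro sum_pos2[of _ x]) auto
        thus "\<exists>y\<in>I. (real (m y))\<^sup>2 < K y" using rx unfolding K_def by (intro bexI[of _ r]) auto
      qed
    qed
    hence "(\<Sum>r\<in>I. (real (m r))\<^sup>2) * real n < (\<Sum>r\<in>I. K r) * real n" using n by simp
    finally show ?thesis by (simp add: sum_distrib_left mult.commute)
  qed
  ultimately have "T m = 0"
    by (metis less_irrefl mult_cancel_right of_real_eq_iff)
  thus ?case by (simp add: T_def)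
qed

end

section \<open>Products over eigenvalues as determinants\<close>

text \<open>The coefficients of this differential equation are exactly Newton's identities, which
  determine F from its constant term.\<close>

lemma fps_newton:
  fixes F :: "'a :: field_char_0 fps"
  assumes F0: "fps_nth F 0 = 1" and F: "fps_X * fps_deriv F = F * Abs_fps (\<lambda>k. if k = 0 then 0 else p k)"
  shows "fps_nth F m = hsym p m"
proof (induction m rule: less_induct)
  case (less m)
  show ?case
  proof (cases "m = 0")
    case True
    thus ?thesis using F0 by simp
  next
    case m: False
    then obtain l where l: "m = Suc l" by (cases m) simp_all
    have 1: "fps_nth (fps_X * fps_deriv F) m = of_nat m * fps_nth F m" unfolding l by simp
    have "fps_nth (F * Abs_fps (\<lambda>k. if k = 0 then 0 else p k)) m
        = fps_nth (Abs_fps (\<lambda>k. if k = 0 then 0 else p k) * F) m"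
      by (simp only: mult.commute)
    also have "\<dots> = (\<Sum>i=0..m. (if i = 0 then 0 else p i) * fps_nth F (m - i))"
      unfolding fps_mult_nth fps_nth_Abs_fps ..
    also have "\<dots> = (\<Sum>k=1..m. p k * hsym p (m - k))"
    proof (rule sum.mono_neutral_cong_right)
      fix k assume "k \<in> {1..m}"
      thus "(if k = 0 then 0 else p k) * fps_nth F (m - k) = p k * hsym p (m - k)"
        using less[of "m - k"] by simp
    qed auto
    also have "\<dots> = of_nat m * hsym p m" by (rule hsym_newton[symmetric])
    finally have "of_nat m * fps_nth F m = of_nat m * hsym p m" unfolding F[symmetric] 1 .
    thus ?thesis using m by (simp only: mult_cancel_left of_nat_eq_0_iff simp_thms)
  qed
qed

definition psum :: "complex list \<Rightarrow> nat \<Rightarrow> complex" where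
  "psum zs k = (\<Sum>z\<leftarrow>zs. z ^ k)"

definition revpoly :: "complex list \<Rightarrow> complex poly" where
  "revpoly zs = (\<Prod>z\<leftarrow>zs. [:1, - z:])"

text \<open>The coefficients of \<open>revpoly\<close> are the signed elementary symmetric
  functions, so this is the duality between them and the h_m. The inverse series satisfies the
  equation of \<open>fps_newton\<close>, because each linear factor has a geometric logarithmic
  derivative.\<close>

lemma revpoly_hsym:
  "fps_of_poly (revpoly zs) * Abs_fps (hsym (psum zs)) = 1"
proof -
  define L where "L z = fps_of_poly [:1, - z:]" for z :: complex
  define P where "P zs = Abs_fps (\<lambda>k. if k = 0 then 0 else psum zs k)" for zs
  have L: "L z = 1 - fps_const z * fps_X" for z
    unfolding L_def by (rule fps_ext) (auto simp: coeff_pCons fps_X_def split: nat.splits)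
  have L0: "fps_nth (L z) 0 = 1" for z by (simp add: L)
  have geo: "L z * Abs_fps (\<lambda>k. if k = 0 then 0 else z ^ k) = fps_const z * fps_X" for z
  proof (rule fps_ext)
    fix m
    show "fps_nth (L z * Abs_fps (\<lambda>k. if k = 0 then 0 else z ^ k)) m = fps_nth (fps_const z * fps_X) m"
    proof (cases m)
      case (Suc l)
      thus ?thesis unfolding L left_diff_distrib mult.assoc by (cases l) simp_all
    qed (simp add: L left_diff_distrib mult.assoc)
  qed
  have P_Cons: "P (z # zs) = Abs_fps (\<lambda>k. if k = 0 then 0 else z ^ k) + P zs" for z zs
    unfolding P_def psum_def by (rule fps_ext) simp
  define F where "F zs = inverse (fps_of_poly (revpoly zs))" for zs
  have ER: "fps_nth (fps_of_poly (revpoly zs)) 0 = 1" for zs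
    by (induction zs) (simp_all add: revpoly_def fps_of_poly_mult coeff_mult)
  have FR: "fps_of_poly (revpoly zs) * F zs = 1" for zs
    unfolding F_def by (rule inverse_mult_eq_1') (simp only: ER one_neq_zero not_False_eq_True)
  have dR: "fps_X * fps_deriv (fps_of_poly (revpoly zs)) = - (fps_of_poly (revpoly zs) * P zs)" for zs
  proof (induction zs)
    case Nil
    show ?case by (simp add: revpoly_def P_def psum_def fps_eq_iff)
  next
    case (Cons z zs)
    let ?R = "fps_of_poly (revpoly zs)"
    have e: "fps_of_poly (revpoly (z # zs)) = L z * ?R"
      by (simp add: revpoly_def fps_of_poly_mult L_def)
    have dL: "fps_X * fps_deriv (L z) = - (fps_const z * fps_X)" by (simp add: L)
    have "fps_X * fps_deriv (L z * ?R) = (fps_X * fps_deriv (L z)) * ?R + L z * (fps_X * fps_deriv ?R)"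
      by (simp add: algebra_simps)
    also have "\<dots> = - (L z * Abs_fps (\<lambda>k. if k = 0 then 0 else z ^ k)) * ?R - L z * (?R * P zs)"
      unfolding dL Cons.IH geo by simp
    also have "\<dots> = - (L z * ?R * P (z # zs))"
      unfolding P_Cons by (simp add: algebra_simps)
    finally show ?case unfolding e .
  qed
  \<comment> \<open>Both sides agree after multiplication by \<open>revpoly zs\<close>, and
    \<open>F zs\<close> undoes that multiplication.\<close>
  have dF: "fps_X * fps_deriv (F zs) = F zs * P zs"
  proof -
    let ?R = "fps_of_poly (revpoly zs)"
    let ?D = "fps_X * fps_deriv (F zs) - F zs * P zs"
    have "?R * ?D = ?R * (fps_X * fps_deriv (F zs)) + - (?R * P zs) * F zs"
      by (simp add: right_diff_distrib mult_ac)
    also have "\<dots> = fps_X * (?R * fps_deriv (F zs) + fps_deriv ?R * F zs)"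
      unfolding dR[symmetric] by (simp add: distrib_left mult_ac)
    also have "\<dots> = fps_X * fps_deriv (?R * F zs)" by (simp only: fps_deriv_mult)
    also have "\<dots> = 0" unfolding FR by simp
    finally have z: "?R * ?D = 0" .
    have "?D = (?R * F zs) * ?D" unfolding FR by simp
    also have "\<dots> = F zs * (?R * ?D)" by (simp only: mult_ac)
    also have "\<dots> = 0" unfolding z by simp
    finally show ?thesis by (simp only: right_minus_eq)
  qed
  have "fps_nth (F zs) 0 = 1" by (simp only: F_def fps_inverse_nth_0 ER inverse_1)
  hence "fps_nth (F zs) m = hsym (psum zs) m" for m
  proof (rule fps_newton)
    show "fps_X * fps_deriv (F zs) = F zs * Abs_fps (\<lambda>k. if k = 0 then 0 else psum zs k)"
      using dF unfolding P_def .
  qed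
  hence "F zs = Abs_fps (hsym (psum zs))" by (intro fps_ext) (simp only: fps_nth_Abs_fps)
  from FR[of zs, unfolded this] show ?thesis .
qed

text \<open>With zeros at negative indices the recurrence holds for every s > 0. It fails at s = 0,
  where only h_0 = 1 remains.\<close>

definition hext :: "complex list \<Rightarrow> int \<Rightarrow> complex" where
  "hext zs s = (if s < 0 then 0 else hsym (psum zs) (nat s))"

lemma degree_revpoly: "degree (revpoly zs) \<le> length zs"
proof (induction zs)
  case (Cons z zs)
  have "degree ([:1, - z:] * revpoly zs) \<le> degree [:1, - z:] + degree (revpoly zs)" by (rule degree_mult_le)
  also have "degree [:1, - z:] \<le> 1" by (rule degree_pCons_le[THEN order_trans]) simp
  finally show ?case using Cons by (simp add: revpoly_def)
qed (simp add: revpoly_def)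

lemma coeff_linear_mult:
  "coeff ([:a, b:] * f) k = a * coeff f k + b * (if k = 0 then 0 else coeff f (k - 1))"
  by (cases k) simp_all

lemma revpoly_reflect:
  "(\<Sum>l\<le>length zs. coeff (revpoly zs) (length zs - l) * r ^ l) = (\<Prod>z\<leftarrow>zs. r - z)"
proof (induction zs)
  case (Cons z zs)
  let ?n = "length zs"
  let ?c = "coeff (revpoly zs)"
  have rc: "revpoly (z # zs) = [:1, - z:] * revpoly zs" by (simp add: revpoly_def)
  have top: "?c (Suc ?n) = 0" using degree_revpoly[of zs] by (intro coeff_eq_0) simp
  have s1: "(\<Sum>l\<le>Suc ?n. ?c (Suc ?n - l) * r ^ l) = r * (\<Sum>l\<le>?n. ?c (?n - l) * r ^ l)"
    unfolding sum.atMost_Suc_shift sum_distrib_left using top by (simp add: mult_ac)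
  have s2: "(\<Sum>l\<le>Suc ?n. (if Suc ?n - l = 0 then 0 else ?c (Suc ?n - l - 1)) * r ^ l) = (\<Sum>l\<le>?n. ?c (?n - l) * r ^ l)"
    by (rule sum.mono_neutral_cong_right) auto
  have "(\<Sum>l\<le>length (z # zs). coeff (revpoly (z # zs)) (length (z # zs) - l) * r ^ l) =
    (\<Sum>l\<le>Suc ?n. ?c (Suc ?n - l) * r ^ l - z * ((if Suc ?n - l = 0 then 0 else ?c (Suc ?n - l - 1)) * r ^ l))"
    unfolding rc coeff_linear_mult by (intro sum.cong) (simp_all add: left_diff_distrib)
  also have "\<dots> = (r - z) * (\<Sum>l\<le>?n. ?c (?n - l) * r ^ l)"
    unfolding sum_subtractf sum_distrib_left[symmetric] s1 s2 left_diff_distrib ..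
  finally show ?case unfolding Cons.IH by simp
qed (simp add: revpoly_def)

lemma hext_recurrence:
  assumes "s > 0"
  shows "(\<Sum>r\<le>length zs. coeff (revpoly zs) r * hext zs (s - int r)) = 0"
proof -
  let ?n = "length zs"
  define m where "m = nat s"
  have m: "s = int m" "m > 0" using assms by (auto simp: m_def)
  have "0 = fps_nth (fps_of_poly (revpoly zs) * Abs_fps (hsym (psum zs))) m"
    unfolding revpoly_hsym using m by simp
  also have "\<dots> = (\<Sum>r=0..m. coeff (revpoly zs) r * hsym (psum zs) (m - r))"
    by (simp add: fps_mult_nth)
  also have "\<dots> = (\<Sum>r\<in>{..max m ?n}. coeff (revpoly zs) r * hext zs (s - int r))"
    by (rule sum.mono_neutral_cong_left) (auto simp: hext_def m nat_diff_distrib)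
  also have "\<dots> = (\<Sum>r\<le>?n. coeff (revpoly zs) r * hext zs (s - int r))"
    using degree_revpoly[of zs] by (intro sum.mono_neutral_right) (auto intro!: coeff_eq_0)
  finally show ?thesis by simp
qed

text \<open>The linear functional sending X^i to h_(i+s), applied to f. Multiplying f by X amounts
  to raising s by one.\<close>

definition hpair :: "complex list \<Rightarrow> complex poly \<Rightarrow> int \<Rightarrow> complex" where
  "hpair zs f s = (\<Sum>i\<le>degree f. coeff f i * hext zs (int i + s))"

lemma hpair_bound:
  assumes "degree f \<le> d"
  shows "hpair zs f s = (\<Sum>i\<le>d. coeff f i * hext zs (int i + s))"
  unfolding hpair_def using assms by (intro sum.mono_neutral_left) (auto intro!: coeff_eq_0)

lemma hpair_linear_factor:
  "hpair zs ([:- r, 1:] * f) s = hpair zs f (s + 1) - r * hpair zs f s"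
proof -
  let ?d = "degree f"
  have deg: "degree ([:- r, 1:] * f) \<le> Suc ?d"
    using degree_mult_le[of "[:- r, 1:]" f] by simp
  have s1: "(\<Sum>i\<le>Suc ?d. coeff f i * hext zs (int i + s)) = hpair zs f s"
    by (rule hpair_bound[symmetric]) simp
  have s2: "(\<Sum>i\<le>Suc ?d. (if i = 0 then 0 else coeff f (i - 1)) * hext zs (int i + s)) = hpair zs f (s + 1)"
    unfolding hpair_def sum.atMost_Suc_shift by (simp add: add_ac)
  have "hpair zs ([:- r, 1:] * f) s = (\<Sum>i\<le>Suc ?d. (if i = 0 then 0 else coeff f (i - 1)) * hext zs (int i + s)
     - r * (coeff f i * hext zs (int i + s)))"
    unfolding hpair_bound[OF deg] coeff_linear_mult by (intro sum.cong refl) (simp add: algebra_simps)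
  also have "\<dots> = hpair zs f (s + 1) - r * hpair zs f s"
    unfolding sum_subtractf sum_distrib_left[symmetric] s1 s2 ..
  finally show ?thesis .
qed

lemma hpair_recurrence:
  assumes "s > 0"
  shows "(\<Sum>r\<le>length zs. coeff (revpoly zs) r * hpair zs f (s - int r)) = 0"
proof -
  have "(\<Sum>r\<le>length zs. coeff (revpoly zs) r * hpair zs f (s - int r)) =
    (\<Sum>r\<le>length zs. \<Sum>i\<le>degree f. coeff f i * (coeff (revpoly zs) r * hext zs (int i + s - int r)))"
    unfolding hpair_def sum_distrib_left by (intro sum.cong refl) (simp add: algebra_simps)
  also have "\<dots> = (\<Sum>i\<le>degree f. coeff f i * (\<Sum>r\<le>length zs. coeff (revpoly zs) r * hext zs (int i + s - int r)))"
    unfolding sum_distrib_left by (rule sum.swap)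
  also have "\<dots> = 0" using assms by (intro sum.neutral) (simp add: hext_recurrence)
  finally show ?thesis .
qed

lemma det_unit_lower_triangular:
  fixes A :: "'a :: comm_ring_1 mat"
  assumes A: "A \<in> carrier_mat n n" and z: "\<And>i j. i < j \<Longrightarrow> j < n \<Longrightarrow> A $$ (i, j) = 0"
    and d: "\<And>i. i < n \<Longrightarrow> A $$ (i, i) = 1"
  shows "Determinant.det A = 1"
proof -
  have "Determinant.det A = prod_list (diag_mat A)"
    by (rule det_lower_triangular[OF z A])
  also have "diag_mat A = map (\<lambda>_. 1) [0..<n]"
    unfolding diag_mat_def using A d by (intro map_cong) auto
  also have "prod_list (map (\<lambda>_. 1) [0..<n]) = (1::'a)"
    by (rule prod_list_neutral) auto
  finally show ?thesis .
qed

text \<open>The companion matrix of the monic polynomial with roots \<open>zs\<close>, minus r times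
  the identity. Its last row is \<open>hpair_recurrence\<close> solved for the term of highest
  index.\<close>

definition companion :: "complex list \<Rightarrow> complex \<Rightarrow> complex mat" where
  "companion zs r = mat (length zs) (length zs) (\<lambda>(j, k).
     (if Suc j < length zs then (if k = Suc j then 1 else 0) else - coeff (revpoly zs) (length zs - k))
     - (if j = k then r else 0))"

lemma prod_list_minus: "(\<Prod>z\<leftarrow>zs. z - r) = (-1) ^ length zs * (\<Prod>z\<leftarrow>zs. r - z :: complex)"
proof (induction zs)
  case (Cons a zs)
  have "(\<Prod>z\<leftarrow>a # zs. z - r) = - (r - a) * (\<Prod>z\<leftarrow>zs. z - r)" by simp
  also have "\<dots> = (-1) ^ length (a # zs) * ((r - a) * (\<Prod>z\<leftarrow>zs. r - z))"
    unfolding Cons.IH list.size by (simp del: minus_diff_eq)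
  finally show ?case by simp
qed simp

lemma coeff_0_revpoly: "coeff (revpoly zs) 0 = 1"
  by (induction zs) (simp_all add: revpoly_def coeff_mult)

text \<open>Adding \<open>r\<^sup>k\<close> times the \<open>k\<close>-th column to the first one clears that column up to its last entry.\<close>

lemma det_companion:
  "Determinant.det (companion zs r) = (\<Prod>z\<leftarrow>zs. z - r)"
proof (cases "length zs")
  case 0
  hence "companion zs r \<in> carrier_mat 0 0" by (simp add: companion_def)
  thus ?thesis using 0 by (simp add: det_dim_zero)
next
  case (Suc m)
  define n where "n = length zs"
  have n: "n = Suc m" by (simp add: n_def Suc)
  define C where "C = companion zs r"
  define W where "W = mat n n (\<lambda>(l, k). if k = 0 then r ^ l else if l = k then 1 else (0::complex))"
  have C: "C \<in> carrier_mat n n" by (simp add: C_def companion_def n_def)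
  have W: "W \<in> carrier_mat n n" by (simp add: W_def)
  have Ci: "C $$ (j, k) = (if Suc j < n then (if k = Suc j then 1 else 0) else - coeff (revpoly zs) (n - k)) - (if j = k then r else 0)"
    if "j < n" "k < n" for j k using that by (simp add: C_def companion_def n_def)
  have detW: "Determinant.det W = 1"
    by (rule det_unit_lower_triangular[OF W]) (auto simp: W_def)
  define B where "B = C * W"
  have B: "B \<in> carrier_mat n n" unfolding B_def by (rule mult_carrier_mat[OF C W])
  have Bi: "B $$ (j, k) = (\<Sum>l<n. C $$ (j, l) * W $$ (l, k))" if "j < n" "k < n" for j k
  proof -
    have "(C * W) $$ (j, k) = (\<Sum>l=0..<n. C $$ (j, l) * W $$ (l, k))"
      using that C W by (simp add: scalar_prod_def)
    thus ?thesis by (simp add: B_def lessThan_atLeast0)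
  qed
  have Bk: "B $$ (j, k) = C $$ (j, k)" if "j < n" "k < n" "k \<noteq> 0" for j k
  proof -
    have "B $$ (j, k) = (\<Sum>l<n. if l = k then C $$ (j, k) else 0)"
      unfolding Bi[OF that(1,2)] by (intro sum.cong refl) (use that in \<open>auto simp: W_def\<close>)
    thus ?thesis using that by simp
  qed
  have B0: "B $$ (j, 0) = (\<Sum>l<n. C $$ (j, l) * r ^ l)" if "j < n" for j
  proof -
    have "0 < n" by (simp add: n)
    show ?thesis unfolding Bi[OF that \<open>0 < n\<close>] by (intro sum.cong refl) (use n in \<open>simp add: W_def\<close>)
  qed
  have B0z: "B $$ (j, 0) = 0" if "Suc j < n" for j
  proof -
    have "(\<Sum>l<n. C $$ (j, l) * r ^ l) = (\<Sum>l<n. (if l = Suc j then r ^ Suc j else 0) - (if l = j then r * r ^ j else 0))"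
      by (intro sum.cong refl) (use that in \<open>auto simp: Ci\<close>)
    also have "\<dots> = 0" using that by (simp add: sum_subtractf)
    finally show ?thesis using B0[of j] that by simp
  qed
  have B0m: "B $$ (m, 0) = - (\<Prod>z\<leftarrow>zs. r - z)"
  proof -
    have "(\<Sum>l<n. C $$ (m, l) * r ^ l) = (\<Sum>l<n. - (coeff (revpoly zs) (n - l) * r ^ l) - (if l = m then r * r ^ m else 0))"
      by (intro sum.cong refl) (use n in \<open>auto simp: Ci left_diff_distrib\<close>)
    also have "\<dots> = - ((\<Sum>l<n. coeff (revpoly zs) (n - l) * r ^ l) + r ^ n)"
      using n by (simp add: sum_subtractf sum_negf)
    also have "(\<Sum>l<n. coeff (revpoly zs) (n - l) * r ^ l) + r ^ n = (\<Sum>l\<le>n. coeff (revpoly zs) (n - l) * r ^ l)"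
      by (simp add: lessThan_Suc_atMost[symmetric] coeff_0_revpoly)
    also have "\<dots> = (\<Prod>z\<leftarrow>zs. r - z)" unfolding n_def by (rule revpoly_reflect)
    finally show ?thesis using B0[of m] n by simp
  qed
  have "Determinant.det B = (\<Sum>i<n. B $$ (i, 0) * cofactor B i 0)"
    by (rule laplace_expansion_column[OF B]) (simp add: n)
  also have "\<dots> = (\<Sum>i\<in>{m}. B $$ (i, 0) * cofactor B i 0)"
    by (rule sum.mono_neutral_right) (use n B0z in auto)
  also have "\<dots> = - (\<Prod>z\<leftarrow>zs. r - z) * cofactor B m 0" by (simp add: B0m)
  also have "cofactor B m 0 = (-1) ^ m"
  proof -
    have dc: "mat_delete B m 0 \<in> carrier_mat m m" using mat_delete_carrier[OF B, of m 0] n by simp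
    have di: "mat_delete B m 0 $$ (i, j) = C $$ (i, Suc j)" if "i < m" "j < m" for i j
      using that n B Bk[of i "Suc j"] by (simp add: mat_delete_def)
    have "Determinant.det (mat_delete B m 0) = 1"
      by (rule det_unit_lower_triangular[OF dc]) (use n in \<open>auto simp: di Ci\<close>)
    thus ?thesis by (simp add: cofactor_def)
  qed
  finally have "Determinant.det B = (-1) ^ n * (\<Prod>z\<leftarrow>zs. r - z)" by (simp add: n)
  moreover have "Determinant.det B = Determinant.det C"
    unfolding B_def Determinant.det_mult[OF C W] detW by simp
  ultimately show ?thesis unfolding prod_list_minus n_def[symmetric] C_def by simp
qed

definition hmat :: "complex list \<Rightarrow> complex poly \<Rightarrow> complex mat" where
  "hmat zs f = mat (length zs) (length zs) (\<lambda>(j, k). hpair zs f (int j - int k))"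

text \<open>Multiplication by X moves every row to the next one. The row that would leave the matrix
  is restored by the recurrence, and this is the action of the companion matrix.\<close>

lemma hmat_linear_factor: "hmat zs ([:- r, 1:] * f) = companion zs r * hmat zs f"
proof (rule eq_matI)
  let ?n = "length zs"
  fix j k assume "j < dim_row (companion zs r * hmat zs f)" "k < dim_col (companion zs r * hmat zs f)"
  hence jk: "j < ?n" "k < ?n" by (simp_all add: companion_def hmat_def)
  define H where "H l = hpair zs f (int l - int k)" for l
  have "(companion zs r * hmat zs f) $$ (j, k) = (\<Sum>l=0..<?n. companion zs r $$ (j, l) * H l)"
    using jk by (simp add: scalar_prod_def companion_def hmat_def H_def)
  also have "\<dots> = (\<Sum>l<?n. companion zs r $$ (j, l) * H l)" by (simp add: lessThan_atLeast0)
  also have "\<dots> = (\<Sum>l<?n. (if Suc j < ?n then (if l = Suc j then H l else 0) else - coeff (revpoly zs) (?n - l) * H l) - (if l = j then r * H l else 0))"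
    by (intro sum.cong refl) (use jk in \<open>simp add: companion_def left_diff_distrib\<close>)
  also have "\<dots> = hpair zs f (int j - int k + 1) - r * H j"
  proof (cases "Suc j < ?n")
    case True
    thus ?thesis using jk by (simp add: sum_subtractf H_def algebra_simps)
  next
    case False
    hence j: "Suc j = ?n" using jk by simp
    have "0 = (\<Sum>i\<le>?n. coeff (revpoly zs) i * hpair zs f (int ?n - int k - int i))"
      using hpair_recurrence[of "int ?n - int k" zs f] jk by simp
    also have "\<dots> = (\<Sum>l\<le>?n. coeff (revpoly zs) (?n - l) * hpair zs f (int l - int k))"
      by (rule sum.reindex_bij_witness[of _ "\<lambda>l. ?n - l" "\<lambda>l. ?n - l"]) (auto simp: of_nat_diff algebra_simps)
    also have "\<dots> = (\<Sum>l<?n. coeff (revpoly zs) (?n - l) * H l) + hpair zs f (int ?n - int k)"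
      by (simp add: lessThan_Suc_atMost[symmetric] coeff_0_revpoly H_def)
    finally have e: "(\<Sum>l<?n. coeff (revpoly zs) (?n - l) * H l) = - hpair zs f (int ?n - int k)"
      by (simp add: eq_neg_iff_add_eq_0)
    have "int ?n - int k = int j - int k + 1" using j by linarith
    with e have "(\<Sum>l<?n. coeff (revpoly zs) (?n - l) * H l) = - hpair zs f (int j - int k + 1)" by metis
    thus ?thesis using False jk by (simp add: sum_subtractf sum_negf)
  qed
  also have "\<dots> = hmat zs ([:- r, 1:] * f) $$ (j, k)"
    using jk unfolding hmat_def hpair_linear_factor H_def by simp
  finally show "hmat zs ([:- r, 1:] * f) $$ (j, k) = (companion zs r * hmat zs f) $$ (j, k)" by simp
qed (simp_all add: companion_def hmat_def)

text \<open>Each linear factor of f contributes one companion determinant, and f = 1 gives a unit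
  triangular matrix. No Vandermonde determinant is divided out, so eigenvalues may coincide.\<close>

lemma det_hmat: "Determinant.det (hmat zs f) = (\<Prod>z\<leftarrow>zs. poly f z)"
proof -
  let ?n = "length zs"
  obtain as where as: "Polynomial.smult (coeff f (degree f)) (\<Prod>a\<leftarrow>as. [:- a, 1:]) = f"
    using fundamental_theorem_algebra_factorized[of f] by blast
  define g where "g = (\<Prod>a\<leftarrow>as. [:- a, 1:])"
  define c where "c = coeff f (degree f)"
  have f: "f = Polynomial.smult c g" using as by (simp add: g_def c_def)
  have carr: "hmat zs g \<in> carrier_mat ?n ?n" for g by (simp add: hmat_def)
  have 1: "Determinant.det (hmat zs (\<Prod>a\<leftarrow>as. [:- a, 1:])) = (\<Prod>z\<leftarrow>zs. poly (\<Prod>a\<leftarrow>as. [:- a, 1:]) z)"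
  proof (induction as)
    case Nil
    have "Determinant.det (hmat zs 1) = 1"
      by (rule det_unit_lower_triangular[OF carr]) (auto simp: hmat_def hpair_def hext_def)
    moreover have "(\<Prod>z\<leftarrow>zs. 1) = (1 :: complex)" by (induction zs) simp_all
    ultimately show ?case by simp
  next
    case (Cons a as)
    let ?g = "\<Prod>a\<leftarrow>as. [:- a, 1:]"
    have "Determinant.det (hmat zs ([:- a, 1:] * ?g)) = (\<Prod>z\<leftarrow>zs. z - a) * (\<Prod>z\<leftarrow>zs. poly ?g z)"
      unfolding hmat_linear_factor
      by (subst Determinant.det_mult[of _ ?n]) (simp_all add: companion_def[of zs a] carr det_companion[unfolded companion_def] Cons.IH)
    also have "\<dots> = (\<Prod>z\<leftarrow>zs. poly ([:- a, 1:] * ?g) z)"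
      by (induction zs) (simp_all add: algebra_simps)
    finally show ?case by simp
  qed
  have "hpair zs (Polynomial.smult c g) s = c * hpair zs g s" for s
    unfolding hpair_bound[OF degree_smult_le] hpair_def by (simp add: sum_distrib_left mult.assoc)
  hence "hmat zs f = c \<cdot>\<^sub>m hmat zs g"
    unfolding f by (intro eq_matI) (simp_all add: hmat_def)
  hence "Determinant.det (hmat zs f) = c ^ ?n * (\<Prod>z\<leftarrow>zs. poly g z)"
    using 1 unfolding g_def[symmetric] by (simp add: hmat_def)
  also have "\<dots> = (\<Prod>z\<leftarrow>zs. poly f z)"
    unfolding f by (induction zs) simp_all
  finally show ?thesis .
qed

section \<open>Eigenvalue lists of special unitary matrices\<close>

lemma upper_triangular_pow:
  fixes B :: "complex mat"
  assumes B: "B \<in> carrier_mat n n" and u: "upper_triangular B"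
  shows "(\<forall>i<n. \<forall>j<i. (B ^\<^sub>m k) $$ (i, j) = 0) \<and> (\<forall>i<n. (B ^\<^sub>m k) $$ (i, i) = (B $$ (i, i)) ^ k)"
proof (induction k)
  case 0
  show ?case using B by simp
next
  case (Suc k)
  have ut: "B $$ (i, j) = 0" if "j < i" "i < n" for i j
    using upper_triangularD[OF u that(1)] that B by simp
  have e: "(B ^\<^sub>m Suc k) $$ (i, j) = (\<Sum>l<n. (B ^\<^sub>m k) $$ (i, l) * B $$ (l, j))" if "i < n" "j < n" for i j
    using mat_mult_index[OF pow_carrier_mat[OF B, of k] B that] by simp
  have "(B ^\<^sub>m Suc k) $$ (i, j) = 0" if ij: "i < n" "j < i" for i j
  proof -
    have "(B ^\<^sub>m k) $$ (i, l) * B $$ (l, j) = 0" if "l < n" for l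
      using Suc ut[of j l] ij that by (cases "l < i") simp_all
    hence "(\<Sum>l<n. (B ^\<^sub>m k) $$ (i, l) * B $$ (l, j)) = 0" by (intro sum.neutral) simp
    thus ?thesis using e[of i j] ij by simp
  qed
  moreover have "(B ^\<^sub>m Suc k) $$ (i, i) = (B $$ (i, i)) ^ Suc k" if i: "i < n" for i
  proof -
    have "(B ^\<^sub>m k) $$ (i, l) * B $$ (l, i) = (if l = i then (B $$ (i, i)) ^ k * B $$ (i, i) else 0)" if "l < n" for l
      using Suc ut[of i l] i that by (cases l i rule: linorder_cases) simp_all
    thus ?thesis using e[of i i] i by simp
  qed
  ultimately show ?case by blast
qed

text \<open>Triangularisation suffices in place of diagonalisation: only traces of powers are
  needed, and the diagonal lists the roots with algebraic multiplicity.\<close>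

lemma SU_eigenvalues:
  assumes A: "A \<in> SU n"
  obtains zs where "length zs = n" "eigenvalue_mset A = mset zs" "\<And>k. ptr A k = psum zs k"
    "prod_list zs = 1" "\<And>z. z \<in> set zs \<Longrightarrow> norm z = 1"
proof -
  note Ac = SU_carrier[OF A]
  obtain zs where zs: "char_poly A = (\<Prod>z\<leftarrow>zs. [:- z, 1:])" "length zs = n"
    using char_poly_factorized[OF Ac] by blast
  obtain B P Q where BPQ: "schur_decomposition A zs = (B, P, Q)" by (cases "schur_decomposition A zs") auto
  from schur_decomposition[OF Ac zs(1) BPQ]
  have sim: "similar_mat_wit A B P Q" and ut: "upper_triangular B" and dg: "diag_mat B = zs" by auto
  note sw = similar_mat_witD2[OF Ac sim]
  have B: "B \<in> carrier_mat n n" and P: "P \<in> carrier_mat n n" and Q: "Q \<in> carrier_mat n n"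
    and QP: "Q * P = 1\<^sub>m n" using sw by auto
  have Bz: "B $$ (i, i) = zs ! i" if "i < n" for i
    using that dg B by (auto simp: diag_mat_def)
  have ptr: "ptr A k = psum zs k" for k
  proof -
    have Bk: "B ^\<^sub>m k \<in> carrier_mat n n" by (rule pow_carrier_mat[OF B])
    have "A ^\<^sub>m k = P * B ^\<^sub>m k * Q"
      using similar_mat_wit_pow[OF sim, of k] similar_mat_witD2(3)[OF mat_pow_carrier[OF A]] by blast
    hence "ptr A k = (\<Sum>i<n. (P * B ^\<^sub>m k * Q) $$ (i, i))" using ptr_SU[OF A] by simp
    also have "\<dots> = (\<Sum>i<n. \<Sum>j<n. (P * B ^\<^sub>m k) $$ (i, j) * Q $$ (j, i))"
      by (intro sum.cong refl mat_mult_index[OF mult_carrier_mat[OF P Bk] Q]) simp_all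
    also have "\<dots> = (\<Sum>i<n. \<Sum>j<n. \<Sum>l<n. P $$ (i, l) * (B ^\<^sub>m k) $$ (l, j) * Q $$ (j, i))"
      unfolding sum_distrib_right[symmetric]
      by (intro sum.cong refl arg_cong2[of _ _ _ _ times] mat_mult_index[OF P Bk]) simp_all
    also have "\<dots> = (\<Sum>j<n. \<Sum>i<n. \<Sum>l<n. P $$ (i, l) * (B ^\<^sub>m k) $$ (l, j) * Q $$ (j, i))" by (rule sum.swap)
    also have "\<dots> = (\<Sum>j<n. \<Sum>l<n. \<Sum>i<n. P $$ (i, l) * (B ^\<^sub>m k) $$ (l, j) * Q $$ (j, i))"
      by (rule sum.cong[OF refl], rule sum.swap)
    also have "\<dots> = (\<Sum>j<n. \<Sum>l<n. (B ^\<^sub>m k) $$ (l, j) * (\<Sum>i<n. Q $$ (j, i) * P $$ (i, l)))"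
      unfolding sum_distrib_left by (intro sum.cong refl) (simp only: mult_ac)
    also have "\<dots> = (\<Sum>j<n. \<Sum>l<n. if l = j then (B ^\<^sub>m k) $$ (j, j) else 0)"
    proof (intro sum.cong refl)
      fix j l assume "j \<in> {..<n}" "l \<in> {..<n}"
      hence "(\<Sum>i<n. Q $$ (j, i) * P $$ (i, l)) = (if j = l then 1 else 0)"
        using mat_mult_index[OF Q P, of j l] QP by simp
      thus "(B ^\<^sub>m k) $$ (l, j) * (\<Sum>i<n. Q $$ (j, i) * P $$ (i, l)) = (if l = j then (B ^\<^sub>m k) $$ (j, j) else 0)"
        by simp
    qed
    also have "\<dots> = (\<Sum>j<n. (zs ! j) ^ k)"
      using upper_triangular_pow[OF B ut, of k] Bz by simp
    also have "\<dots> = psum zs k"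
      unfolding psum_def using zs(2) by (simp add: sum_list_sum_nth lessThan_atLeast0)
    finally show ?thesis .
  qed
  have "proots (\<Prod>z\<leftarrow>zs. [:- z, 1:]) = mset zs" for zs :: "complex list"
  proof (induction zs)
    case (Cons a zs)
    have "(\<Prod>z\<leftarrow>zs. [:- z, 1:]) \<noteq> (0 :: complex poly)" by (auto simp: prod_list_zero_iff)
    thus ?case using Cons by (simp add: proots_mult del: mult_pCons_left)
  qed simp
  hence em: "eigenvalue_mset A = mset zs" by (simp add: eigenvalue_mset_def zs(1))
  have "1 = Determinant.det A" using A by (simp add: SU_def)
  also have "\<dots> = Determinant.det B"
    using det_similar[of A B] sim unfolding similar_mat_def by blast
  also have "\<dots> = prod_list zs" using det_upper_triangular[OF ut B] dg by simp
  finally have pl: "prod_list zs = 1" by simp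
  have nrm: "norm z = 1" if z: "z \<in> set zs" for z
  proof -
    have "poly (\<Prod>z\<leftarrow>zs. [:- z, 1:]) z = 0"
      using z by (induction zs) auto
    hence "eigenvalue A z" using eigenvalue_root_char_poly[OF Ac] zs(1) by simp
    then obtain v where v: "v \<in> carrier_vec n" "v \<noteq> 0\<^sub>v n" "A *\<^sub>v v = z \<cdot>\<^sub>v v"
      using Ac unfolding eigenvalue_def eigenvector_def by auto
    have Av: "(\<Sum>j<n. A $$ (i, j) * v $ j) = z * v $ i" if "i < n" for i
    proof -
      have "(A *\<^sub>v v) $ i = (\<Sum>j<n. A $$ (i, j) * v $ j)"
        using that Ac v(1) by (simp add: scalar_prod_def lessThan_atLeast0)
      thus ?thesis using v that by simp
    qed
    \<comment> \<open>The squared length of the eigenvector v: A preserves it, while passing to z v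
      multiplies it by \<open>cnj z * z\<close>.\<close>
    define s where "s = (\<Sum>i<n. cnj (v $ i) * v $ i)"
    have "(\<Sum>i<n. cnj (\<Sum>j<n. A $$ (i, j) * v $ j) * (\<Sum>l<n. A $$ (i, l) * v $ l)) =
       (\<Sum>i<n. \<Sum>j<n. \<Sum>l<n. cnj (v $ j) * v $ l * (cnj (A $$ (i, j)) * A $$ (i, l)))"
      unfolding cnj_sum sum_product by (intro sum.cong refl) (simp only: complex_cnj_mult mult_ac)
    also have "\<dots> = (\<Sum>j<n. \<Sum>i<n. \<Sum>l<n. cnj (v $ j) * v $ l * (cnj (A $$ (i, j)) * A $$ (i, l)))"
      by (rule sum.swap)
    also have "\<dots> = (\<Sum>j<n. \<Sum>l<n. \<Sum>i<n. cnj (v $ j) * v $ l * (cnj (A $$ (i, j)) * A $$ (i, l)))"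
      by (rule sum.cong[OF refl], rule sum.swap)
    also have "\<dots> = (\<Sum>j<n. \<Sum>l<n. if l = j then cnj (v $ j) * v $ j else 0)"
    proof (intro sum.cong refl)
      fix j l assume "j \<in> {..<n}" "l \<in> {..<n}"
      thus "(\<Sum>i<n. cnj (v $ j) * v $ l * (cnj (A $$ (i, j)) * A $$ (i, l))) = (if l = j then cnj (v $ j) * v $ j else 0)"
        unfolding sum_distrib_left[symmetric] using SU_row_sum[OF A, of j l] by simp
    qed
    also have "\<dots> = s" by (simp add: s_def)
    finally have 1: "(\<Sum>i<n. cnj (\<Sum>j<n. A $$ (i, j) * v $ j) * (\<Sum>l<n. A $$ (i, l) * v $ l)) = s" .
    have "(\<Sum>i<n. cnj (\<Sum>j<n. A $$ (i, j) * v $ j) * (\<Sum>l<n. A $$ (i, l) * v $ l)) = (\<Sum>i<n. (cnj z * z) * (cnj (v $ i) * v $ i))"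
    proof (intro sum.cong refl)
      fix i assume "i \<in> {..<n}"
      hence "(\<Sum>j<n. A $$ (i, j) * v $ j) = z * v $ i" using Av by simp
      thus "cnj (\<Sum>j<n. A $$ (i, j) * v $ j) * (\<Sum>l<n. A $$ (i, l) * v $ l) = (cnj z * z) * (cnj (v $ i) * v $ i)"
        by (simp only: complex_cnj_mult mult_ac)
    qed
    hence 2: "s = (cnj z * z) * s" unfolding 1 s_def sum_distrib_left[symmetric] .
    have "s = of_real (\<Sum>i<n. (norm (v $ i))\<^sup>2)"
      unfolding s_def of_real_sum by (intro sum.cong refl) (metis complex_norm_square mult.commute)
    moreover have "(\<Sum>i<n. (norm (v $ i))\<^sup>2) \<noteq> 0"
    proof -
      obtain i where "i < n" "v $ i \<noteq> 0" using v(1,2) by (metis carrier_vecD eq_vecI index_zero_vec)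
      hence "0 < (\<Sum>i<n. (norm (v $ i))\<^sup>2)" by (intro sum_pos2[of _ i]) auto
      thus ?thesis by simp
    qed
    ultimately have "s \<noteq> 0" by (metis of_real_eq_0_iff)
    with 2 have "cnj z * z = 1" by simp
    hence "of_real ((norm z)\<^sup>2) = (1 :: complex)" by (metis complex_norm_square mult.commute)
    hence "(norm z)\<^sup>2 = 1" using of_real_eq_1_iff by blast
    thus ?thesis by (simp add: power2_eq_1_iff) (metis norm_ge_zero neg_0_le_iff_le not_one_le_zero)
  qed
  show ?thesis using that[OF zs(2) em ptr pl nrm] .
qed

definition zcoeff :: "complex poly \<Rightarrow> int \<Rightarrow> complex" where
  "zcoeff f i = (if i < 0 then 0 else coeff f (nat i))"

text \<open>This is \<open>det_hmat\<close> summed over the index of h instead of the index of the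
  coefficient. Expanding it yields products with one h per row, the shape treated by
  \<open>integral_prod_hsym_eq_0\<close>.\<close>

lemma prod_eigenvalues_poly:
  assumes A: "A \<in> SU n"
  shows "(\<Prod>z\<in>#eigenvalue_mset A. poly f z) =
    Determinant.det (mat n n (\<lambda>(j, l). \<Sum>m\<le>degree f + n. zcoeff f (int m - int j + int l) * hsym (ptr A) m))"
proof -
  obtain zs where zs: "length zs = n" "eigenvalue_mset A = mset zs" "\<And>k. ptr A k = psum zs k"
    using SU_eigenvalues[OF A] by metis
  have p: "ptr A = psum zs" using zs(3) by blast
  have "(\<Prod>z\<in>#eigenvalue_mset A. poly f z) = Determinant.det (hmat zs f)"
    unfolding det_hmat zs(2) by (simp add: prod_mset_prod_list flip: mset_map)
  also have "hmat zs f = mat n n (\<lambda>(j, l). \<Sum>m\<le>degree f + n. zcoeff f (int m - int j + int l) * hsym (ptr A) m)"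
  proof (rule eq_matI)
    fix j l
    assume "j < dim_row (mat n n (\<lambda>(j, l). \<Sum>m\<le>degree f + n. zcoeff f (int m - int j + int l) * hsym (ptr A) m))"
       "l < dim_col (mat n n (\<lambda>(j, l). \<Sum>m\<le>degree f + n. zcoeff f (int m - int j + int l) * hsym (ptr A) m))"
    hence jl: "j < n" "l < n" by simp_all
    have "(\<Sum>i\<le>degree f. coeff f i * hext zs (int i + (int j - int l))) =
      (\<Sum>m\<le>degree f + n. zcoeff f (int m - int j + int l) * hsym (ptr A) m)"
    proof -
      let ?R = "{i \<in> {..degree f}. 0 \<le> int i + (int j - int l)}"
      let ?T = "{m \<in> {..degree f + n}. 0 \<le> int m - int j + int l \<and> int m - int j + int l \<le> int (degree f)}"
      have "(\<Sum>i\<le>degree f. coeff f i * hext zs (int i + (int j - int l))) = (\<Sum>i\<in>?R. coeff f i * hext zs (int i + (int j - int l)))"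
        by (rule sum.mono_neutral_right) (auto simp: hext_def)
      also have "\<dots> = (\<Sum>m\<in>?T. zcoeff f (int m - int j + int l) * hsym (ptr A) m)"
      proof (rule sum.reindex_bij_witness[where i = "\<lambda>m. nat (int m - int j + int l)" and j = "\<lambda>i. nat (int i + int j - int l)"])
        fix i assume "i \<in> ?R"
        hence i: "i \<le> degree f" "0 \<le> int i + int j - int l" by auto
        have e: "int (nat (int i + int j - int l)) = int i + int j - int l" using i by simp
        show "nat (int (nat (int i + int j - int l)) - int j + int l) = i" unfolding e by simp
        show "nat (int i + int j - int l) \<in> ?T" using i jl by auto
        show "zcoeff f (int (nat (int i + int j - int l)) - int j + int l) * hsym (ptr A) (nat (int i + int j - int l)) =
           coeff f i * hext zs (int i + (int j - int l))"
          unfolding e using i by (simp add: zcoeff_def hext_def p add_diff_eq)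
      next
        fix m assume m: "m \<in> ?T"
        show "nat (int (nat (int m - int j + int l)) + int j - int l) = m" using m by simp
        show "nat (int m - int j + int l) \<in> ?R" using m by auto
      qed
      also have "\<dots> = (\<Sum>m\<le>degree f + n. zcoeff f (int m - int j + int l) * hsym (ptr A) m)"
        by (rule sum.mono_neutral_left) (auto simp: zcoeff_def dest!: le_degree)
      finally show ?thesis .
    qed
    thus "hmat zs f $$ (j, l) = mat n n (\<lambda>(j, l). \<Sum>m\<le>degree f + n. zcoeff f (int m - int j + int l) * hsym (ptr A) m) $$ (j, l)"
      using jl by (simp add: hmat_def zs(1) hpair_def)
  qed (simp_all add: hmat_def zs(1))
  finally show ?thesis .
qed

section \<open>Integrals of eigenvalue products of polynomials\<close>

lemma det_mat_expand:
  fixes f :: "nat \<Rightarrow> nat \<Rightarrow> 'a :: comm_ring_1"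
  shows "Determinant.det (mat n n (\<lambda>(j, l). f j l)) = (\<Sum>\<sigma> | \<sigma> permutes {..<n}. of_int (sign \<sigma>) * (\<Prod>j<n. f j (\<sigma> j)))"
proof -
  have "Determinant.det (mat n n (\<lambda>(j, l). f j l)) =
    (\<Sum>\<sigma> | \<sigma> permutes {0..<n}. of_int (sign \<sigma>) * (\<Prod>j = 0..<n. mat n n (\<lambda>(j, l). f j l) $$ (j, \<sigma> j)))"
    by (rule det_def') simp
  also have "\<dots> = (\<Sum>\<sigma> | \<sigma> permutes {0..<n}. of_int (sign \<sigma>) * (\<Prod>j = 0..<n. f j (\<sigma> j)))"
  proof (rule sum.cong[OF refl])
    fix \<sigma> assume "\<sigma> \<in> {\<sigma>. \<sigma> permutes {0..<n}}"
    hence "\<sigma> j < n" if "j < n" for j using permutes_in_image[of \<sigma> "{0..<n}" j] that by auto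
    hence "(\<Prod>j = 0..<n. mat n n (\<lambda>(j, l). f j l) $$ (j, \<sigma> j)) = (\<Prod>j = 0..<n. f j (\<sigma> j))"
      by (intro prod.cong refl) simp
    thus "of_int (sign \<sigma>) * (\<Prod>j = 0..<n. mat n n (\<lambda>(j, l). f j l) $$ (j, \<sigma> j)) = of_int (sign \<sigma>) * (\<Prod>j = 0..<n. f j (\<sigma> j))"
      by simp
  qed
  finally show ?thesis by (simp add: lessThan_atLeast0)
qed

lemma sum_PiE_const:
  fixes X :: "(nat \<Rightarrow> nat) \<Rightarrow> 'a :: comm_monoid_add"
  assumes n: "n > 0" and z: "\<And>g p q. p < n \<Longrightarrow> q < n \<Longrightarrow> g p \<noteq> g q \<Longrightarrow> X g = 0"
  shows "(\<Sum>g\<in>{..<n} \<rightarrow>\<^sub>E {..B}. X g) = (\<Sum>k\<le>B. X (\<lambda>j\<in>{..<n}. k))"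
proof -
  have inj: "inj_on (\<lambda>k. \<lambda>j\<in>{..<n}. k) {..B}"
  proof (rule inj_onI)
    fix k l assume "(\<lambda>j\<in>{..<n}. k) = (\<lambda>j\<in>{..<n}. l)"
    from fun_cong[OF this, of 0] show "k = l" using n by simp
  qed
  have "(\<Sum>g\<in>{..<n} \<rightarrow>\<^sub>E {..B}. X g) = (\<Sum>g\<in>(\<lambda>k. \<lambda>j\<in>{..<n}. k) ` {..B}. X g)"
  proof (rule sum.mono_neutral_right)
    show "finite ({..<n} \<rightarrow>\<^sub>E {..B})" by (intro finite_PiE) auto
    show "(\<lambda>k. \<lambda>j\<in>{..<n}. k) ` {..B} \<subseteq> {..<n} \<rightarrow>\<^sub>E {..B}"
      by (intro image_subsetI) (simp add: restrict_PiE_iff)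
    show "\<forall>g\<in>({..<n} \<rightarrow>\<^sub>E {..B}) - (\<lambda>k. \<lambda>j\<in>{..<n}. k) ` {..B}. X g = 0"
    proof
      fix g assume g: "g \<in> ({..<n} \<rightarrow>\<^sub>E {..B}) - (\<lambda>k. \<lambda>j\<in>{..<n}. k) ` {..B}"
      have "\<exists>q<n. g q \<noteq> g 0"
      proof (rule ccontr)
        assume "\<not> (\<exists>q<n. g q \<noteq> g 0)"
        hence eq: "g q = g 0" if "q < n" for q using that by blast
        have gP: "g \<in> {..<n} \<rightarrow>\<^sub>E {..B}" using g by (rule DiffD1)
        have "g = (\<lambda>j\<in>{..<n}. g 0)"
        proof (rule ext)
          fix x
          show "g x = (\<lambda>j\<in>{..<n}. g 0) x"
            using eq[of x] PiE_arb[OF gP, of x] by (cases "x < n") simp_all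
        qed
        moreover have "g 0 \<in> {..B}" by (rule PiE_mem[OF gP]) (use n in simp)
        ultimately have "\<exists>k\<in>{..B}. g = (\<lambda>j\<in>{..<n}. k)" by (rule bexI)
        then obtain k where "k \<in> {..B}" "g = (\<lambda>j\<in>{..<n}. k)" by (rule bexE)
        thus False using DiffD2[OF g] by blast
      qed
      then obtain q where "q < n" "g q \<noteq> g 0" by blast
      thus "X g = 0" using z[of q 0 g] n by simp
    qed
  qed
  also have "\<dots> = (\<Sum>k\<le>B. X (\<lambda>j\<in>{..<n}. k))" using sum.reindex[OF inj, of X] by (simp add: comp_def)
  finally show ?thesis .
qed

context haar begin

text \<open>The product belongs to the rectangular partition with n rows of length k, whose Schur
  function is the k-th power of the determinant.\<close>

definition rect_moment :: "nat \<Rightarrow> complex" where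
  "rect_moment k = (LINT A|M. (\<Prod>j<n. hsym (ptr A) k))"

text \<open>Expand the determinant over permutations and over one index per row. Only constant index
  choices have a nonzero integral, and for each k the remaining coefficients reassemble into a
  determinant.\<close>

lemma integral_prod_eigenvalues_rect_moment:
  assumes n: "n > 0"
  shows "(LINT A|M. (\<Prod>z\<in>#eigenvalue_mset A. poly f z)) =
    (\<Sum>k\<le>degree f + n. rect_moment k * Determinant.det (mat n n (\<lambda>(j, l). zcoeff f (int k - int j + int l))))"
proof -
  let ?B = "degree f + n"
  let ?S = "{\<sigma>. \<sigma> permutes {..<n}}"
  let ?G = "{..<n} \<rightarrow>\<^sub>E {..?B}"
  define c where "c \<sigma> g = (\<Prod>j<n. zcoeff f (int (g j) - int j + int (\<sigma> j)))" for \<sigma> :: "nat \<Rightarrow> nat" and g :: "nat \<Rightarrow> nat"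
  define h where "h g A = (\<Prod>j<n. hsym (ptr A) (g j))" for g :: "nat \<Rightarrow> nat" and A
  have fin: "finite ?S" "finite ?G" by (simp_all add: finite_permutations finite_PiE)
  have hi: "integrable M (h g)" for g
    unfolding h_def by (intro smooth_integrable smooth_on_SU_prod smooth_on_SU_intros) simp
  have h0: "(LINT A|M. h g A) = 0" if "p < n" "q < n" "g p \<noteq> g q" for g p q
    unfolding h_def using integral_prod_hsym_eq_0[of "{..<n}" p q g] that by simp
  have e: "(\<Prod>z\<in>#eigenvalue_mset A. poly f z) = (\<Sum>\<sigma>\<in>?S. of_int (sign \<sigma>) * (\<Sum>g\<in>?G. c \<sigma> g * h g A))"
    if A: "A \<in> SU n" for A
    unfolding prod_eigenvalues_poly[OF A] det_mat_expand
    by (intro sum.cong refl arg_cong2[of _ _ _ _ times]) (simp add: prod_sum_PiE c_def h_def prod.distrib)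
  have "(LINT A|M. (\<Prod>z\<in>#eigenvalue_mset A. poly f z)) = (LINT A|M. (\<Sum>\<sigma>\<in>?S. of_int (sign \<sigma>) * (\<Sum>g\<in>?G. c \<sigma> g * h g A)))"
    by (rule Bochner_Integration.integral_cong[OF refl]) (simp only: e space_M)
  also have "\<dots> = (\<Sum>\<sigma>\<in>?S. (LINT A|M. of_int (sign \<sigma>) * (\<Sum>g\<in>?G. c \<sigma> g * h g A)))"
    by (intro Bochner_Integration.integral_sum integrable_mult_right Bochner_Integration.integrable_sum hi)
  also have "\<dots> = (\<Sum>\<sigma>\<in>?S. of_int (sign \<sigma>) * (\<Sum>g\<in>?G. c \<sigma> g * (LINT A|M. h g A)))"
  proof (rule sum.cong[OF refl])
    fix \<sigma>
    have "(LINT A|M. (\<Sum>g\<in>?G. c \<sigma> g * h g A)) = (\<Sum>g\<in>?G. (LINT A|M. c \<sigma> g * h g A))"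
      by (intro Bochner_Integration.integral_sum integrable_mult_right hi)
    thus "(LINT A|M. of_int (sign \<sigma>) * (\<Sum>g\<in>?G. c \<sigma> g * h g A)) = of_int (sign \<sigma>) * (\<Sum>g\<in>?G. c \<sigma> g * (LINT A|M. h g A))"
      by simp
  qed
  also have "\<dots> = (\<Sum>\<sigma>\<in>?S. of_int (sign \<sigma>) * (\<Sum>k\<le>?B. (\<Prod>j<n. zcoeff f (int k - int j + int (\<sigma> j))) * rect_moment k))"
  proof (intro sum.cong refl arg_cong2[of _ _ _ _ times])
    fix \<sigma>
    have "(\<Sum>g\<in>?G. c \<sigma> g * (LINT A|M. h g A)) = (\<Sum>k\<le>?B. c \<sigma> (\<lambda>j\<in>{..<n}. k) * (LINT A|M. h (\<lambda>j\<in>{..<n}. k) A))"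
      by (rule sum_PiE_const[OF n]) (use h0 in simp)
    also have "\<dots> = (\<Sum>k\<le>?B. (\<Prod>j<n. zcoeff f (int k - int j + int (\<sigma> j))) * rect_moment k)"
      unfolding c_def h_def rect_moment_def by (intro sum.cong refl arg_cong2[of _ _ _ _ times] Bochner_Integration.integral_cong prod.cong) simp_all
    finally show "(\<Sum>g\<in>?G. c \<sigma> g * (LINT A|M. h g A)) = (\<Sum>k\<le>?B. (\<Prod>j<n. zcoeff f (int k - int j + int (\<sigma> j))) * rect_moment k)" .
  qed
  also have "\<dots> = (\<Sum>k\<le>?B. \<Sum>\<sigma>\<in>?S. rect_moment k * (of_int (sign \<sigma>) * (\<Prod>j<n. zcoeff f (int k - int j + int (\<sigma> j)))))"
    unfolding sum_distrib_left by (subst sum.swap) (simp only: mult_ac)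
  also have "\<dots> = (\<Sum>k\<le>?B. rect_moment k * Determinant.det (mat n n (\<lambda>(j, l). zcoeff f (int k - int j + int l))))"
    unfolding det_mat_expand sum_distrib_left ..
  finally show ?thesis .
qed

text \<open>Applied to \<open>X\<^sup>k\<close>, whose product over the eigenvalues is \<open>1\<close>, the preceding formula
  has a single nonzero determinant.\<close>

lemma rect_moment_eq_1:
  assumes n: "n > 0"
  shows "rect_moment k = 1"
proof -
  define f where "f = monom (1::complex) k"
  have "(\<Prod>z\<in>#eigenvalue_mset A. poly f z) = 1" if A: "A \<in> SU n" for A
  proof -
    obtain zs where zs: "eigenvalue_mset A = mset zs" "prod_list zs = 1"
      using SU_eigenvalues[OF A] by metis
    have "(\<Prod>z\<leftarrow>zs. z ^ k) = prod_list zs ^ k" by (induction zs) (simp_all add: power_mult_distrib)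
    thus ?thesis unfolding zs(1) using zs(2) by (simp add: f_def poly_monom prod_mset_prod_list flip: mset_map)
  qed
  hence "(LINT A|M. (\<Prod>z\<in>#eigenvalue_mset A. poly f z)) = (LINT A|M. 1)"
    by (intro Bochner_Integration.integral_cong refl) (simp add: space_M)
  also have "\<dots> = 1" by (simp add: prob_space)
  finally have 1: "1 = (\<Sum>m\<le>degree f + n. rect_moment m * Determinant.det (mat n n (\<lambda>(j, l). zcoeff f (int m - int j + int l))))"
    unfolding integral_prod_eigenvalues_rect_moment[OF n] by simp
  have zc: "zcoeff f i = (if i = int k then 1 else 0)" for i
    unfolding f_def zcoeff_def by auto
  have det: "Determinant.det (mat n n (\<lambda>(j, l). zcoeff f (int m - int j + int l))) = (if m = k then 1 else 0)" for m
  proof (cases "m = k")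
    case True
    have "mat n n (\<lambda>(j, l). zcoeff f (int m - int j + int l)) = 1\<^sub>m n"
      by (rule eq_matI) (auto simp: zc True)
    thus ?thesis using True by simp
  next
    case False
    \<comment> \<open>A row of zeros: in the last row l - j is at most 0, so the index stays below k
      if m < k; in the first row it is at least 0, so the index stays above k if m > k.\<close>
    define j where "j = (if m < k then n - 1 else 0)"
    have j: "j < n" using n by (simp add: j_def)
    have "(\<Prod>j<n. zcoeff f (int m - int j + int (\<sigma> j))) = 0" if \<sigma>: "\<sigma> permutes {..<n}" for \<sigma>
    proof (rule prod_zero)
      have "\<sigma> j < n" using permutes_in_image[OF \<sigma>, of j] j by simp
      hence "int m - int j + int (\<sigma> j) \<noteq> int k" using False n by (auto simp: j_def split: if_splits)
      thus "\<exists>j\<in>{..<n}. zcoeff f (int m - int j + int (\<sigma> j)) = 0" using j by (auto simp: zc)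
    qed simp
    thus ?thesis unfolding det_mat_expand using False by (simp add: sum.neutral)
  qed
  have "degree f = k" by (simp add: f_def degree_monom_eq)
  thus ?thesis using 1 unfolding det by (simp add: if_distrib cong: if_cong)
qed

lemma integral_prod_eigenvalues:
  assumes n: "n > 0"
  shows "(LINT A|M. (\<Prod>z\<in>#eigenvalue_mset A. poly f z)) =
    (\<Sum>k\<le>degree f + n. Determinant.det (mat n n (\<lambda>(j, l). zcoeff f (int k - int j + int l))))"
  unfolding integral_prod_eigenvalues_rect_moment[OF n] rect_moment_eq_1[OF n] by simp

end

section \<open>Toeplitz determinants of Laurent series\<close>

definition vext :: "(nat \<Rightarrow> real) \<Rightarrow> int \<Rightarrow> real" where
  "vext v i = (if i < 0 then 0 else v (nat i))"

text \<open>The coefficient of z^s in the product of the sum of \<open>u m\<close> z^(-m) and the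
  sum of \<open>v m\<close> z^m.\<close>

definition toep :: "(nat \<Rightarrow> real) \<Rightarrow> (nat \<Rightarrow> real) \<Rightarrow> int \<Rightarrow> real" where
  "toep u v s = (\<Sum>m. u m * vext v (int m + s))"

text \<open>The same coefficient after cutting both series at degree K: the bound on m encodes both
  m <= K and m + s <= K.\<close>

definition toep_trunc :: "(nat \<Rightarrow> real) \<Rightarrow> (nat \<Rightarrow> real) \<Rightarrow> nat \<Rightarrow> int \<Rightarrow> real" where
  "toep_trunc u v K s = (\<Sum>m<Suc K - nat s. u m * vext v (int m + s))"

text \<open>The Toeplitz determinant of z^(-k) times the symbol with Laurent coefficients f.\<close>

definition toep_det :: "nat \<Rightarrow> (int \<Rightarrow> real) \<Rightarrow> int \<Rightarrow> real" where
  "toep_det n f k = Determinant.det (mat n n (\<lambda>(j, l). f (k - int j + int l)))"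

text \<open>The truncated Laurent symbol multiplied by z^K to make it a polynomial. This is harmless
  on the group, where the product of all z^K is 1.\<close>

definition trunc_poly :: "(nat \<Rightarrow> real) \<Rightarrow> (nat \<Rightarrow> real) \<Rightarrow> nat \<Rightarrow> complex poly" where
  "trunc_poly u v K = (\<Sum>m\<le>K. monom (of_real (u m)) (K - m)) * (\<Sum>m\<le>K. monom (of_real (v m)) m)"

lemma coeff_trunc_poly: "zcoeff (trunc_poly u v K) i = of_real (toep_trunc u v K (i - int K))"
proof -
  have cv: "coeff (\<Sum>m\<le>K. monom (complex_of_real (v m)) m) i = (if i \<le> K then of_real (v i) else 0)" for i
    by (simp add: coeff_sum)
  have c: "coeff (trunc_poly u v K) i = (\<Sum>m\<le>K. of_real (u m) * (if K - m \<le> i \<and> i - (K - m) \<le> K then of_real (v (i - (K - m))) else 0))" for i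
  proof -
    have "coeff (trunc_poly u v K) i = (\<Sum>m\<le>K. coeff (monom (complex_of_real (u m)) (K - m) * (\<Sum>m\<le>K. monom (complex_of_real (v m)) m)) i)"
      unfolding trunc_poly_def sum_distrib_right coeff_sum ..
    also have "\<dots> = (\<Sum>m\<le>K. of_real (u m) * (if K - m \<le> i \<and> i - (K - m) \<le> K then of_real (v (i - (K - m))) else 0))"
      by (intro sum.cong refl) (simp add: coeff_monom_mult cv)
    finally show ?thesis .
  qed
  show ?thesis
  proof (cases "i < 0")
    case True
    have "u m * vext v (int m + (i - int K)) = 0" if "m < Suc K" for m
      using that True by (simp add: vext_def)
    moreover have "nat (i - int K) = 0" using True by simp
    ultimately have "toep_trunc u v K (i - int K) = 0"
      unfolding toep_trunc_def by (intro sum.neutral) simp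
    thus ?thesis using True by (simp add: zcoeff_def)
  next
    case False
    define k where "k = nat i"
    have i: "i = int k" using False by (simp add: k_def)
    have "(\<Sum>m\<le>K. u m * (if K - m \<le> k \<and> k - (K - m) \<le> K then v (k - (K - m)) else 0))
      = (\<Sum>m<Suc K - nat (i - int K). u m * vext v (int m + (i - int K)))"
    proof (rule sum.mono_neutral_cong_right)
      show "{..<Suc K - nat (i - int K)} \<subseteq> {..K}" by auto
      show "\<forall>m\<in>{..K} - {..<Suc K - nat (i - int K)}. u m * (if K - m \<le> k \<and> k - (K - m) \<le> K then v (k - (K - m)) else 0) = 0"
        by (auto simp: i)
      fix m assume m: "m \<in> {..<Suc K - nat (i - int K)}"
      show "u m * (if K - m \<le> k \<and> k - (K - m) \<le> K then v (k - (K - m)) else 0) = u m * vext v (int m + (i - int K))"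
      proof (cases "K - m \<le> k")
        case True
        have "nat (int m + (int k - int K)) = k - (K - m)" using m True by auto
        moreover have "k - (K - m) \<le> K" using m True by (auto simp: i)
        ultimately show ?thesis using True m by (auto simp: vext_def i)
      next
        case False
        thus ?thesis using m by (auto simp: vext_def i)
      qed
    qed simp
    hence "complex_of_real (\<Sum>m\<le>K. u m * (if K - m \<le> k \<and> k - (K - m) \<le> K then v (k - (K - m)) else 0)) = of_real (toep_trunc u v K (i - int K))"
      unfolding toep_trunc_def by (rule arg_cong)
    moreover have "zcoeff (trunc_poly u v K) i = complex_of_real (\<Sum>m\<le>K. u m * (if K - m \<le> k \<and> k - (K - m) \<le> K then v (k - (K - m)) else 0))"
      unfolding zcoeff_def i using c[of k] by (simp add: if_distrib cong: if_cong)
    ultimately show ?thesis by simp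
  qed
qed

lemma toep_det_expand:
  "toep_det n f k = (\<Sum>\<sigma> | \<sigma> permutes {..<n}. of_int (sign \<sigma>) * (\<Prod>j<n. f (k - int j + int (\<sigma> j))))"
  unfolding toep_det_def det_mat_expand ..

lemma toep_det_eq_0:
  assumes "n > 0" "\<And>j l. j < n \<Longrightarrow> l < n \<Longrightarrow> j = j0 \<Longrightarrow> f (k - int j + int l) = 0" "j0 < n"
  shows "toep_det n f k = 0"
proof -
  have "(\<Prod>j<n. f (k - int j + int (\<sigma> j))) = 0" if \<sigma>: "\<sigma> permutes {..<n}" for \<sigma>
  proof (rule prod_zero)
    have "\<sigma> j0 < n" using permutes_in_image[OF \<sigma>, of j0] assms(3) by simp
    thus "\<exists>j\<in>{..<n}. f (k - int j + int (\<sigma> j)) = 0" using assms(2)[of j0 "\<sigma> j0"] assms(3) by auto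
  qed simp
  thus ?thesis unfolding toep_det_expand by (simp add: sum.neutral)
qed

lemma toep_trunc_eq_0: "s > int K \<or> s < - int K \<Longrightarrow> toep_trunc u v K s = 0"
  unfolding toep_trunc_def by (intro sum.neutral) (auto simp: vext_def)

text \<open>For each permutation the indices k - j + \<open>\<sigma> j\<close> add up to n k, so
  their absolute values add up to at least |k|.\<close>

lemma toep_det_bound:
  assumes f: "\<And>s. \<bar>f s\<bar> \<le> C * r ^ nat \<bar>s\<bar>" and r: "0 \<le> r" "r \<le> 1" and C: "C \<ge> 0" and n: "n > 0"
  shows "\<bar>toep_det n f k\<bar> \<le> (fact n * C ^ n) * r ^ nat \<bar>k\<bar>"
proof -
  have p: "\<bar>of_int (sign \<sigma>) * (\<Prod>j<n. f (k - int j + int (\<sigma> j)))\<bar> \<le> C ^ n * r ^ nat \<bar>k\<bar>"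
    if \<sigma>: "\<sigma> permutes {..<n}" for \<sigma>
  proof -
    have "\<bar>of_int (sign \<sigma>) * (\<Prod>j<n. f (k - int j + int (\<sigma> j)))\<bar> = (\<Prod>j<n. \<bar>f (k - int j + int (\<sigma> j))\<bar>)"
      by (simp add: abs_mult abs_prod sign_def)
    also have "\<dots> \<le> (\<Prod>j<n. C * r ^ nat \<bar>k - int j + int (\<sigma> j)\<bar>)"
      by (intro prod_mono) (use f in auto)
    also have "\<dots> = C ^ n * r ^ (\<Sum>j<n. nat \<bar>k - int j + int (\<sigma> j)\<bar>)"
      by (simp add: prod.distrib power_sum)
    also have "\<dots> \<le> C ^ n * r ^ nat \<bar>k\<bar>"
    proof (intro mult_left_mono power_decreasing)
      have "(\<Sum>j<n. int (\<sigma> j)) = (\<Sum>j<n. int j)"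
        using sum.permute[OF \<sigma>, of int] by (simp add: comp_def)
      hence "(\<Sum>j<n. k - int j + int (\<sigma> j)) = int n * k" by (simp add: sum.distrib sum_subtractf)
      hence "int n * \<bar>k\<bar> = \<bar>\<Sum>j<n. k - int j + int (\<sigma> j)\<bar>" by (simp add: abs_mult)
      also have "\<dots> \<le> (\<Sum>j<n. \<bar>k - int j + int (\<sigma> j)\<bar>)" by (rule sum_abs)
      also have "\<dots> = int (\<Sum>j<n. nat \<bar>k - int j + int (\<sigma> j)\<bar>)" by simp
      finally have "int n * \<bar>k\<bar> \<le> int (\<Sum>j<n. nat \<bar>k - int j + int (\<sigma> j)\<bar>)" .
      moreover have "1 * \<bar>k\<bar> \<le> int n * \<bar>k\<bar>" using n by (intro mult_right_mono) auto
      ultimately show "nat \<bar>k\<bar> \<le> (\<Sum>j<n. nat \<bar>k - int j + int (\<sigma> j)\<bar>)" by linarith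
    qed (use r C in auto)
    finally show ?thesis .
  qed
  have "\<bar>toep_det n f k\<bar> \<le> (\<Sum>\<sigma> | \<sigma> permutes {..<n}. C ^ n * r ^ nat \<bar>k\<bar>)"
    unfolding toep_det_expand by (intro order_trans[OF sum_abs] sum_mono p) simp
  also have "\<dots> = (fact n * C ^ n) * r ^ nat \<bar>k\<bar>" by (simp add: card_permutations[of "{..<n}" n])
  finally show ?thesis .
qed

lemma toep_bounds:
  assumes u: "\<And>m. \<bar>u m\<bar> \<le> C * r ^ (2 * m)" and v: "\<And>m. \<bar>v m\<bar> \<le> C * r ^ (2 * m)" and r: "0 < r" "r < 1" and C: "C \<ge> 0"
  shows "summable (\<lambda>m. u m * vext v (int m + s))"
    and "\<bar>toep_trunc u v K s\<bar> \<le> C\<^sup>2 / (1 - r) * r ^ nat \<bar>s\<bar>"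
proof -
  have b: "\<bar>u m * vext v (int m + s)\<bar> \<le> (C\<^sup>2 * r ^ nat \<bar>s\<bar>) * r ^ m" for m
  proof (cases "int m + s < 0")
    case True
    thus ?thesis using r by (simp add: vext_def)
  next
    case False
    have "\<bar>u m * vext v (int m + s)\<bar> \<le> (C * r ^ (2 * m)) * (C * r ^ (2 * nat (int m + s)))"
      unfolding abs_mult using u v False C r by (intro mult_mono) (auto simp: vext_def)
    also have "\<dots> = C\<^sup>2 * r ^ (2 * m + 2 * nat (int m + s))" by (simp add: power2_eq_square power_add mult_ac)
    \<comment> \<open>Since m and m + s are nonnegative, 2 m + 2 (m + s) is at least |s| + m: the
      doubled exponent pays both for summability and for decay in s.\<close>
    also have "\<dots> \<le> C\<^sup>2 * r ^ (nat \<bar>s\<bar> + m)"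
      using False r by (intro mult_left_mono power_decreasing) auto
    finally show ?thesis by (simp add: power_add mult_ac)
  qed
  have sg: "summable (\<lambda>m. (C\<^sup>2 * r ^ nat \<bar>s\<bar>) * r ^ m)" using r by (intro summable_mult summable_geometric) auto
  show "summable (\<lambda>m. u m * vext v (int m + s))"
    by (rule summable_comparison_test'[OF sg, of 0]) (use b in simp)
  have "\<bar>toep_trunc u v K s\<bar> \<le> (\<Sum>m<Suc K - nat s. (C\<^sup>2 * r ^ nat \<bar>s\<bar>) * r ^ m)"
    unfolding toep_trunc_def by (intro order_trans[OF sum_abs] sum_mono b)
  also have "\<dots> \<le> (\<Sum>m. (C\<^sup>2 * r ^ nat \<bar>s\<bar>) * r ^ m)"
    by (rule sum_le_suminf[OF sg]) (use r in auto)
  also have "\<dots> = (C\<^sup>2 * r ^ nat \<bar>s\<bar>) * (1 / (1 - r))"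
    using r by (simp add: suminf_mult suminf_geometric summable_geometric)
  finally show "\<bar>toep_trunc u v K s\<bar> \<le> C\<^sup>2 / (1 - r) * r ^ nat \<bar>s\<bar>" by (simp add: mult_ac)
qed

lemma toep_trunc_tendsto:
  assumes "summable (\<lambda>m. u m * vext v (int m + s))"
  shows "(\<lambda>K. toep_trunc u v K s) \<longlonglongrightarrow> toep u v s"
proof -
  have "filterlim (\<lambda>K. Suc K - nat s) sequentially sequentially"
    unfolding filterlim_at_top eventually_sequentially by (metis diff_le_mono le_SucI add_diff_cancel_right' )
  from filterlim_compose[OF summable_LIMSEQ[OF assms] this] show ?thesis
    unfolding toep_trunc_def toep_def .
qed

lemma toep_det_tendsto:
  assumes "\<And>s. (\<lambda>K. f K s) \<longlonglongrightarrow> g s"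
  shows "(\<lambda>K. toep_det n (f K) k) \<longlonglongrightarrow> toep_det n g k"
  unfolding toep_det_expand by (intro tendsto_intros assms)

section \<open>From Laurent polynomials to Laurent series\<close>

lemma prod_mset_norm_le:
  fixes f :: "'a \<Rightarrow> complex"
  assumes "\<And>z. z \<in> set zs \<Longrightarrow> norm (f z) \<le> c"
  shows "norm (\<Prod>z\<leftarrow>zs. f z) \<le> c ^ length zs"
  using assms
proof (induction zs)
  case (Cons a zs)
  have "norm (f a) * norm (\<Prod>z\<leftarrow>zs. f z) \<le> c * c ^ length zs"
    using Cons order_trans[OF norm_ge_zero, of "f a" c] by (intro mult_mono) auto
  thus ?case by (simp add: norm_mult)
qed simp

lemma poly_trunc_poly:
  assumes "z \<noteq> 0"
  shows "poly (trunc_poly u v K) z = z ^ K * ((\<Sum>m\<le>K. of_real (u m) * (1 / z) ^ m) * (\<Sum>m\<le>K. of_real (v m) * z ^ m))"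
proof -
  have "(\<Sum>m\<le>K. of_real (u m) * z ^ (K - m)) = z ^ K * (\<Sum>m\<le>K. of_real (u m) * (1 / z) ^ m)"
    unfolding sum_distrib_left
    by (intro sum.cong refl) (use assms in \<open>simp add: power_diff power_one_over field_simps\<close>)
  thus ?thesis unfolding trunc_poly_def by (simp add: poly_sum poly_monom)
qed

lemma tendsto_prod_list:
  fixes f :: "nat \<Rightarrow> 'a \<Rightarrow> complex"
  assumes "\<And>z. z \<in> set zs \<Longrightarrow> (\<lambda>K. f K z) \<longlonglongrightarrow> g z"
  shows "(\<lambda>K. \<Prod>z\<leftarrow>zs. f K z) \<longlonglongrightarrow> (\<Prod>z\<leftarrow>zs. g z)"
  using assms
proof (induction zs)
  case (Cons a zs)
  have 1: "(\<lambda>K. f K a) \<longlonglongrightarrow> g a" by (rule Cons.prems) simp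
  have 2: "(\<lambda>K. \<Prod>z\<leftarrow>zs. f K z) \<longlonglongrightarrow> (\<Prod>z\<leftarrow>zs. g z)"
    by (rule Cons.IH, rule Cons.prems) simp
  from tendsto_mult[OF 1 2] show ?case by (simp only: list.map prod_list.Cons)
qed simp

lemma geometric_bound_series:
  fixes w :: "nat \<Rightarrow> real" and z :: complex
  assumes r: "0 < r" "r < 1" and C: "C \<ge> 0" and w: "\<And>m. \<bar>w m\<bar> \<le> C * r ^ (2 * m)" and z: "norm z = 1"
  shows "summable (\<lambda>m. complex_of_real (w m) * z ^ m)"
    and "norm (\<Sum>m\<le>K. complex_of_real (w m) * z ^ m) \<le> C * (1 / (1 - r\<^sup>2))"
proof -
  have r2: "r\<^sup>2 < 1" "0 \<le> r\<^sup>2" using r by (simp_all add: power_less_one_iff)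
  have sg: "summable (\<lambda>m. C * r ^ (2 * m))" unfolding power_mult using r2 by (intro summable_mult summable_geometric) simp
  have sgB: "(\<Sum>m. C * r ^ (2 * m)) = C * (1 / (1 - r\<^sup>2))" unfolding power_mult using r2
    by (subst suminf_mult) (simp_all add: suminf_geometric summable_geometric)
  have nw: "norm (complex_of_real (w m) * z ^ m) \<le> C * r ^ (2 * m)" for m
    using w z by (simp add: norm_mult norm_power)
  show "summable (\<lambda>m. complex_of_real (w m) * z ^ m)"
    by (rule summable_comparison_test'[OF sg, of 0]) (use nw in simp)
  have "norm (\<Sum>m\<le>K. complex_of_real (w m) * z ^ m) \<le> (\<Sum>m\<le>K. C * r ^ (2 * m))"
    by (intro sum_norm_le nw)
  also have "\<dots> \<le> (\<Sum>m. C * r ^ (2 * m))" by (rule sum_le_suminf[OF sg]) (use C r in auto)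
  finally show "norm (\<Sum>m\<le>K. complex_of_real (w m) * z ^ m) \<le> C * (1 / (1 - r\<^sup>2))" unfolding sgB .
qed

lemma trunc_poly_eigenvalues:
  assumes A: "A \<in> SU n" and r: "0 < r" "r < 1" and C: "C \<ge> 0"
    and u: "\<And>m. \<bar>u m\<bar> \<le> C * r ^ (2 * m)" and v: "\<And>m. \<bar>v m\<bar> \<le> C * r ^ (2 * m)"
  shows "norm (\<Prod>z\<in>#eigenvalue_mset A. poly (trunc_poly u v K) z) \<le> ((C * (1 / (1 - r\<^sup>2))) * (C * (1 / (1 - r\<^sup>2)))) ^ n"
    and "(\<lambda>K. \<Prod>z\<in>#eigenvalue_mset A. poly (trunc_poly u v K) z) \<longlonglongrightarrow>
      (\<Prod>z\<in>#eigenvalue_mset A. (\<Sum>m. of_real (u m) * (1 / z) ^ m) * (\<Sum>m. of_real (v m) * z ^ m))"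
proof -
  define UK where "UK K z = (\<Sum>m\<le>K. complex_of_real (u m) * z ^ m)" for K z
  define VK where "VK K z = (\<Sum>m\<le>K. complex_of_real (v m) * z ^ m)" for K z
  let ?B = "C * (1 / (1 - r\<^sup>2))"
  have B0: "?B \<ge> 0" using C r by (simp add: power_le_one)
  note ser = geometric_bound_series[OF r C]
  let ?FK = "\<lambda>K A. \<Prod>z\<in>#eigenvalue_mset A. poly (trunc_poly u v K) z"
  obtain zs where zs: "length zs = n" "eigenvalue_mset A = mset zs" "prod_list zs = 1" "\<And>z. z \<in> set zs \<Longrightarrow> norm z = 1"
    using SU_eigenvalues[OF A] by metis
  have FK: "?FK K A = (\<Prod>z\<leftarrow>zs. UK K (1 / z) * VK K z)" for K
  proof -
    have "?FK K A = (\<Prod>z\<leftarrow>zs. poly (trunc_poly u v K) z)"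
      unfolding zs(2) by (simp add: prod_mset_prod_list flip: mset_map)
    also have "\<dots> = (\<Prod>z\<leftarrow>zs. z ^ K * (UK K (1 / z) * VK K z))"
    proof (intro arg_cong[of _ _ prod_list] map_cong refl)
      fix z assume "z \<in> set zs"
      hence "z \<noteq> 0" using zs(4) by force
      thus "poly (trunc_poly u v K) z = z ^ K * (UK K (1 / z) * VK K z)"
        unfolding UK_def VK_def by (rule poly_trunc_poly)
    qed
    \<comment> \<open>Collecting the factors z^K gives a power of the product of all eigenvalues,
      which is 1.\<close>
    also have "\<dots> = prod_list zs ^ K * (\<Prod>z\<leftarrow>zs. UK K (1 / z) * VK K z)"
      by (induction zs) (simp_all add: power_mult_distrib mult_ac)
    finally show ?thesis using zs(3) by simp
  qed
  have nz: "norm z = 1" "norm (1 / z) = 1" if "z \<in> set zs" for z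
    using zs(4)[OF that] by (simp_all add: norm_divide)
  have "norm (UK K (1 / z) * VK K z) \<le> ?B * ?B" if "z \<in> set zs" for z
    unfolding norm_mult UK_def VK_def
    using B0 by (intro mult_mono ser(2)[OF u nz(2)[OF that]] ser(2)[OF v nz(1)[OF that]]) auto
  thus "norm (?FK K A) \<le> (?B * ?B) ^ n" unfolding FK zs(1)[symmetric] by (rule prod_mset_norm_le)
  have "(\<lambda>K. UK K (1 / z) * VK K z) \<longlonglongrightarrow> (\<Sum>m. of_real (u m) * (1 / z) ^ m) * (\<Sum>m. of_real (v m) * z ^ m)" if "z \<in> set zs" for z
    unfolding UK_def VK_def
    by (intro tendsto_mult summable_LIMSEQ' ser(1)[OF u nz(2)[OF that]] ser(1)[OF v nz(1)[OF that]])
  hence "(\<lambda>K. \<Prod>z\<leftarrow>zs. UK K (1 / z) * VK K z) \<longlonglongrightarrow> (\<Prod>z\<leftarrow>zs. (\<Sum>m. of_real (u m) * (1 / z) ^ m) * (\<Sum>m. of_real (v m) * z ^ m))"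
    by (rule tendsto_prod_list)
  thus "(\<lambda>K. ?FK K A) \<longlonglongrightarrow> (\<Prod>z\<in>#eigenvalue_mset A. (\<Sum>m. of_real (u m) * (1 / z) ^ m) * (\<Sum>m. of_real (v m) * z ^ m))"
    unfolding FK unfolding zs(2) by (simp only: prod_mset_prod_list flip: mset_map)
qed

text \<open>Tannery's theorem with a geometric majorant independent of K. The index map e allows one
  argument for both the nonnegative and the negative integers.\<close>

lemma toep_det_series:
  assumes n: "n > 0" and r: "0 < r" "r < 1" and C: "C \<ge> 0"
    and u: "\<And>m. \<bar>u m\<bar> \<le> C * r ^ (2 * m)" and v: "\<And>m. \<bar>v m\<bar> \<le> C * r ^ (2 * m)"
    and e: "\<And>k. k \<le> nat \<bar>e k\<bar>"
  shows "summable (\<lambda>k. toep_det n (toep u v) (e k))"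
    and "(\<lambda>K. \<Sum>k. toep_det n (toep_trunc u v K) (e k)) \<longlonglongrightarrow> (\<Sum>k. toep_det n (toep u v) (e k))"
proof -
  define E where "E = fact n * (C\<^sup>2 / (1 - r)) ^ n"
  have C': "C\<^sup>2 / (1 - r) \<ge> 0" using r by simp
  have E0: "E \<ge> 0" unfolding E_def using C' by simp
  have bound: "\<bar>toep_det n (toep_trunc u v K) k\<bar> \<le> E * r ^ nat \<bar>k\<bar>" for K k
    unfolding E_def
  proof (rule toep_det_bound[OF _ _ _ C' n])
    show "\<bar>toep_trunc u v K s\<bar> \<le> C\<^sup>2 / (1 - r) * r ^ nat \<bar>s\<bar>" for s
      by (rule toep_bounds(2)[of u C r v, OF u v r C])
  qed (use r in simp_all)
  have lim: "(\<lambda>K. toep_det n (toep_trunc u v K) k) \<longlonglongrightarrow> toep_det n (toep u v) k" for k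
  proof (rule toep_det_tendsto, rule toep_trunc_tendsto)
    show "summable (\<lambda>m. u m * vext v (int m + s))" for s
      by (rule toep_bounds(1)[of u C r v, OF u v r C])
  qed
  have sumE: "summable (\<lambda>k. E * r ^ k)" using r by (intro summable_mult summable_geometric) simp
  have le: "norm (toep_det n (toep_trunc u v K) (e k)) \<le> E * r ^ k" for k K
  proof -
    have "r ^ nat \<bar>e k\<bar> \<le> r ^ k" using r e[of k] by (intro power_decreasing) simp_all
    hence "E * r ^ nat \<bar>e k\<bar> \<le> E * r ^ k" using E0 by (rule mult_left_mono)
    with bound[of K "e k"] show ?thesis unfolding real_norm_def by (rule order_trans)
  qed
  have ev: "\<forall>\<^sub>F (k, K) in sequentially \<times>\<^sub>F sequentially. norm (toep_det n (toep_trunc u v K) (e k)) \<le> E * r ^ k"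
    by (rule always_eventually) (simp add: split_beta le del: real_norm_def)
  have *: "(\<forall>\<^sub>F K in sequentially. summable (\<lambda>k. norm (toep_det n (toep_trunc u v K) (e k)))) \<and>
      summable (\<lambda>k. norm (toep_det n (toep u v) (e k))) \<and>
      (\<lambda>K. \<Sum>k. toep_det n (toep_trunc u v K) (e k)) \<longlonglongrightarrow> (\<Sum>k. toep_det n (toep u v) (e k))"
    by (rule tannerys_theorem[where a = "\<lambda>k K. toep_det n (toep_trunc u v K) (e k)" and b = "\<lambda>k. toep_det n (toep u v) (e k)"
          and M = "\<lambda>k. E * r ^ k" and F = sequentially], rule lim, rule ev, rule sumE, rule sequentially_bot)
  show "summable (\<lambda>k. toep_det n (toep u v) (e k))"
    by (rule summable_norm_cancel[OF conjunct1[OF conjunct2[OF *]]])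
  show "(\<lambda>K. \<Sum>k. toep_det n (toep_trunc u v K) (e k)) \<longlonglongrightarrow> (\<Sum>k. toep_det n (toep u v) (e k))"
    by (rule conjunct2[OF conjunct2[OF *]])
qed

lemma (in prob_space) integral_eq_limit:
  fixes f :: "nat \<Rightarrow> 'a \<Rightarrow> complex"
  assumes m: "\<And>K. f K \<in> borel_measurable M" and b: "\<And>K x. x \<in> space M \<Longrightarrow> norm (f K x) \<le> B"
    and p: "\<And>x. x \<in> space M \<Longrightarrow> (\<lambda>K. f K x) \<longlonglongrightarrow> g x"
    and c: "\<And>K. (LINT x|M. f K x) = c K" and s: "c \<longlonglongrightarrow> s"
  shows "(LINT x|M. g x) = s"
proof -
  have g: "g \<in> borel_measurable M"
    by (rule borel_measurable_LIMSEQ_metric[OF m p])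
  have "(\<lambda>K. LINT x|M. f K x) \<longlonglongrightarrow> (LINT x|M. g x)"
    by (rule integral_dominated_convergence[where w = "\<lambda>_. B", OF g m]) (use p b in \<open>auto intro!: AE_I2\<close>)
  moreover have "(\<lambda>K. LINT x|M. f K x) = c" using c by (rule ext)
  ultimately show ?thesis using s LIMSEQ_unique by metis
qed

context haar begin

text \<open>Measurability is not visible from a multiset of roots; the determinant formula writes
  the product as a polynomial in the h_m.\<close>

lemma smooth_prod_eigenvalues: "smooth_on_SU n (\<lambda>A. \<Prod>z\<in>#eigenvalue_mset A. poly f z)"
proof -
  have "smooth_on_SU n (\<lambda>A. \<Sum>\<sigma> | \<sigma> permutes {..<n}. of_int (sign \<sigma>) *
      (\<Prod>j<n. \<Sum>m\<le>degree f + n. zcoeff f (int m - int j + int (\<sigma> j)) * hsym (ptr A) m))"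
    by (intro smooth_on_SU_sum smooth_on_SU_prod smooth_on_SU_intros(1,3) smooth_on_SU_intros(5))
      (simp_all add: finite_permutations)
  then obtain G where "has_grad n (\<lambda>A. \<Sum>\<sigma> | \<sigma> permutes {..<n}. of_int (sign \<sigma>) *
      (\<Prod>j<n. \<Sum>m\<le>degree f + n. zcoeff f (int m - int j + int (\<sigma> j)) * hsym (ptr A) m)) G"
    unfolding smooth_on_SU_def by blast
  hence "has_grad n (\<lambda>A. \<Prod>z\<in>#eigenvalue_mset A. poly f z) G"
    by (rule has_grad_cong) (simp_all only: prod_eigenvalues_poly det_mat_expand)
  thus ?thesis unfolding smooth_on_SU_def by blast
qed

text \<open>The factor z^K moves the shift from k to k - K, so the finite sum splits at k = K into
  the two half-lines. Writing the halves as series makes their form independent of K.\<close>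

lemma integral_trunc_poly:
  assumes n: "n > 0"
  shows "(LINT A|M. (\<Prod>z\<in>#eigenvalue_mset A. poly (trunc_poly u v K) z)) =
    of_real ((\<Sum>k. toep_det n (toep_trunc u v K) (int k)) + (\<Sum>k. toep_det n (toep_trunc u v K) (- 1 - int k)))"
proof -
  let ?f = "trunc_poly u v K"
  let ?d = "toep_det n (toep_trunc u v K)"
  have d: "Determinant.det (mat n n (\<lambda>(j, l). zcoeff ?f (int k - int j + int l))) = of_real (?d (int k - int K))" for k
    unfolding det_mat_expand toep_det_expand coeff_trunc_poly of_real_sum of_real_mult of_real_prod of_real_of_int_eq
    by (intro sum.cong refl arg_cong2[of _ _ _ _ times] prod.cong arg_cong[of _ _ "\<lambda>x. of_real (toep_trunc u v K x)"]) simp_all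
  have z1: "?d k = 0" if "k < - int K" for k
    by (rule toep_det_eq_0[OF n, of "n - 1"]) (use n that in \<open>auto intro!: toep_trunc_eq_0\<close>)
  have z2: "?d k = 0" if "k > int K" for k
    by (rule toep_det_eq_0[OF n, of 0]) (use n that in \<open>auto intro!: toep_trunc_eq_0\<close>)
  have "(LINT A|M. (\<Prod>z\<in>#eigenvalue_mset A. poly ?f z)) = (\<Sum>k\<le>degree ?f + n. of_real (?d (int k - int K)))"
    unfolding integral_prod_eigenvalues[OF n] d ..
  \<comment> \<open>Leading coefficients may vanish, so the range is normalised to 0, ..., 2K; every
    term gained or lost is 0.\<close>
  also have "\<dots> = (\<Sum>k\<in>{..<K} \<union> {K..2 * K}. of_real (?d (int k - int K)))"
  proof -
    have "of_real (?d (int k - int K)) = (0 :: complex)" if "k > degree ?f + n" "k \<le> 2 * K" for k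
    proof -
      have "Determinant.det (mat n n (\<lambda>(j, l). zcoeff ?f (int k - int j + int l))) = 0"
        unfolding det_mat_expand
      proof (intro sum.neutral ballI)
        fix \<sigma> assume "\<sigma> \<in> {\<sigma>. \<sigma> permutes {..<n}}"
        have "zcoeff ?f (int k - int 0 + int (\<sigma> 0)) = 0"
          using that unfolding zcoeff_def by (auto intro!: coeff_eq_0)
        hence "(\<Prod>j<n. zcoeff ?f (int k - int j + int (\<sigma> j))) = 0"
          using n by (intro prod_zero bexI[of _ 0]) simp_all
        thus "of_int (sign \<sigma>) * (\<Prod>j<n. zcoeff ?f (int k - int j + int (\<sigma> j))) = 0" by simp
      qed
      thus ?thesis unfolding d .
    qed
    moreover have "of_real (?d (int k - int K)) = (0 :: complex)" if "k > 2 * K" for k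
      using z2[of "int k - int K"] that by simp
    ultimately show ?thesis
      by (intro sum.mono_neutral_cong) auto
  qed
  also have "\<dots> = (\<Sum>k<K. of_real (?d (int k - int K))) + (\<Sum>k=K..2 * K. of_real (?d (int k - int K)))"
    by (rule sum.union_disjoint) auto
  also have "(\<Sum>k<K. of_real (?d (int k - int K))) = (\<Sum>k<K. complex_of_real (?d (- 1 - int k)))"
    by (rule sum.reindex_bij_witness[of _ "\<lambda>k. K - 1 - k" "\<lambda>k. K - 1 - k"]) (auto simp: of_nat_diff algebra_simps)
  also have "(\<Sum>k=K..2 * K. of_real (?d (int k - int K))) = (\<Sum>k\<le>K. complex_of_real (?d (int k)))"
    by (rule sum.reindex_bij_witness[of _ "\<lambda>k. k + K" "\<lambda>k. k - K"]) (auto simp: of_nat_diff)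
  also have "(\<Sum>k<K. complex_of_real (?d (- 1 - int k))) = of_real (\<Sum>k. ?d (- 1 - int k))"
    unfolding of_real_sum[symmetric]
    by (intro arg_cong[of _ _ of_real] suminf_finite[symmetric]) (auto intro!: z1)
  also have "(\<Sum>k\<le>K. complex_of_real (?d (int k))) = of_real (\<Sum>k. ?d (int k))"
    unfolding of_real_sum[symmetric]
    by (intro arg_cong[of _ _ of_real] suminf_finite[symmetric]) (auto intro!: z2)
  finally show ?thesis by simp
qed

lemma integral_prod_eigenvalues_series:
  assumes n: "n > 0" and r: "0 < r" "r < 1" and C: "C \<ge> 0"
    and u: "\<And>m. \<bar>u m\<bar> \<le> C * r ^ (2 * m)" and v: "\<And>m. \<bar>v m\<bar> \<le> C * r ^ (2 * m)"
  shows "summable (\<lambda>k. toep_det n (toep u v) (int k))"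
    and "summable (\<lambda>k. toep_det n (toep u v) (- 1 - int k))"
    and "(LINT A|M. (\<Prod>z\<in>#eigenvalue_mset A. (\<Sum>m. of_real (u m) * (1 / z) ^ m) * (\<Sum>m. of_real (v m) * z ^ m))) =
    of_real ((\<Sum>k. toep_det n (toep u v) (int k)) + (\<Sum>k. toep_det n (toep u v) (- 1 - int k)))"
proof -
  note ser = toep_det_series[of n r C u v, OF n r C u v]
  have t1: "summable (\<lambda>k. toep_det n (toep u v) (int k))"
    "(\<lambda>K. \<Sum>k. toep_det n (toep_trunc u v K) (int k)) \<longlonglongrightarrow> (\<Sum>k. toep_det n (toep u v) (int k))"
    by (rule ser[of int], simp)+
  have t2: "summable (\<lambda>k. toep_det n (toep u v) (- 1 - int k))"
    "(\<lambda>K. \<Sum>k. toep_det n (toep_trunc u v K) (- 1 - int k)) \<longlonglongrightarrow> (\<Sum>k. toep_det n (toep u v) (- 1 - int k))"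
    by (rule ser[of "\<lambda>k. - 1 - int k"], simp)+
  show "summable (\<lambda>k. toep_det n (toep u v) (int k))" "summable (\<lambda>k. toep_det n (toep u v) (- 1 - int k))"
    by (rule t1(1), rule t2(1))
  define FK where "FK K A = (\<Prod>z\<in>#eigenvalue_mset A. poly (trunc_poly u v K) z)" for K and A :: "complex mat"
  define F where "F A = (\<Prod>z\<in>#eigenvalue_mset A. (\<Sum>m. of_real (u m) * (1 / z) ^ m) * (\<Sum>m. of_real (v m) * z ^ m))" for A
  define B where "B = ((C * (1 / (1 - r\<^sup>2))) * (C * (1 / (1 - r\<^sup>2)))) ^ n"
  have pt1: "norm (FK K A) \<le> B" if "A \<in> space M" for K A
    unfolding FK_def B_def by (rule trunc_poly_eigenvalues(1)[of A n r C u v, OF that[unfolded space_M] r C u v])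
  have pt2: "(\<lambda>K. FK K A) \<longlonglongrightarrow> F A" if "A \<in> space M" for A
    unfolding FK_def F_def by (rule trunc_poly_eigenvalues(2)[of A n r C u v, OF that[unfolded space_M] r C u v])
  have mK: "FK K \<in> borel_measurable M" for K
    unfolding FK_def by (rule borel_measurable_integrable[OF smooth_integrable[OF smooth_prod_eigenvalues]])
  define S where "S K = (\<Sum>k. toep_det n (toep_trunc u v K) (int k)) + (\<Sum>k. toep_det n (toep_trunc u v K) (- 1 - int k))" for K
  define s where "s = (\<Sum>k. toep_det n (toep u v) (int k)) + (\<Sum>k. toep_det n (toep u v) (- 1 - int k))"
  have e: "(LINT A|M. FK K A) = of_real (S K)" for K
    unfolding S_def FK_def by (rule integral_trunc_poly[OF n])
  have "S \<longlonglongrightarrow> s"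
    unfolding S_def[abs_def] s_def by (rule tendsto_add[OF t1(2) t2(2)])
  hence "(\<lambda>K. complex_of_real (S K)) \<longlonglongrightarrow> of_real s" by (rule tendsto_of_real)
  from integral_eq_limit[of FK B F "\<lambda>K. of_real (S K)" "of_real s", OF mK pt1 pt2 e this]
  have "(LINT A|M. F A) = of_real s" .
  thus "(LINT A|M. (\<Prod>z\<in>#eigenvalue_mset A. (\<Sum>m. of_real (u m) * (1 / z) ^ m) * (\<Sum>m. of_real (v m) * z ^ m))) =
    of_real ((\<Sum>k. toep_det n (toep u v) (int k)) + (\<Sum>k. toep_det n (toep u v) (- 1 - int k)))"
    unfolding s_def F_def .
qed

end

section \<open>Comparison of the Toeplitz determinants\<close>

lemma comp_permutes_PiE:
  assumes \<tau>: "\<tau> permutes {..<n::nat}"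
  shows "bij_betw (\<lambda>g. g \<circ> \<tau>) ({..<n} \<rightarrow>\<^sub>E A) ({..<n} \<rightarrow>\<^sub>E A)"
proof (rule bij_betw_byWitness[where f' = "\<lambda>g. g \<circ> inv_into UNIV \<tau>"])
  have c: "g \<circ> \<sigma> \<in> {..<n} \<rightarrow>\<^sub>E A" if g: "g \<in> {..<n} \<rightarrow>\<^sub>E A" and \<sigma>: "\<sigma> permutes {..<n}" for g \<sigma>
  proof (rule PiE_I)
    fix x assume "x \<in> {..<n}"
    hence "\<sigma> x \<in> {..<n}" using permutes_in_image[OF \<sigma>] by blast
    thus "(g \<circ> \<sigma>) x \<in> A" using PiE_mem[OF g] by simp
  next
    fix x assume x: "x \<notin> {..<n}"
    hence "\<sigma> x = x" by (rule permutes_not_in[OF \<sigma>])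
    thus "(g \<circ> \<sigma>) x = undefined" using PiE_arb[OF g x] by simp
  qed
  show "(\<lambda>g. g \<circ> \<tau>) ` ({..<n} \<rightarrow>\<^sub>E A) \<subseteq> {..<n} \<rightarrow>\<^sub>E A"
    using c[OF _ \<tau>] by (intro image_subsetI)
  show "(\<lambda>g. g \<circ> inv_into UNIV \<tau>) ` ({..<n} \<rightarrow>\<^sub>E A) \<subseteq> {..<n} \<rightarrow>\<^sub>E A"
    using c[OF _ permutes_inv[OF \<tau>]] by (intro image_subsetI)
  have "g \<circ> \<tau> \<circ> inv_into UNIV \<tau> = g" "g \<circ> inv_into UNIV \<tau> \<circ> \<tau> = g" for g
    using permutes_inv_o[OF \<tau>] by (simp_all add: comp_assoc)
  thus "\<forall>g\<in>{..<n} \<rightarrow>\<^sub>E A. g \<circ> \<tau> \<circ> inv_into UNIV \<tau> = g" "\<forall>g\<in>{..<n} \<rightarrow>\<^sub>E A. g \<circ> inv_into UNIV \<tau> \<circ> \<tau> = g"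
    by blast+
qed

text \<open>Expand one determinant, then average over all relabellings of the rows: the signs
  collect the factors x into the second determinant. The sum runs over all maps g instead of
  increasing ones, which accounts for \<open>fact n\<close>.\<close>

lemma andreief:
  fixes x y :: "nat \<Rightarrow> nat \<Rightarrow> real"
  shows "fact n * Determinant.det (mat n n (\<lambda>(j, l). \<Sum>p<P. x j p * y l p)) =
    (\<Sum>g\<in>{..<n} \<rightarrow>\<^sub>E {..<P}. Determinant.det (mat n n (\<lambda>(q, j). x j (g q))) * Determinant.det (mat n n (\<lambda>(q, l). y l (g q))))"
proof -
  let ?G = "{..<n} \<rightarrow>\<^sub>E {..<P}"
  let ?S = "{\<sigma>. \<sigma> permutes {..<n}}"
  define Y where "Y g = Determinant.det (mat n n (\<lambda>(q, l). y l (g q)))" for g :: "nat \<Rightarrow> nat"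
  have fin: "finite ?S" "finite ?G" by (simp_all add: finite_permutations finite_PiE)
  have 1: "Determinant.det (mat n n (\<lambda>(j, l). \<Sum>p<P. x j p * y l p)) = (\<Sum>g\<in>?G. (\<Prod>j<n. x j (g j)) * Y g)"
  proof -
    have "Determinant.det (mat n n (\<lambda>(j, l). \<Sum>p<P. x j p * y l p)) =
      (\<Sum>\<sigma>\<in>?S. \<Sum>g\<in>?G. (\<Prod>j<n. x j (g j)) * (of_int (sign \<sigma>) * (\<Prod>j<n. y (\<sigma> j) (g j))))"
      unfolding det_mat_expand
      by (intro sum.cong refl) (simp add: prod_sum_PiE sum_distrib_left prod.distrib mult_ac)
    also have "\<dots> = (\<Sum>g\<in>?G. \<Sum>\<sigma>\<in>?S. (\<Prod>j<n. x j (g j)) * (of_int (sign \<sigma>) * (\<Prod>j<n. y (\<sigma> j) (g j))))"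
      by (rule sum.swap)
    also have "\<dots> = (\<Sum>g\<in>?G. (\<Prod>j<n. x j (g j)) * Y g)"
      unfolding Y_def det_mat_expand sum_distrib_left ..
    finally show ?thesis .
  qed
  have Yp: "Y (g \<circ> \<tau>) = of_int (sign \<tau>) * Y g" if \<tau>: "\<tau> permutes {..<n}" for g \<tau>
  proof -
    have \<tau>': "\<tau> permutes {0..<n}" using \<tau> by (simp add: lessThan_atLeast0)
    have "mat n n (\<lambda>(q, l). y l ((g \<circ> \<tau>) q)) = mat n n (\<lambda>(q, l). mat n n (\<lambda>(q, l). y l (g q)) $$ (\<tau> q, l))"
      using permutes_in_image[OF \<tau>] by (intro eq_matI) auto
    thus ?thesis unfolding Y_def by (subst det_permute_rows[OF _ \<tau>', symmetric]) simp_all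
  qed
  have 2: "Determinant.det (mat n n (\<lambda>(j, l). \<Sum>p<P. x j p * y l p)) = (\<Sum>g\<in>?G. (of_int (sign \<tau>) * (\<Prod>j<n. x j (g (\<tau> j)))) * Y g)"
    if \<tau>: "\<tau> \<in> ?S" for \<tau>
  proof -
    have \<tau>': "\<tau> permutes {..<n}" using \<tau> by simp
    have "(\<Sum>g\<in>?G. (\<Prod>j<n. x j (g j)) * Y g) = (\<Sum>g\<in>?G. (\<Prod>j<n. x j ((g \<circ> \<tau>) j)) * Y (g \<circ> \<tau>))"
      by (rule sum.reindex_bij_betw[OF comp_permutes_PiE[OF \<tau>'], symmetric])
    also have "\<dots> = (\<Sum>g\<in>?G. (of_int (sign \<tau>) * (\<Prod>j<n. x j (g (\<tau> j)))) * Y g)"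
      unfolding Yp[OF \<tau>'] by (intro sum.cong refl) (simp only: mult_ac comp_apply)
    finally show ?thesis unfolding 1 .
  qed
  have "fact n * Determinant.det (mat n n (\<lambda>(j, l). \<Sum>p<P. x j p * y l p)) =
    (\<Sum>\<tau>\<in>?S. Determinant.det (mat n n (\<lambda>(j, l). \<Sum>p<P. x j p * y l p)))"
    by (simp add: card_permutations[of "{..<n}" n])
  also have "\<dots> = (\<Sum>\<tau>\<in>?S. \<Sum>g\<in>?G. (of_int (sign \<tau>) * (\<Prod>j<n. x j (g (\<tau> j)))) * Y g)"
    by (rule sum.cong[OF refl]) (rule 2)
  also have "\<dots> = (\<Sum>g\<in>?G. (\<Sum>\<tau>\<in>?S. of_int (sign \<tau>) * (\<Prod>j<n. x j (g (\<tau> j)))) * Y g)"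
    unfolding sum_distrib_right by (rule sum.swap)
  also have "\<dots> = (\<Sum>g\<in>?G. Determinant.det (mat n n (\<lambda>(q, j). x j (g q))) * Y g)"
  proof (intro sum.cong refl arg_cong2[of _ _ _ _ times])
    fix g :: "nat \<Rightarrow> nat"
    have "transpose_mat (mat n n (\<lambda>(q, j). x j (g q))) = mat n n (\<lambda>(j, q). x j (g q))"
      by (intro eq_matI) simp_all
    hence "Determinant.det (mat n n (\<lambda>(q, j). x j (g q))) = Determinant.det (mat n n (\<lambda>(j, q). x j (g q)))"
      using Determinant.det_transpose[of "mat n n (\<lambda>(q, j). x j (g q))" n] by simp
    thus "(\<Sum>\<tau>\<in>?S. of_int (sign \<tau>) * (\<Prod>j<n. x j (g (\<tau> j)))) = Determinant.det (mat n n (\<lambda>(q, j). x j (g q)))"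
      unfolding det_mat_expand[of n "\<lambda>j q. x j (g q)"] by simp
  qed
  finally show ?thesis unfolding Y_def .
qed

text \<open>\<open>bdet\<close> is a Vandermonde determinant up to a constant, hence invariant under a common shift of all
  \<open>g q\<close>; \<open>cdet\<close> is built from the coefficients of \<open>(1 - t)\<^bsup>-(n + d)\<^esup>\<close> and is a multiple of it by a product.\<close>

definition bdet :: "nat \<Rightarrow> (nat \<Rightarrow> nat) \<Rightarrow> real" where
  "bdet n g = Determinant.det (mat n n (\<lambda>(q, i). real (g q choose i)))"

definition cdet :: "nat \<Rightarrow> nat \<Rightarrow> (nat \<Rightarrow> nat) \<Rightarrow> real" where
  "cdet n d g = Determinant.det (mat n n (\<lambda>(q, j). real ((g q + j + d) choose (n - 1 + d))))"

lemma det_mat_factor: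
  fixes f h :: "nat \<Rightarrow> nat \<Rightarrow> 'a :: comm_ring_1"
  shows "Determinant.det (mat n n (\<lambda>(q, j). \<Sum>i<n. f q i * h i j)) =
    Determinant.det (mat n n (\<lambda>(q, i). f q i)) * Determinant.det (mat n n (\<lambda>(i, j). h i j))"
proof -
  have "mat n n (\<lambda>(q, j). \<Sum>i<n. f q i * h i j) = mat n n (\<lambda>(q, i). f q i) * mat n n (\<lambda>(i, j). h i j)"
    by (intro eq_matI) (simp_all add: scalar_prod_def lessThan_atLeast0)
  thus ?thesis by (simp add: Determinant.det_mult[of _ n])
qed

lemma det_mat_row_scale:
  fixes f :: "nat \<Rightarrow> nat \<Rightarrow> 'a :: comm_ring_1"
  shows "Determinant.det (mat n n (\<lambda>(q, i). c q * f q i)) = (\<Prod>q<n. c q) * Determinant.det (mat n n (\<lambda>(q, i). f q i))"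
  unfolding det_mat_expand sum_distrib_left by (intro sum.cong refl) (simp add: prod.distrib mult_ac)

text \<open>Pascal's rule is right multiplication by a unit upper triangular matrix.\<close>

lemma bdet_Suc: "bdet n (\<lambda>q. Suc (g q)) = bdet n g"
proof -
  have "Determinant.det (mat n n (\<lambda>(q, j). real (Suc (g q) choose j))) =
    Determinant.det (mat n n (\<lambda>(q, j). \<Sum>i<n. real (g q choose i) * (if i = j \<or> Suc i = j then 1 else 0)))"
  proof (rule arg_cong[of _ _ Determinant.det], rule eq_matI, goal_cases)
    case (1 q j)
    hence j: "j < n" by simp
    have "(\<Sum>i<n. real (g q choose i) * (if i = j \<or> Suc i = j then 1 else 0)) = real (Suc (g q) choose j)"
    proof (cases j)
      case 0
      have "(\<Sum>i<n. real (g q choose i) * (if i = j \<or> Suc i = j then 1 else 0)) = (\<Sum>i<n. if i = 0 then 1 else 0)"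
        by (intro sum.cong refl) (simp add: 0)
      thus ?thesis using j 0 by simp
    next
      case (Suc k)
      have "(\<Sum>i<n. real (g q choose i) * (if i = j \<or> Suc i = j then 1 else 0)) =
        (\<Sum>i<n. (if i = Suc k then real (g q choose Suc k) else 0) + (if i = k then real (g q choose k) else 0))"
        by (intro sum.cong refl) (auto simp: Suc)
      also have "\<dots> = real (g q choose Suc k) + real (g q choose k)" using j Suc by (simp add: sum.distrib)
      finally show ?thesis by (simp add: Suc)
    qed
    thus ?case using 1 by simp
  qed simp_all
  also have "\<dots> = bdet n g * Determinant.det (mat n n (\<lambda>(i, j). if i = j \<or> Suc i = j then 1 else (0::real)))"
    unfolding det_mat_factor bdet_def ..
  also have "Determinant.det (mat n n (\<lambda>(i, j). if i = j \<or> Suc i = j then 1 else (0::real))) = 1"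
  proof -
    let ?A = "mat n n (\<lambda>(i, j). if i = j \<or> Suc i = j then 1 else (0::real))"
    have "Determinant.det (transpose_mat ?A) = 1"
      by (rule det_unit_lower_triangular[of _ n]) auto
    thus ?thesis by (simp add: Determinant.det_transpose[of _ n])
  qed
  finally show ?thesis by (simp add: bdet_def)
qed

definition ckappa :: "nat \<Rightarrow> nat \<Rightarrow> real" where
  "ckappa n d = Determinant.det (mat n n (\<lambda>(i, j). real (j choose (n - 1 - i)) / real ((d + i) choose d)))"

text \<open>Vandermonde's convolution separates g from j. Then (g + d choose d + i) is split into a
  factor depending only on g and d, the entry (g choose i) of \<open>bdet\<close>, and a denominator
  that is moved to the other matrix.\<close>

lemma choose_shift_expand:
  assumes "j < n"
  shows "real ((g + j + d) choose (n - 1 + d)) =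
    (\<Sum>i<n. (real ((g + d) choose d) * real (g choose i)) * (real (j choose (n - 1 - i)) / real ((d + i) choose d)))"
proof -
  have e: "real ((g + d) choose d) * real (g choose i) / real ((d + i) choose d) = real ((g + d) choose (d + i))" for i
  proof (cases "i \<le> g")
    case True
    have "((g + d) choose (d + i)) * ((d + i) choose d) = ((g + d) choose d) * ((g + d - d) choose (d + i - d))"
      by (rule choose_mult) (use True in auto)
    hence "real ((g + d) choose (d + i)) * real ((d + i) choose d) = real ((g + d) choose d) * real (g choose i)"
      by (simp flip: of_nat_mult)
    moreover have "real ((d + i) choose d) \<noteq> 0" by simp
    ultimately show ?thesis by (simp add: field_simps)
  next
    case False
    thus ?thesis by (simp add: binomial_eq_0)
  qed
  have "real ((g + j + d) choose (n - 1 + d)) = (\<Sum>k\<le>n - 1 + d. real ((g + d) choose k) * real (j choose (n - 1 + d - k)))"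
    using vandermonde[of "g + d" j "n - 1 + d"] by (simp add: algebra_simps flip: of_nat_mult of_nat_sum)
  also have "\<dots> = (\<Sum>k\<in>{d..n - 1 + d}. real ((g + d) choose k) * real (j choose (n - 1 + d - k)))"
    by (rule sum.mono_neutral_right) (use assms in \<open>auto intro!: binomial_eq_0\<close>)
  also have "\<dots> = (\<Sum>i<n. real ((g + d) choose (d + i)) * real (j choose (n - 1 - i)))"
    by (rule sum.reindex_bij_witness[of _ "\<lambda>i. d + i" "\<lambda>k. k - d"]) (use assms in auto)
  also have "\<dots> = (\<Sum>i<n. (real ((g + d) choose d) * real (g choose i)) * (real (j choose (n - 1 - i)) / real ((d + i) choose d)))"
    by (intro sum.cong refl) (simp add: e[symmetric])
  finally show ?thesis .
qed

text \<open>The expansion is a product of matrices, and its left factor has its rows scaled. Only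
  the scaling distinguishes the dependence on g from that of a Vandermonde determinant.\<close>

lemma cdet_eq: "cdet n d g = (\<Prod>q<n. real ((g q + d) choose d)) * bdet n g * ckappa n d"
proof -
  have "cdet n d g = Determinant.det (mat n n (\<lambda>(q, j). \<Sum>i<n. (real ((g q + d) choose d) * real (g q choose i)) * (real (j choose (n - 1 - i)) / real ((d + i) choose d))))"
    unfolding cdet_def
  proof (rule arg_cong[of _ _ Determinant.det], rule eq_matI, goal_cases)
    case (1 q j)
    thus ?case using choose_shift_expand[of j n "g q" d] by simp
  qed simp_all
  thus ?thesis unfolding det_mat_factor det_mat_row_scale bdet_def ckappa_def by simp
qed

text \<open>For d = 0 the matrix is Pascal's triangle with its rows reversed, so its determinant is
  a sign.\<close>

lemma ckappa_0_sq: "(ckappa n 0)\<^sup>2 = 1"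
proof -
  define p where "p i = (if i < n then n - 1 - i else i)" for i
  have p: "p permutes {0..<n}"
    by (rule bij_imp_permutes, rule bij_betw_byWitness[where f' = p]) (auto simp: p_def)
  let ?A = "mat n n (\<lambda>(i, j). real (j choose i))"
  have "Determinant.det (transpose_mat ?A) = 1"
    by (rule det_unit_lower_triangular[of _ n]) (auto simp: binomial_eq_0)
  hence A: "Determinant.det ?A = 1" by (simp add: Determinant.det_transpose[of _ n])
  have "mat n n (\<lambda>(i, j). real (j choose (n - 1 - i)) / real ((0 + i) choose 0)) = mat n n (\<lambda>(i, j). ?A $$ (p i, j))"
    by (rule eq_matI) (auto simp: p_def)
  hence "ckappa n 0 = of_int (sign p) * Determinant.det ?A"
    unfolding ckappa_def by (subst det_permute_rows[OF _ p, symmetric]) simp_all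
  thus ?thesis unfolding A by (simp add: sign_def power2_eq_square)
qed

lemma bdet_not_inj:
  assumes "p < n" "q < n" "p \<noteq> q" "g p = g q"
  shows "bdet n g = 0"
proof -
  have "row (mat n n (\<lambda>(q, i). real (g q choose i))) p = row (mat n n (\<lambda>(q, i). real (g q choose i))) q"
    using assms by (intro eq_vecI) simp_all
  thus ?thesis unfolding bdet_def
    by (intro det_identical_rows[of _ n p q]) (use assms in simp_all)
qed

text \<open>The largest element of a set of m + 1 naturals is at least m; remove it and
  induct.\<close>

lemma prod_antitone_le:
  fixes f :: "nat \<Rightarrow> real"
  assumes f: "\<And>k. 0 \<le> f k" "\<And>k l. k \<le> l \<Longrightarrow> f l \<le> f k" and S: "finite S"
  shows "(\<Prod>s\<in>S. f s) \<le> (\<Prod>k<card S. f k)"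
  using S
proof (induction "card S" arbitrary: S)
  case (Suc m)
  define s where "s = Max S"
  have ne: "S \<noteq> {}" using Suc.hyps(2) by auto
  have sS: "s \<in> S" using Suc.prems ne by (simp add: s_def)
  have "S \<subseteq> {..s}" using Suc.prems by (auto simp: s_def)
  hence "card S \<le> Suc s" using card_mono[of "{..s}" S] by simp
  hence ms: "m \<le> s" using Suc.hyps(2) by simp
  have c: "card (S - {s}) = m" using Suc sS by simp
  have "(\<Prod>s\<in>S - {s}. f s) \<le> (\<Prod>k<m. f k)" using Suc.hyps(1)[of "S - {s}"] c Suc.prems by simp
  hence "f s * (\<Prod>s\<in>S - {s}. f s) \<le> f m * (\<Prod>k<m. f k)"
    using f ms by (intro mult_mono prod_nonneg) auto
  thus ?case using prod.remove[OF Suc.prems sS, of f] Suc.hyps(2)[symmetric] by (simp add: mult.commute)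
qed simp

lemma choose_add_prod: "real ((n + d) choose d) = (\<Prod>i<n. 1 + real d / real (i + 1))"
proof (induction n)
  case (Suc n)
  have "Suc n * ((Suc (n + d)) choose d) = Suc (n + d) * ((n + d) choose d)"
    using binomial_absorb_comp[of "Suc (n + d)" d] by (simp add: Suc_diff_le del: mult_Suc)
  hence "real (Suc n * ((Suc (n + d)) choose d)) = real (Suc (n + d) * ((n + d) choose d))" by (simp only:)
  hence "real (n + 1) * real ((Suc n + d) choose d) = real (n + 1 + d) * real ((n + d) choose d)"
    by (simp only: of_nat_mult) simp
  moreover have "real (n + 1) \<noteq> 0" by simp
  ultimately have "real ((Suc n + d) choose d) = real ((n + d) choose d) * (1 + real d / real (n + 1))"
    by (simp add: field_simps)
  thus ?case using Suc by simp
qed simp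

lemma choose_Suc_ratio: "real ((Suc n + d) choose d) = (1 + real d / real (n + 1)) * real ((n + d) choose d)"
  unfolding choose_add_prod by simp

lemma cdet_Suc: "cdet n d (\<lambda>q. Suc (g q)) = (\<Prod>q<n. 1 + real d / real (g q + 1)) * cdet n d g"
  unfolding cdet_eq bdet_Suc choose_Suc_ratio prod.distrib by (simp only: mult.assoc)

text \<open>Distinct values make the product largest when they are 0, ..., n - 1, and there it
  telescopes to the binomial coefficient.\<close>

lemma ratio_le:
  assumes "inj_on g {..<n}"
  shows "(\<Prod>q<n. 1 + real d / real (g q + 1)) \<le> real ((n + d) choose d)"
proof -
  have "(\<Prod>q<n. 1 + real d / real (g q + 1)) = (\<Prod>s\<in>g ` {..<n}. 1 + real d / real (s + 1))"
    using prod.reindex[OF assms, of "\<lambda>s. 1 + real d / real (s + 1)"] by (simp add: comp_def)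
  also have "\<dots> \<le> (\<Prod>k<card (g ` {..<n}). 1 + real d / real (k + 1))"
    by (rule prod_antitone_le) (auto intro!: divide_left_mono add_nonneg_nonneg)
  finally show ?thesis unfolding choose_add_prod card_image[OF assms] by simp
qed

lemma cdet_shift:
  assumes "inj_on g {..<n}"
  obtains R where "0 \<le> R" "R \<le> real ((n + d) choose d) ^ k" "cdet n d (\<lambda>q. g q + k) = R * cdet n d g"
proof -
  have "\<exists>R. 0 \<le> R \<and> R \<le> real ((n + d) choose d) ^ k \<and> cdet n d (\<lambda>q. g q + k) = R * cdet n d g"
  proof (induction k)
    case 0
    show ?case by (intro exI[of _ 1]) simp
  next
    case (Suc k)
    then obtain R where R: "0 \<le> R" "R \<le> real ((n + d) choose d) ^ k" "cdet n d (\<lambda>q. g q + k) = R * cdet n d g" by blast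
    let ?r = "\<Prod>q<n. 1 + real d / real (g q + k + 1)"
    have inj: "inj_on (\<lambda>q. g q + k) {..<n}" using assms by (auto simp: inj_on_def)
    have r: "0 \<le> ?r" "?r \<le> real ((n + d) choose d)"
      using ratio_le[OF inj, of d] by (auto intro!: prod_nonneg add_nonneg_nonneg)
    have "cdet n d (\<lambda>q. g q + Suc k) = ?r * R * cdet n d g"
      using cdet_Suc[of n d "\<lambda>q. g q + k"] R(3) by simp
    moreover have "?r * R \<le> real ((n + d) choose d) ^ Suc k"
      using r R by (simp add: mult_mono)
    ultimately show ?case using r(1) R(1) by (intro exI[of _ "?r * R"]) simp
  qed
  thus ?thesis using that by blast
qed

section \<open>Truncated Toeplitz determinants as sums of nonnegative terms\<close>

definition wt :: "nat \<Rightarrow> real \<Rightarrow> nat \<Rightarrow> real" where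
  "wt a t m = real ((m + a - 1) choose (a - 1)) * t ^ m"

text \<open>This equals the sum of the \<open>g q\<close> minus n (n - 1) / 2: for injective g, the
  size of the partition whose shifted parts are the values of g.\<close>

definition excess :: "nat \<Rightarrow> (nat \<Rightarrow> nat) \<Rightarrow> int" where
  "excess n g = (\<Sum>q<n. int (g q) - (int n - 1) + int q)"

text \<open>At negative indices the binomial coefficient vanishes by itself, so the case distinction
  in \<open>vext\<close> disappears.\<close>

lemma vext_wt:
  assumes "n > 0"
  shows "vext (wt (n + d) t) (int p - (int n - 1) + int k + int j) =
    real ((p + k + j + d) choose (n - 1 + d)) * t ^ nat (int p - (int n - 1) + int k + int j)"
proof (cases "int p - (int n - 1) + int k + int j < 0")
  case True
  hence "p + k + j + d < n - 1 + d" by linarith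
  thus ?thesis using True by (simp add: vext_def binomial_eq_0)
next
  case False
  hence "nat (int p - (int n - 1) + int k + int j) + (n + d) - 1 = p + k + j + d" using assms by linarith
  moreover have "n + d - 1 = n - 1 + d" using assms by simp
  ultimately show ?thesis using False unfolding vext_def wt_def by simp
qed

text \<open>The exponents of t have the same sum for every permutation, so a single power comes out.
  Rounding negative exponents up to 0 is harmless, since the binomial coefficient is 0
  there.\<close>

lemma det_vext_wt:
  assumes n: "n > 0"
  shows "Determinant.det (mat n n (\<lambda>(q, j). vext (wt (n + d) t) (int (g q) - (int n - 1) + int k + int j))) =
    t ^ nat (excess n g + int n * int k) * cdet n d (\<lambda>q. g q + k)"
  unfolding vext_wt[OF n] cdet_def det_mat_expand sum_distrib_left
proof (rule sum.cong[OF refl])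
  fix \<sigma> assume "\<sigma> \<in> {\<sigma>. \<sigma> permutes {..<n}}"
  hence \<sigma>: "\<sigma> permutes {..<n}" by simp
  let ?s = "\<lambda>q. int (g q) - (int n - 1) + int k + int (\<sigma> q)"
  let ?c = "\<lambda>q. real ((g q + k + \<sigma> q + d) choose (n - 1 + d))"
  have sum: "(\<Sum>q<n. ?s q) = excess n g + int n * int k"
    using sum.permute[OF \<sigma>, of int] by (simp add: excess_def sum.distrib sum_subtractf comp_def algebra_simps)
  have "(\<Prod>q<n. ?c q * t ^ nat (?s q)) = t ^ nat (excess n g + int n * int k) * (\<Prod>q<n. ?c q)"
  proof (cases "\<exists>q<n. ?s q < 0")
    case True
    then obtain q where q: "q < n" "?s q < 0" by blast
    hence "g q + k + \<sigma> q + d < n - 1 + d" by linarith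
    hence "?c q = 0" by (simp add: binomial_eq_0)
    hence "(\<Prod>q<n. ?c q) = 0" using q by (intro prod_zero) auto
    thus ?thesis by (simp add: prod.distrib)
  next
    case False
    hence nn: "0 \<le> ?s q" if "q < n" for q using that by (meson not_less)
    have "int (\<Sum>q<n. nat (?s q)) = (\<Sum>q<n. ?s q)"
      unfolding of_nat_sum by (intro sum.cong refl) (use nn in simp)
    hence "(\<Sum>q<n. nat (?s q)) = nat (excess n g + int n * int k)" unfolding sum by linarith
    thus ?thesis by (simp add: prod.distrib power_sum[symmetric])
  qed
  thus "of_int (sign \<sigma>) * (\<Prod>q<n. ?c q * t ^ nat (?s q)) =
    t ^ nat (excess n g + int n * int k) * (of_int (sign \<sigma>) * (\<Prod>q<n. ?c q))" by simp
qed

text \<open>A negative total forces a negative index in every permutation term of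
  \<open>cdet n 0 g\<close>, so this determinant is 0; \<open>ckappa n 0\<close> is nonzero and
  carries the conclusion to \<open>bdet\<close>.\<close>

lemma bdet_excess_neg:
  assumes n: "n > 0" and e: "excess n g < 0"
  shows "bdet n g = 0"
proof -
  have "cdet n 0 g = 0"
    unfolding cdet_def det_mat_expand
  proof (rule sum.neutral, rule ballI)
    fix \<sigma> assume "\<sigma> \<in> {\<sigma>. \<sigma> permutes {..<n}}"
    hence \<sigma>: "\<sigma> permutes {..<n}" by simp
    have "(\<Sum>q<n. int (g q) - (int n - 1) + int (\<sigma> q)) < 0"
      using e sum.permute[OF \<sigma>, of int] by (simp add: excess_def sum.distrib comp_def)
    then obtain q where q: "q < n" "int (g q) - (int n - 1) + int (\<sigma> q) < 0"
      by (meson lessThan_iff not_less sum_nonneg)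
    hence "g q + \<sigma> q + 0 < n - 1 + 0" by linarith
    hence "real ((g q + \<sigma> q + 0) choose (n - 1 + 0)) = 0" by (simp add: binomial_eq_0)
    hence "(\<Prod>q<n. real ((g q + \<sigma> q + 0) choose (n - 1 + 0))) = 0" using q by (intro prod_zero) auto
    thus "of_int (sign \<sigma>) * (\<Prod>q<n. real ((g q + \<sigma> q + 0) choose (n - 1 + 0))) = 0" by simp
  qed
  hence "bdet n g * ckappa n 0 = 0" unfolding cdet_eq by simp
  moreover have "ckappa n 0 \<noteq> 0" using ckappa_0_sq[of n] by auto
  ultimately show ?thesis by simp
qed

text \<open>The Toeplitz determinant with symbol \<open>toep u v\<close> at \<open>k2 - k1\<close>, its defining series cut off at \<open>P\<close>; the
  summation index is shifted by \<open>n - 1\<close> so that it runs over natural numbers for all entries.\<close>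

definition btr :: "(nat \<Rightarrow> real) \<Rightarrow> (nat \<Rightarrow> real) \<Rightarrow> nat \<Rightarrow> nat \<Rightarrow> nat \<Rightarrow> nat \<Rightarrow> real" where
  "btr u v n P k1 k2 = Determinant.det (mat n n (\<lambda>(j, l). \<Sum>p<P.
     vext u (int p - (int n - 1) + int k1 + int j) * vext v (int p - (int n - 1) + int k2 + int l)))"

lemma btr_eq:
  assumes n: "n > 0"
  shows "fact n * btr (wt (n + d) t) (wt (n + d) t') n P k1 k2 =
    (\<Sum>g\<in>{..<n} \<rightarrow>\<^sub>E {..<P}. t ^ nat (excess n g + int n * int k1) * cdet n d (\<lambda>q. g q + k1) *
      (t' ^ nat (excess n g + int n * int k2) * cdet n d (\<lambda>q. g q + k2)))"
  unfolding btr_def andreief[of n "\<lambda>j p. vext (wt (n + d) t) (int p - (int n - 1) + int k1 + int j)"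
      "\<lambda>l p. vext (wt (n + d) t') (int p - (int n - 1) + int k2 + int l)" P] det_vext_wt[OF n] ..

text \<open>Each term of the expansion contains two shifted determinants, both nonnegative multiples
  of the same \<open>cdet n d g\<close>. The term is therefore a nonnegative multiple of a square
  and can be compared with its unshifted counterpart.\<close>

lemma btr_bounds:
  assumes n: "n > 0" and t: "0 \<le> t" "0 \<le> t'"
  shows "0 \<le> btr (wt (n + d) t) (wt (n + d) t') n P k1 k2"
    and "btr (wt (n + d) t) (wt (n + d) t') n P k1 k2 \<le>
      real ((n + d) choose d) ^ (k1 + k2) * t ^ (n * k1) * t' ^ (n * k2) * btr (wt (n + d) t) (wt (n + d) t') n P 0 0"
proof -
  let ?b = "btr (wt (n + d) t) (wt (n + d) t') n P"
  let ?Q = "real ((n + d) choose d) ^ (k1 + k2) * t ^ (n * k1) * t' ^ (n * k2)"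
  define X where "X k1 k2 g = t ^ nat (excess n g + int n * int k1) * cdet n d (\<lambda>q. g q + k1) *
      (t' ^ nat (excess n g + int n * int k2) * cdet n d (\<lambda>q. g q + k2))" for k1 k2 g
  have X: "0 \<le> X k1 k2 g \<and> X k1 k2 g \<le> ?Q * X 0 0 g" for g
  \<comment> \<open>Outside this case \<open>bdet\<close>, and with it every shifted determinant, is
    0. Inside it the shift can be taken out of the rounded exponent.\<close>
  proof (cases "inj_on g {..<n} \<and> 0 \<le> excess n g")
    case True
    define e where "e = nat (excess n g)"
    have e: "nat (excess n g + int n * int k) = e + n * k" for k
      using True by (simp add: e_def nat_add_distrib nat_mult_distrib)
    obtain R1 where R1: "0 \<le> R1" "R1 \<le> real ((n + d) choose d) ^ k1" "cdet n d (\<lambda>q. g q + k1) = R1 * cdet n d g"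
      using cdet_shift[of g n d k1] True by blast
    obtain R2 where R2: "0 \<le> R2" "R2 \<le> real ((n + d) choose d) ^ k2" "cdet n d (\<lambda>q. g q + k2) = R2 * cdet n d g"
      using cdet_shift[of g n d k2] True by blast
    define Y where "Y = t ^ e * t' ^ e * (cdet n d g)\<^sup>2"
    have Y: "Y \<ge> 0" using t by (simp add: Y_def)
    have "X k1 k2 g = (R1 * R2) * (t ^ (n * k1) * t' ^ (n * k2) * Y)"
      unfolding X_def e R1(3) R2(3) Y_def by (simp add: power_add power2_eq_square mult_ac)
    moreover have "X 0 0 g = Y"
      unfolding X_def e Y_def by (simp add: power2_eq_square mult_ac)
    moreover have "R1 * R2 \<le> real ((n + d) choose d) ^ (k1 + k2)"
      unfolding power_add using R1 R2 by (intro mult_mono) auto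
    moreover have "0 \<le> t ^ (n * k1) * t' ^ (n * k2) * Y" using t Y by simp
    ultimately have "X k1 k2 g \<le> real ((n + d) choose d) ^ (k1 + k2) * (t ^ (n * k1) * t' ^ (n * k2) * X 0 0 g)" "0 \<le> X k1 k2 g"
      using R1(1) R2(1) by (simp_all add: mult_right_mono)
    thus ?thesis by (simp only: mult.assoc simp_thms)
  next
    case False
    have b: "bdet n g = 0"
    proof (cases "inj_on g {..<n}")
      case True
      thus ?thesis using False n by (intro bdet_excess_neg) auto
    next
      case False
      thus ?thesis by (auto simp: inj_on_def intro: bdet_not_inj)
    qed
    have "bdet n (\<lambda>q. g q + k) = 0" for k
    proof (induction k)
      case (Suc k)
      thus ?case using bdet_Suc[of n "\<lambda>q. g q + k"] by simp
    qed (use b in simp)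
    hence "cdet n d (\<lambda>q. g q + k) = 0" for k unfolding cdet_eq by simp
    hence "X k1 k2 g = 0" for k1 k2 unfolding X_def by (simp only: mult_zero_right)
    thus ?thesis by (simp only: mult_zero_right order_refl simp_thms)
  qed
  have b: "fact n * ?b k1 k2 = (\<Sum>g\<in>{..<n} \<rightarrow>\<^sub>E {..<P}. X k1 k2 g)"
    "fact n * ?b 0 0 = (\<Sum>g\<in>{..<n} \<rightarrow>\<^sub>E {..<P}. X 0 0 g)"
    unfolding X_def by (rule btr_eq[OF n])+
  have "0 \<le> fact n * ?b k1 k2" unfolding b using X by (intro sum_nonneg) blast
  thus "0 \<le> ?b k1 k2" by (intro mult_left_le_imp_le[of "fact n" 0]) simp_all
  have "fact n * ?b k1 k2 \<le> ?Q * (fact n * ?b 0 0)"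
    unfolding b sum_distrib_left using X by (intro sum_mono) blast
  hence "fact n * ?b k1 k2 \<le> fact n * (?Q * ?b 0 0)" by (simp only: mult_ac)
  thus "?b k1 k2 \<le> ?Q * ?b 0 0" by (rule mult_left_le_imp_le) simp
qed

text \<open>The term \<open>p = 0\<close> only contributes to the last diagonal entry.\<close>

lemma btr_rec:
  assumes uv: "u 0 = 1" "v 0 = 1"
  shows "btr u v (Suc n) (Suc P) 0 0 = btr u v (Suc n) P 1 1 + btr u v n P 0 0"
proof -
  define G where "G = mat (Suc n) (Suc n) (\<lambda>(j, l). \<Sum>p<Suc P.
     vext u (int p - (int (Suc n) - 1) + int 0 + int j) * vext v (int p - (int (Suc n) - 1) + int 0 + int l))"
  define H where "H = mat (Suc n) (Suc n) (\<lambda>(j, l). \<Sum>p<P.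
     vext u (int p - (int (Suc n) - 1) + int 1 + int j) * vext v (int p - (int (Suc n) - 1) + int 1 + int l))"
  have G: "G \<in> carrier_mat (Suc n) (Suc n)" and H: "H \<in> carrier_mat (Suc n) (Suc n)" by (simp_all add: G_def H_def)
  have GH: "G $$ (j, l) = (if j = n \<and> l = n then 1 else 0) + H $$ (j, l)" if "j < Suc n" "l < Suc n" for j l
  proof -
    have "G $$ (j, l) = vext u (int j - int n) * vext v (int l - int n) + H $$ (j, l)"
      using that unfolding G_def H_def by (simp add: sum.lessThan_Suc_shift algebra_simps del: sum.lessThan_Suc)
    moreover have "vext u (int j - int n) * vext v (int l - int n) = (if j = n \<and> l = n then 1 else 0)"
      using that uv by (auto simp: vext_def)
    ultimately show ?thesis by simp
  qed
  have del: "mat_delete G n l = mat_delete H n l" if "l < Suc n" for l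
    using G H that by (intro eq_matI) (auto simp: mat_delete_def GH)
  have "Determinant.det G = (\<Sum>l<Suc n. G $$ (n, l) * cofactor G n l)"
    by (rule laplace_expansion_row[OF G]) simp
  also have "\<dots> = (\<Sum>l<Suc n. H $$ (n, l) * cofactor H n l + (if l = n then cofactor H n n else 0))"
    by (intro sum.cong refl) (auto simp: GH cofactor_def del algebra_simps)
  also have "\<dots> = Determinant.det H + cofactor H n n"
    unfolding sum.distrib using laplace_expansion_row[OF H, of n] by simp
  also have "cofactor H n n = btr u v n P 0 0"
  proof -
    have "mat_delete H n n = mat n n (\<lambda>(j, l). \<Sum>p<P.
     vext u (int p - (int n - 1) + int 0 + int j) * vext v (int p - (int n - 1) + int 0 + int l))"
      by (rule eq_matI) (auto simp: mat_delete_def H_def algebra_simps)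
    thus ?thesis by (simp add: cofactor_def btr_def)
  qed
  finally show ?thesis unfolding btr_def G_def H_def .
qed

lemma sums_int_shift:
  fixes F :: "int \<Rightarrow> real"
  assumes S: "(\<lambda>p. F (int p)) sums S" and z: "\<And>i. i < 0 \<or> i < - c \<Longrightarrow> F i = 0"
  shows "(\<lambda>p. F (int p - c)) sums S"
proof (cases "c \<ge> 0")
  case True
  define k where "k = nat c"
  have c: "c = int k" using True by (simp add: k_def)
  have "(\<lambda>p. F (int (p + k) - c)) sums (S - (\<Sum>p<k. F (int p - c)))"
    using S z c by (simp add: sum.neutral)
  thus ?thesis using sums_iff_shift'[of "\<lambda>p. F (int p - c)" k S] by simp
next
  case False
  define k where "k = nat (- c)"
  have c: "c = - int k" using False by (simp add: k_def)
  have "(\<lambda>p. F (int (p + k))) sums (S - (\<Sum>p<k. F (int p)))"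
    using sums_iff_shift'[of "\<lambda>p. F (int p)" k S] S by simp
  moreover have "(\<Sum>p<k. F (int p)) = 0" using z c by (intro sum.neutral) auto
  ultimately show ?thesis by (simp add: c)
qed

text \<open>If one shift is 0, every term with p < 0 has a negative index in one factor, so starting
  at p = 0 loses nothing. For k1 = k2 = 1 the corner entry does lose its term p = -1, and this is
  the gap measured by \<open>btr_rec\<close>.\<close>

lemma btr_tendsto:
  assumes s: "\<And>s. summable (\<lambda>m. u m * vext v (int m + s))" and k: "k1 = 0 \<or> k2 = 0"
  shows "(\<lambda>P. btr u v n P k1 k2) \<longlonglongrightarrow> toep_det n (toep u v) (int k2 - int k1)"
proof -
  have "(\<lambda>P. \<Sum>p<P. vext u (int p - (int n - 1) + int k1 + int j) * vext v (int p - (int n - 1) + int k2 + int l))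
    \<longlonglongrightarrow> toep u v (int k2 - int k1 - int j + int l)" if jl: "j < n" "l < n" for j l
  proof -
    let ?s = "int k2 - int k1 - int j + int l"
    let ?c = "int n - 1 - int k1 - int j"
    define F where "F i = vext u i * vext v (i + ?s)" for i
    have "(\<lambda>m. u m * vext v (int m + ?s)) sums toep u v ?s"
      unfolding toep_def using s by (rule summable_sums)
    hence "(\<lambda>p. F (int p)) sums toep u v ?s" by (simp add: F_def vext_def[of u])
    hence "(\<lambda>p. F (int p - ?c)) sums toep u v ?s"
    proof (rule sums_int_shift)
      fix i assume "i < 0 \<or> i < - ?c"
      hence "i < 0 \<or> i + ?s < 0" using k jl by auto
      thus "F i = 0" by (auto simp: F_def vext_def)
    qed
    moreover have "F (int p - ?c) = vext u (int p - (int n - 1) + int k1 + int j) * vext v (int p - (int n - 1) + int k2 + int l)" for p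
      unfolding F_def by (simp add: algebra_simps)
    ultimately show ?thesis by (simp add: sums_def)
  qed
  thus ?thesis unfolding btr_def toep_det_def det_mat_expand
    by (intro tendsto_sum tendsto_mult tendsto_const tendsto_prod) (auto dest: permutes_in_image)
qed

section \<open>Negative binomial series\<close>

lemma wt_nonneg: "0 \<le> t \<Longrightarrow> 0 \<le> wt a t m"
  by (simp add: wt_def)

lemma negbin_Suc:
  fixes w :: "'a :: real_normed_field"
  shows "(\<Sum>i\<le>m. (of_nat ((i + a) choose a) * w ^ i) * w ^ (m - i)) = of_nat ((m + Suc a) choose Suc a) * w ^ m"
proof -
  have "(\<Sum>i\<le>m. (of_nat ((i + a) choose a) * w ^ i) * w ^ (m - i)) = (\<Sum>i\<le>m. of_nat ((i + a) choose a) * w ^ m)"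
    by (intro sum.cong refl) (simp add: mult.assoc flip: power_add)
  also have "\<dots> = of_nat (\<Sum>i\<le>m. (i + a) choose a) * w ^ m" by (simp add: sum_distrib_right)
  also have "(\<Sum>i\<le>m. (i + a) choose a) = (m + Suc a) choose Suc a"
    using choose_rising_sum(1)[of a m] by (simp add: add.commute)
  finally show ?thesis .
qed

text \<open>Induction by a Cauchy product with the geometric series. The real case comes first
  because it supplies the absolute convergence for the complex one.\<close>

lemma negbin_sums_real:
  fixes w :: real
  assumes "0 \<le> w" "w < 1"
  shows "(\<lambda>m. of_nat ((m + a) choose a) * w ^ m) sums (1 / (1 - w) ^ Suc a)"
proof (induction a)
  case 0
  show ?case using geometric_sums[of w] assms by simp
next
  case (Suc a)
  have 1: "summable (\<lambda>m. norm (of_nat ((m + a) choose a) * w ^ m))"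
    using sums_summable[OF Suc] assms by simp
  have 2: "summable (\<lambda>m. norm (w ^ m))" using assms by (simp add: summable_geometric)
  have "(\<lambda>m. \<Sum>i\<le>m. (of_nat ((i + a) choose a) * w ^ i) * w ^ (m - i)) sums
    ((\<Sum>m. of_nat ((m + a) choose a) * w ^ m) * (\<Sum>m. w ^ m))"
    by (rule Cauchy_product_sums[OF 1 2])
  moreover have "(\<Sum>m. of_nat ((m + a) choose a) * w ^ m) * (\<Sum>m. w ^ m) = 1 / (1 - w) ^ Suc (Suc a)"
    unfolding sums_unique[OF Suc, symmetric] using assms by (simp add: suminf_geometric mult.commute)
  ultimately show ?case unfolding negbin_Suc by simp
qed

lemma negbin_sums:
  fixes w :: complex
  assumes "norm w < 1"
  shows "(\<lambda>m. of_nat ((m + a) choose a) * w ^ m) sums (1 / (1 - w) ^ Suc a)"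
proof (induction a)
  case 0
  show ?case using geometric_sums[of w] assms by simp
next
  case (Suc a)
  have 1: "summable (\<lambda>m. norm (of_nat ((m + a) choose a) * w ^ m))"
    using sums_summable[OF negbin_sums_real[of "norm w" a]] assms by (simp add: norm_mult norm_power)
  have 2: "summable (\<lambda>m. norm (w ^ m))" using assms by (simp add: summable_geometric norm_power)
  have "(\<lambda>m. \<Sum>i\<le>m. (of_nat ((i + a) choose a) * w ^ i) * w ^ (m - i)) sums
    ((\<Sum>m. of_nat ((m + a) choose a) * w ^ m) * (\<Sum>m. w ^ m))"
    by (rule Cauchy_product_sums[OF 1 2])
  moreover have "(\<Sum>m. of_nat ((m + a) choose a) * w ^ m) * (\<Sum>m. w ^ m) = 1 / (1 - w) ^ Suc (Suc a)"
    unfolding sums_unique[OF Suc, symmetric] using assms by (simp add: suminf_geometric mult.commute)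
  ultimately show ?case unfolding negbin_Suc by simp
qed

text \<open>The constant is the sum of the series with ratio t / s, which dominates each of its
  nonnegative terms; multiplying by s^m restores t.\<close>

lemma wt_le_geometric:
  assumes a: "a > 0" and t: "0 \<le> t" "t < s" and s: "s < 1"
  shows "wt a t m \<le> 1 / (1 - t / s) ^ a * s ^ m"
proof -
  have ts: "0 \<le> t / s" "t / s < 1" using t by simp_all
  have "(\<lambda>m. of_nat ((m + (a - 1)) choose (a - 1)) * (t / s) ^ m) sums (1 / (1 - t / s) ^ Suc (a - 1))"
    by (rule negbin_sums_real[OF ts])
  hence S: "wt a (t / s) sums (1 / (1 - t / s) ^ a)"
    using a unfolding wt_def by simp
  have "(\<Sum>i\<in>{m}. wt a (t / s) i) \<le> (\<Sum>i. wt a (t / s) i)"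
    by (rule sum_le_suminf[OF sums_summable[OF S]]) (use wt_nonneg[OF ts(1)] in simp_all)
  hence "wt a (t / s) m \<le> 1 / (1 - t / s) ^ a" using sums_unique[OF S] by simp
  hence "wt a (t / s) m * s ^ m \<le> 1 / (1 - t / s) ^ a * s ^ m" using t by (intro mult_right_mono) auto
  moreover have "wt a (t / s) m * s ^ m = wt a t m" using t by (simp add: wt_def power_divide)
  ultimately show ?thesis by simp
qed

lemma wt_bound:
  assumes a: "a > 0" and t: "0 \<le> t" "t < 1" "0 \<le> t'" "t' < 1"
  obtains C r where "0 < r" "r < 1" "0 \<le> C" "\<And>m. \<bar>wt a t m\<bar> \<le> C * r ^ (2 * m)" "\<And>m. \<bar>wt a t' m\<bar> \<le> C * r ^ (2 * m)"
proof -
  \<comment> \<open>The midpoint between the larger parameter and 1; r is its square root because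
    the bounds are stated with r^(2m).\<close>
  define s where "s = (1 + max t t') / 2"
  have s: "t < s" "t' < s" "s < 1" "0 < s" using t by (auto simp: s_def)
  define r where "r = sqrt s"
  have r: "0 < r" "r < 1" "r ^ (2 * m) = s ^ m" for m
    using s by (simp_all add: r_def power_mult)
  define C where "C = max (1 / (1 - t / s) ^ a) (1 / (1 - t' / s) ^ a)"
  have C: "1 / (1 - t / s) ^ a \<le> C" "1 / (1 - t' / s) ^ a \<le> C" by (simp_all add: C_def)
  have C0: "0 \<le> C" by (rule order_trans[OF _ C(1)]) (use s t in simp)
  have "\<bar>wt a t m\<bar> \<le> C * r ^ (2 * m)" for m
  proof -
    have "wt a t m \<le> 1 / (1 - t / s) ^ a * s ^ m" by (rule wt_le_geometric[OF a t(1) s(1,3)])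
    also have "\<dots> \<le> C * s ^ m" using C s by (intro mult_right_mono) auto
    finally show ?thesis using wt_nonneg[OF t(1)] by (simp add: r(3))
  qed
  moreover have "\<bar>wt a t' m\<bar> \<le> C * r ^ (2 * m)" for m
  proof -
    have "wt a t' m \<le> 1 / (1 - t' / s) ^ a * s ^ m" by (rule wt_le_geometric[OF a t(3) s(2,3)])
    also have "\<dots> \<le> C * s ^ m" using C s by (intro mult_right_mono) auto
    finally show ?thesis using wt_nonneg[OF t(3)] by (simp add: r(3))
  qed
  ultimately show ?thesis using that r(1,2) C0 by blast
qed

text \<open>Writing x = y^2 gives each binomial factor its own y^p; one product is bounded and the
  other is summable.\<close>

lemma summable_choose_choose:
  assumes x: "0 \<le> x" "x < (1::real)"
  shows "summable (\<lambda>p. real (p choose j) * real (p choose l) * x ^ p)"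
proof -
  define y where "y = sqrt x"
  have y: "0 \<le> y" "y < 1" "x = y * y" using x by (simp_all add: y_def)
  have s: "summable (\<lambda>p. real ((p + k) choose k) * y ^ p)" for k
    using sums_summable[OF negbin_sums_real[OF y(1,2), of k]] by simp
  define K where "K = (\<Sum>p. real ((p + j) choose j) * y ^ p)"
  have K: "real ((p + j) choose j) * y ^ p \<le> K" for p
    using sum_le_suminf[OF s[of j], of "{p}"] y by (simp add: K_def)
  show ?thesis
  proof (rule summable_comparison_test'[OF summable_mult[OF s[of l], of K], of 0])
    fix p :: nat
    have "real (p choose j) * real (p choose l) * x ^ p = (real (p choose j) * y ^ p) * (real (p choose l) * y ^ p)"
      by (simp add: y(3) power_mult_distrib mult_ac)
    also have "\<dots> \<le> (real ((p + j) choose j) * y ^ p) * (real ((p + l) choose l) * y ^ p)"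
      using y by (intro mult_mono mult_right_mono) (auto intro!: binomial_right_mono simp: of_nat_le_iff)
    also have "\<dots> \<le> K * (real ((p + l) choose l) * y ^ p)"
      using K y by (intro mult_right_mono) auto
    finally show "norm (real (p choose j) * real (p choose l) * x ^ p) \<le> K * (real ((p + l) choose l) * y ^ p)"
      using x by simp
  qed
qed

text \<open>With \<open>y = x / (1 - x)\<close>, the matrix of sums \<open>\<Sum>p. (p choose j) * (p choose l) * x ^ p\<close> has the
  decomposition \<open>L D L\<^sup>T\<close> with \<open>L = lfac y\<close>.\<close>

definition lfac :: "real \<Rightarrow> nat \<Rightarrow> nat \<Rightarrow> real" where
  "lfac y j r = real (j choose r) * y ^ (j - r)"

definition ldl :: "real \<Rightarrow> nat \<Rightarrow> nat \<Rightarrow> nat \<Rightarrow> real" where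
  "ldl y R j l = (\<Sum>r\<le>R. (y * (1 + y)) ^ r * lfac y j r * lfac y l r)"

lemma lfac_eq_0: "j < r \<Longrightarrow> lfac y j r = 0"
  by (simp add: lfac_def binomial_eq_0)

lemma lfac_Suc: "lfac y (Suc j) (Suc r) = y * lfac y j (Suc r) + lfac y j r" "lfac y (Suc j) 0 = y * lfac y j 0"
proof -
  have "real (j choose Suc r) * y ^ (j - r) = y * (real (j choose Suc r) * y ^ (j - Suc r))"
  proof (cases "r < j")
    case True
    hence "j - r = Suc (j - Suc r)" by simp
    thus ?thesis by simp
  qed (simp add: binomial_eq_0)
  thus "lfac y (Suc j) (Suc r) = y * lfac y j (Suc r) + lfac y j r" by (simp add: lfac_def algebra_simps)
  show "lfac y (Suc j) 0 = y * lfac y j 0" by (simp add: lfac_def)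
qed

lemma ldl_Suc_split: "ldl y (Suc R) j l = lfac y j 0 * lfac y l 0 +
   (y * (1 + y)) * (\<Sum>r\<le>R. (y * (1 + y)) ^ r * lfac y j (Suc r) * lfac y l (Suc r))"
  unfolding ldl_def sum.atMost_Suc_shift by (simp add: sum_distrib_left mult.assoc)

text \<open>The three-term recurrence satisfied by the moments in
  \<open>suminf_choose_choose\<close>. The hypothesis on j makes the last summand of row j vanish,
  so that cutting the sum at R or at R + 1 gives the same value.\<close>

lemma ldl_rec:
  assumes "j \<le> R"
  shows "ldl y (Suc R) (Suc j) (Suc l) = y * (ldl y (Suc R) j (Suc l) + ldl y (Suc R) (Suc j) l + ldl y (Suc R) j l)"
proof -
  define b where "b = y * (1 + y)"
  define s1 where "s1 = (\<Sum>r\<le>R. b ^ r * lfac y j (Suc r) * lfac y l (Suc r))"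
  define s2 where "s2 = (\<Sum>r\<le>R. b ^ r * lfac y j (Suc r) * lfac y l r)"
  define s3 where "s3 = (\<Sum>r\<le>R. b ^ r * lfac y j r * lfac y l (Suc r))"
  define s4 where "s4 = (\<Sum>r\<le>R. b ^ r * lfac y j r * lfac y l r)"
  define c0 where "c0 = lfac y j 0 * lfac y l 0"
  note defs = s1_def s2_def s3_def s4_def
  have e0: "ldl y (Suc R) j l = c0 + b * s1"
    unfolding ldl_Suc_split b_def[symmetric] s1_def c0_def ..
  have "ldl y (Suc R) j l = s4"
    unfolding ldl_def s4_def b_def[symmetric] using assms by (simp add: lfac_eq_0)
  with e0 have s4: "s4 = c0 + b * s1" by simp
  have e1: "ldl y (Suc R) j (Suc l) = y * c0 + b * (y * s1 + s2)"
    unfolding ldl_Suc_split b_def[symmetric] defs c0_def lfac_Suc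
    by (simp add: sum_distrib_left sum.distrib algebra_simps)
  have e2: "ldl y (Suc R) (Suc j) l = y * c0 + b * (y * s1 + s3)"
    unfolding ldl_Suc_split b_def[symmetric] defs c0_def lfac_Suc
    by (simp add: sum_distrib_left sum.distrib algebra_simps)
  have e3: "ldl y (Suc R) (Suc j) (Suc l) = y * y * c0 + b * (y * y * s1 + y * s2 + y * s3 + s4)"
    unfolding ldl_Suc_split b_def[symmetric] defs c0_def lfac_Suc
    by (simp add: sum_distrib_left sum.distrib algebra_simps)
  have "y * y * c0 + b * (y * y * s1 + y * s2 + y * s3 + (c0 + b * s1)) =
      y * ((y * c0 + b * (y * s1 + s2)) + (y * c0 + b * (y * s1 + s3)) + (c0 + b * s1))"
    unfolding b_def by (simp add: algebra_simps)
  thus ?thesis unfolding e0 e1 e2 e3 s4 .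
qed

text \<open>Dropping the term p = 0 and applying Pascal's rule to both binomials gives S = x (S +
  lower moments), that is S = y times the lower moments. Both sides then obey the same recurrence
  and boundary values.\<close>

lemma suminf_choose_choose:
  assumes x: "0 \<le> x" "x < 1" and j: "j \<le> R"
  shows "(\<Sum>p. real (p choose j) * real (p choose l) * x ^ p) = ldl (x / (1 - x)) (Suc R) j l / (1 - x)"
proof -
  define f where "f j l p = real (p choose j) * real (p choose l) * x ^ p" for j l p
  define S where "S j l = (\<Sum>p. f j l p)" for j l
  define y where "y = x / (1 - x)"
  have sm: "summable (f j l)" for j l unfolding f_def by (rule summable_choose_choose[OF x])
  have solve: "a = y * b" if "a = x * (a + b)" for a b
    using that x by (simp add: y_def field_simps)
  have S00: "S 0 0 = 1 / (1 - x)" using suminf_geometric[of x] x by (simp add: S_def f_def)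
  have shift: "S j l = (\<Sum>p. f j l (Suc p))" if "f j l 0 = 0" for j l
    using suminf_split_head[OF sm, of j l] that by (simp add: S_def)
  have Sj0: "S (Suc j) 0 = y * S j 0" for j
  proof (rule solve)
    have "f (Suc j) 0 (Suc p) = x * (f (Suc j) 0 p + f j 0 p)" for p by (simp add: f_def algebra_simps)
    hence "(\<Sum>p. f (Suc j) 0 (Suc p)) = x * (S (Suc j) 0 + S j 0)"
      using sm by (simp add: S_def suminf_mult suminf_add summable_add)
    thus "S (Suc j) 0 = x * (S (Suc j) 0 + S j 0)" using shift[of "Suc j" 0] by (simp add: f_def)
  qed
  have S0l: "S 0 (Suc l) = y * S 0 l" for l
  proof (rule solve)
    have "f 0 (Suc l) (Suc p) = x * (f 0 (Suc l) p + f 0 l p)" for p by (simp add: f_def algebra_simps)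
    hence "(\<Sum>p. f 0 (Suc l) (Suc p)) = x * (S 0 (Suc l) + S 0 l)"
      using sm by (simp add: S_def suminf_mult suminf_add summable_add)
    thus "S 0 (Suc l) = x * (S 0 (Suc l) + S 0 l)" using shift[of 0 "Suc l"] by (simp add: f_def)
  qed
  have Sjl: "S (Suc j) (Suc l) = y * (S j (Suc l) + S (Suc j) l + S j l)" for j l
  proof (rule solve)
    have "f (Suc j) (Suc l) (Suc p) = x * (f (Suc j) (Suc l) p + (f j (Suc l) p + f (Suc j) l p + f j l p))" for p
      by (simp add: f_def algebra_simps)
    hence "(\<Sum>p. f (Suc j) (Suc l) (Suc p)) = x * (S (Suc j) (Suc l) + (S j (Suc l) + S (Suc j) l + S j l))"
      using sm by (simp add: S_def suminf_mult suminf_add summable_add)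
    thus "S (Suc j) (Suc l) = x * (S (Suc j) (Suc l) + (S j (Suc l) + S (Suc j) l + S j l))"
      using shift[of "Suc j" "Suc l"] by (simp add: f_def)
  qed
  have l0: "ldl y (Suc R) 0 l = y ^ l" for l
    unfolding ldl_Suc_split by (simp add: lfac_def)
  have j0: "ldl y (Suc R) j 0 = y ^ j" for j
    unfolding ldl_Suc_split by (simp add: lfac_def)
  have "S j l = ldl y (Suc R) j l / (1 - x)" using j
  proof (induction j arbitrary: l)
    case 0
    show ?case unfolding l0 by (induction l) (simp_all add: S00 S0l)
  next
    case (Suc j)
    have IH: "S j l = ldl y (Suc R) j l / (1 - x)" for l using Suc by simp
    show ?case
    proof (induction l)
      case 0
      show ?case using IH[of 0] by (simp add: Sj0 j0)
    next
      case (Suc l)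
      have "j \<le> R" using \<open>Suc j \<le> R\<close> by simp
      thus ?case unfolding Sjl ldl_rec[OF \<open>j \<le> R\<close>] IH Suc.IH by (simp add: add_divide_distrib[symmetric])
    qed
  qed
  thus ?thesis unfolding S_def f_def y_def .
qed

section \<open>Toeplitz determinants at shift zero\<close>

lemma wt_0 [simp]: "wt a t 0 = 1"
  by (simp add: wt_def)

lemma double_sum_int: "2 * (\<Sum>q<n. int q) = int n * (int n - 1)"
  by (induction n) (simp_all add: algebra_simps)

lemma toep_det_0_eq_1:
  assumes "\<And>s. f s = vext w s" "w 0 = 1"
  shows "toep_det n f 0 = 1"
proof -
  have "Determinant.det (transpose_mat (mat n n (\<lambda>(j, l). f (0 - int j + int l)))) = 1"
    by (rule det_unit_lower_triangular[of _ n]) (use assms in \<open>auto simp: vext_def\<close>)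
  thus ?thesis by (simp add: toep_det_def Determinant.det_transpose[of _ n])
qed

lemma toep_det_0_eq_1':
  assumes "\<And>s. f s = vext w (- s)" "w 0 = 1"
  shows "toep_det n f 0 = 1"
  unfolding toep_det_def
  by (rule det_unit_lower_triangular[of _ n]) (use assms in \<open>auto simp: vext_def\<close>)

lemma toep_delta_left:
  assumes "\<And>m. m > 0 \<Longrightarrow> u m = 0" "u 0 = 1"
  shows "toep u v s = vext v s"
proof -
  have "toep u v s = (\<Sum>m\<in>{0}. u m * vext v (int m + s))"
    unfolding toep_def by (rule suminf_finite) (use assms in auto)
  thus ?thesis using assms by simp
qed

lemma toep_delta_right:
  assumes "\<And>m. m > 0 \<Longrightarrow> v m = 0" "v 0 = 1"
  shows "toep u v s = vext u (- s)"
proof -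
  have "u m * vext v (int m + s) = (if int m = - s then u m else 0)" for m
    using assms(1)[of "nat (int m + s)"] assms(2) by (auto simp: vext_def)
  hence "toep u v s = (\<Sum>m. if int m = - s then u m else 0)" unfolding toep_def by simp
  also have "\<dots> = (\<Sum>m\<in>{nat (- s)}. if int m = - s then u m else 0)"
    by (rule suminf_finite) auto
  also have "\<dots> = vext u (- s)" by (auto simp: vext_def)
  finally show ?thesis .
qed

text \<open>Both outer factors of the decomposition are unit triangular, so the determinant is the
  product of the diagonal entries \<open>b ^ r / (1 - x)\<close> with b = x / (1 - x)^2.\<close>

lemma det_choose_moments:
  assumes x: "0 \<le> x" "x < 1"
  shows "Determinant.det (mat a a (\<lambda>(j, l). \<Sum>p. (x ^ p * real (p choose j)) * real (p choose l)))
    = x ^ (\<Sum>q<a. q) / (1 - x) ^ a\<^sup>2"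
proof -
  define y where "y = x / (1 - x)"
  define b where "b = y * (1 + y)"
  have b: "b = x / (1 - x)\<^sup>2" using x by (simp add: b_def y_def field_simps power2_eq_square)
  have "Determinant.det (mat a a (\<lambda>(j, l). \<Sum>p. (x ^ p * real (p choose j)) * real (p choose l))) =
    Determinant.det (mat a a (\<lambda>(j, l). \<Sum>r<a. lfac y j r * (b ^ r / (1 - x) * lfac y l r)))"
  proof (rule arg_cong[of _ _ Determinant.det], rule eq_matI, goal_cases)
    case (1 j l)
    hence jl: "j < a" "l < a" by simp_all
    have "(\<Sum>p. (x ^ p * real (p choose j)) * real (p choose l)) = (\<Sum>p. real (p choose j) * real (p choose l) * x ^ p)"
      by (simp add: mult_ac)
    also have "\<dots> = ldl y (Suc a) j l / (1 - x)"
      unfolding y_def using jl by (intro suminf_choose_choose x) simp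
    also have "ldl y (Suc a) j l = (\<Sum>r<a. b ^ r * lfac y j r * lfac y l r)"
      unfolding ldl_def b_def[symmetric]
      by (rule sum.mono_neutral_right) (use jl in \<open>auto simp: lfac_eq_0\<close>)
    finally have "(\<Sum>p. (x ^ p * real (p choose j)) * real (p choose l)) = (\<Sum>r<a. lfac y j r * (b ^ r / (1 - x) * lfac y l r))"
      unfolding sum_divide_distrib by (simp add: mult_ac)
    thus ?case using jl by simp
  qed simp_all
  also have "\<dots> = Determinant.det (mat a a (\<lambda>(j, r). lfac y j r)) * ((\<Prod>r<a. b ^ r / (1 - x)) * Determinant.det (mat a a (\<lambda>(r, l). lfac y l r)))"
    unfolding det_mat_factor det_mat_row_scale ..
  also have "Determinant.det (mat a a (\<lambda>(j, r). lfac y j r)) = 1"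
    by (rule det_unit_lower_triangular[of _ a]) (auto simp: lfac_eq_0, simp add: lfac_def)
  also have "Determinant.det (mat a a (\<lambda>(r, l). lfac y l r)) = 1"
  proof -
    have "Determinant.det (transpose_mat (mat a a (\<lambda>(r, l). lfac y l r))) = 1"
      by (rule det_unit_lower_triangular[of _ a]) (auto simp: lfac_eq_0, simp add: lfac_def)
    thus ?thesis by (simp add: Determinant.det_transpose[of _ a])
  qed
  also have "(\<Prod>r<a. b ^ r / (1 - x)) = b ^ (\<Sum>q<a. q) / (1 - x) ^ a"
    by (simp add: prod_dividef power_sum)
  also have "\<dots> = x ^ (\<Sum>q<a. q) / (1 - x) ^ (2 * (\<Sum>q<a. q) + a)"
    unfolding b by (simp add: power_divide power_mult power_add)
  also have "2 * (\<Sum>q<a. q) + a = a\<^sup>2"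
  proof -
    have "int (2 * (\<Sum>q<a. q) + a) = int (a\<^sup>2)"
      using double_sum_int[of a] by (simp add: power2_eq_square algebra_simps)
    thus ?thesis by linarith
  qed
  finally show ?thesis by simp
qed

lemma toep_summable_wt:
  assumes "a > 0" "0 \<le> t" "t < 1" "0 \<le> t'" "t' < 1"
  shows "summable (\<lambda>m. wt a t m * vext (wt a t') (int m + s))"
proof -
  obtain C r where Cr: "0 < r" "r < 1" "0 \<le> C" "\<And>m. \<bar>wt a t m\<bar> \<le> C * r ^ (2 * m)" "\<And>m. \<bar>wt a t' m\<bar> \<le> C * r ^ (2 * m)"
    using wt_bound[OF assms] by metis
  show ?thesis by (rule toep_bounds(1)[of "wt a t" C r "wt a t'", OF Cr(4,5,1,2,3)])
qed

text \<open>Here size and exponent agree, so d = 0 and the constant in \<open>cdet\<close> is a sign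
  that squares away. Up to the factor x^T the Andreief sum is that of the moment matrix of
  binomials. That factor has to be cancelled, which is why t t' = 0 is treated separately.\<close>

lemma toep_det_full:
  assumes a: "a > 0" and t: "0 \<le> t" "t < 1" "0 \<le> t'" "t' < 1"
  shows "toep_det a (toep (wt a t) (wt a t')) 0 = 1 / (1 - t * t') ^ a\<^sup>2"
proof (cases "t = 0 \<or> t' = 0")
  case True
  have w0: "wt a 0 m = 0" if "m > 0" for m using that by (simp add: wt_def)
  have "toep_det a (toep (wt a t) (wt a t')) 0 = 1"
  proof (cases "t = 0")
    case True
    show ?thesis unfolding True
      by (rule toep_det_0_eq_1[where w = "wt a t'"]) (simp_all add: toep_delta_left w0)
  next
    case False
    with \<open>t = 0 \<or> t' = 0\<close> have "t' = 0" by simp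
    show ?thesis unfolding \<open>t' = 0\<close>
      by (rule toep_det_0_eq_1'[where w = "wt a t"]) (simp_all add: toep_delta_right w0)
  qed
  thus ?thesis using True by auto
next
  case False
  define x where "x = t * t'"
  have x: "0 < x" "x < 1" using False t by (auto simp: x_def intro: mult_strict_mono[of t 1 t' 1, simplified])
  define T where "T = (\<Sum>q<a. q)"
  let ?b = "\<lambda>P. btr (wt a t) (wt a t') a P 0 0"
  let ?m = "\<lambda>P. Determinant.det (mat a a (\<lambda>(j, l). \<Sum>p<P. (x ^ p * real (p choose j)) * real (p choose l)))"
  have b: "x ^ T * ?b P = ?m P" for P
  proof -
    have "fact a * (x ^ T * ?b P) = x ^ T * (fact a * btr (wt (a + 0) t) (wt (a + 0) t') a P 0 0)" by simp
    also have "\<dots> = (\<Sum>g\<in>{..<a} \<rightarrow>\<^sub>E {..<P}. x ^ T * (t ^ nat (excess a g + int a * int 0) * cdet a 0 (\<lambda>q. g q + 0) *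
      (t' ^ nat (excess a g + int a * int 0) * cdet a 0 (\<lambda>q. g q + 0))))"
      unfolding btr_eq[OF a] sum_distrib_left ..
    also have "\<dots> = (\<Sum>g\<in>{..<a} \<rightarrow>\<^sub>E {..<P}. Determinant.det (mat a a (\<lambda>(q, j). x ^ g q * real (g q choose j))) * Determinant.det (mat a a (\<lambda>(q, l). real (g q choose l))))"
    proof (rule sum.cong[OF refl])
      fix g :: "nat \<Rightarrow> nat"
      have c: "cdet a 0 (\<lambda>q. g q + 0) = bdet a g * ckappa a 0" by (simp add: cdet_eq)
      have k: "ckappa a 0 * ckappa a 0 = 1" using ckappa_0_sq[of a] by (simp add: power2_eq_square)
      have "x ^ T * (t ^ nat (excess a g) * (bdet a g * ckappa a 0) * (t' ^ nat (excess a g) * (bdet a g * ckappa a 0)))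
        = x ^ (T + nat (excess a g)) * (bdet a g * bdet a g) * (ckappa a 0 * ckappa a 0)"
        by (simp add: x_def power_add power_mult_distrib mult_ac)
      also have "\<dots> = (\<Prod>q<a. x ^ g q) * bdet a g * bdet a g"
      \<comment> \<open>The exponent equals the sum of the \<open>g q\<close> only when the excess
        is nonnegative; otherwise \<open>bdet\<close> vanishes and both sides are 0.\<close>
      proof (cases "bdet a g = 0")
        case False
        hence "0 \<le> excess a g" using bdet_excess_neg[OF a, of g] by linarith
        moreover have "excess a g = (\<Sum>q<a. int (g q)) - int T"
          using double_sum_int[of a] by (simp add: excess_def T_def sum.distrib sum_subtractf)
        ultimately have "int (T + nat (excess a g)) = int (\<Sum>q<a. g q)" by simp
        hence "T + nat (excess a g) = (\<Sum>q<a. g q)" by (simp only: of_nat_eq_iff)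
        thus ?thesis by (simp add: k power_sum)
      qed simp
      finally show "x ^ T * (t ^ nat (excess a g + int a * int 0) * cdet a 0 (\<lambda>q. g q + 0) *
          (t' ^ nat (excess a g + int a * int 0) * cdet a 0 (\<lambda>q. g q + 0))) =
        Determinant.det (mat a a (\<lambda>(q, j). x ^ g q * real (g q choose j))) * Determinant.det (mat a a (\<lambda>(q, l). real (g q choose l)))"
        unfolding det_mat_row_scale c bdet_def[symmetric] by simp
    qed
    also have "\<dots> = fact a * ?m P"
      by (rule andreief[of a "\<lambda>j p. x ^ p * real (p choose j)" "\<lambda>l p. real (p choose l)" P, symmetric])
    finally show ?thesis by simp
  qed
  have "?b \<longlonglongrightarrow> toep_det a (toep (wt a t) (wt a t')) (int 0 - int 0)"
    by (rule btr_tendsto) (simp_all add: toep_summable_wt[OF a t])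
  hence 1: "(\<lambda>P. x ^ T * ?b P) \<longlonglongrightarrow> x ^ T * toep_det a (toep (wt a t) (wt a t')) 0"
    by (intro tendsto_mult tendsto_const) simp
  have "(\<lambda>P. \<Sum>p<P. (x ^ p * real (p choose j)) * real (p choose l)) \<longlonglongrightarrow> (\<Sum>p. (x ^ p * real (p choose j)) * real (p choose l))" for j l
  proof (rule summable_LIMSEQ)
    have "summable (\<lambda>p. real (p choose j) * real (p choose l) * x ^ p)" using x by (intro summable_choose_choose) auto
    thus "summable (\<lambda>p. (x ^ p * real (p choose j)) * real (p choose l))" by (simp add: mult_ac)
  qed
  hence 2: "?m \<longlonglongrightarrow> Determinant.det (mat a a (\<lambda>(j, l). \<Sum>p. (x ^ p * real (p choose j)) * real (p choose l)))"
    unfolding det_mat_expand by (intro tendsto_sum tendsto_mult tendsto_const tendsto_prod)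
  have "x ^ T * toep_det a (toep (wt a t) (wt a t')) 0 = x ^ T / (1 - x) ^ a\<^sup>2"
    using LIMSEQ_unique[OF 1[unfolded b] 2] det_choose_moments[of x a] x by (simp add: T_def)
  hence "x ^ T * toep_det a (toep (wt a t) (wt a t')) 0 = x ^ T * (1 / (1 - x) ^ a\<^sup>2)" by simp
  hence "toep_det a (toep (wt a t) (wt a t')) 0 = 1 / (1 - x) ^ a\<^sup>2"
    using x(1) by (simp only: mult_left_cancel power_eq_0_iff less_irrefl mult_cancel_left) auto
  thus ?thesis unfolding x_def .
qed

text \<open>Limits of \<open>btr_bounds\<close>, with the shifts (0, k) for positive and (k, 0) for
  negative arguments.\<close>

lemma toep_det_wt_bounds:
  fixes n d :: nat and t t' :: real
  assumes n: "n > 0" and t: "0 \<le> t" "t < 1" "0 \<le> t'" "t' < 1"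
  defines "T \<equiv> toep (wt (n + d) t) (wt (n + d) t')"
  shows "0 \<le> toep_det n T (int k)" "toep_det n T (int k) \<le> (real ((n + d) choose d) * t' ^ n) ^ k * toep_det n T 0"
    and "0 \<le> toep_det n T (- int k)" "toep_det n T (- int k) \<le> (real ((n + d) choose d) * t ^ n) ^ k * toep_det n T 0"
proof -
  let ?b = "btr (wt (n + d) t) (wt (n + d) t') n"
  have nd: "n + d > 0" using n by simp
  have lim: "(\<lambda>P. ?b P k1 k2) \<longlonglongrightarrow> toep_det n T (int k2 - int k1)" if "k1 = 0 \<or> k2 = 0" for k1 k2
    unfolding T_def by (rule btr_tendsto[OF toep_summable_wt[OF nd t] that])
  have l0: "(\<lambda>P. ?b P 0 0) \<longlonglongrightarrow> toep_det n T 0" using lim[of 0 0] by simp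
  have lk: "(\<lambda>P. ?b P 0 k) \<longlonglongrightarrow> toep_det n T (int k)" using lim[of 0 k] by simp
  have lk': "(\<lambda>P. ?b P k 0) \<longlonglongrightarrow> toep_det n T (- int k)" using lim[of k 0] by simp
  note bb = btr_bounds[OF n t(1,3)]
  show "0 \<le> toep_det n T (int k)" by (rule LIMSEQ_le_const[OF lk]) (use bb(1) in blast)
  show "0 \<le> toep_det n T (- int k)" by (rule LIMSEQ_le_const[OF lk']) (use bb(1) in blast)
  show "toep_det n T (int k) \<le> (real ((n + d) choose d) * t' ^ n) ^ k * toep_det n T 0"
  proof (rule LIMSEQ_le[OF lk tendsto_mult[OF tendsto_const l0]], intro exI allI impI)
    fix P :: nat
    show "?b P 0 k \<le> (real ((n + d) choose d) * t' ^ n) ^ k * ?b P 0 0"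
      using bb(2)[of d P 0 k] by (simp add: power_mult power_mult_distrib)
  qed
  show "toep_det n T (- int k) \<le> (real ((n + d) choose d) * t ^ n) ^ k * toep_det n T 0"
  proof (rule LIMSEQ_le[OF lk' tendsto_mult[OF tendsto_const l0]], intro exI allI impI)
    fix P :: nat
    show "?b P k 0 \<le> (real ((n + d) choose d) * t ^ n) ^ k * ?b P 0 0"
      using bb(2)[of d P k 0] by (simp add: power_mult power_mult_distrib)
  qed
qed

text \<open>The limit of \<open>btr_rec\<close> at fixed exponent: the determinant with both shifts
  equal to 1 is nonnegative, and \<open>btr_bounds\<close> makes it a small multiple of the larger
  determinant.\<close>

lemma toep_det_wt_step:
  fixes n d :: nat and t t' :: real
  assumes t: "0 \<le> t" "t < 1" "0 \<le> t'" "t' < 1"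
  defines "T \<equiv> toep (wt (Suc n + d) t) (wt (Suc n + d) t')"
  shows "toep_det n T 0 \<le> toep_det (Suc n) T 0"
    and "toep_det (Suc n) T 0 \<le> toep_det n T 0 + (real ((Suc n + d) choose d))\<^sup>2 * (t * t') ^ Suc n * toep_det (Suc n) T 0"
proof -
  let ?w = "wt (Suc n + d) t" and ?w' = "wt (Suc n + d) t'"
  have lim: "(\<lambda>P. btr ?w ?w' m P 0 0) \<longlonglongrightarrow> toep_det m T 0" for m
    using btr_tendsto[OF toep_summable_wt[OF _ t], of "Suc n + d" 0 0 m] by (simp add: T_def)
  have rec: "btr ?w ?w' (Suc n) (Suc P) 0 0 = btr ?w ?w' (Suc n) P 1 1 + btr ?w ?w' n P 0 0" for P
    by (rule btr_rec) simp_all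
  have lS: "(\<lambda>P. btr ?w ?w' (Suc n) (Suc P) 0 0) \<longlonglongrightarrow> toep_det (Suc n) T 0"
    using LIMSEQ_Suc[OF lim[of "Suc n"]] .
  have pos: "0 \<le> btr ?w ?w' (Suc n) P 1 1" for P by (rule btr_bounds(1)) (use t in simp_all)
  have le: "btr ?w ?w' (Suc n) P 1 1 \<le> (real ((Suc n + d) choose d))\<^sup>2 * (t * t') ^ Suc n * btr ?w ?w' (Suc n) P 0 0" for P
    using btr_bounds(2)[of "Suc n" t t' d P 1 1] t
    by (simp only: zero_less_Suc one_add_one mult_1_right power_mult_distrib mult.assoc)
  show "toep_det n T 0 \<le> toep_det (Suc n) T 0"
    by (rule LIMSEQ_le[OF lim lS]) (use rec pos in simp)
  show "toep_det (Suc n) T 0 \<le> toep_det n T 0 + (real ((Suc n + d) choose d))\<^sup>2 * (t * t') ^ Suc n * toep_det (Suc n) T 0"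
  proof (rule LIMSEQ_le[OF lS tendsto_add[OF lim tendsto_mult[OF tendsto_const lim]]], intro exI allI impI)
    fix P :: nat
    show "btr ?w ?w' (Suc n) (Suc P) 0 0 \<le> btr ?w ?w' n P 0 0 + (real ((Suc n + d) choose d))\<^sup>2 * (t * t') ^ Suc n * btr ?w ?w' (Suc n) P 0 0"
      using rec[of P] le[of P] by linarith
  qed
qed

text \<open>Descent from size n + d, where the value is exact, to size n. One \<epsilon> bounds the
  relative loss in all d steps, and \<epsilon> <= 1 keeps 1 - \<epsilon> nonnegative so that the
  lower bounds multiply.\<close>

lemma toep_det_wt_0_bounds:
  fixes n d :: nat and t t' :: real
  assumes n: "n > 0" and t: "0 \<le> t" "t < 1" "0 \<le> t'" "t' < 1"
    and e: "real (n + d) ^ (2 * d) * (t * t') ^ n \<le> 1"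
  defines "T \<equiv> toep (wt (n + d) t) (wt (n + d) t')"
  shows "toep_det n T 0 \<le> 1 / (1 - t * t') ^ (n + d)\<^sup>2"
    and "(1 - real (n + d) ^ (2 * d) * (t * t') ^ n) ^ d / (1 - t * t') ^ (n + d)\<^sup>2 \<le> toep_det n T 0"
proof -
  define x where "x = t * t'"
  have x: "0 \<le> x" "x \<le> 1" using t by (auto simp: x_def mult_le_one)
  define \<epsilon> where "\<epsilon> = real (n + d) ^ (2 * d) * x ^ n"
  have eps: "0 \<le> \<epsilon>" "\<epsilon> \<le> 1" using e x by (simp_all add: \<epsilon>_def x_def)
  have full: "toep_det (n + d) T 0 = 1 / (1 - x) ^ (n + d)\<^sup>2"
    unfolding T_def x_def by (rule toep_det_full) (use n t in simp_all)
  have step: "toep_det m T 0 \<le> toep_det (Suc m) T 0 \<and> (1 - \<epsilon>) * toep_det (Suc m) T 0 \<le> toep_det m T 0 \<and> 0 \<le> toep_det (Suc m) T 0"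
    if m: "n \<le> m" "m < n + d" for m
  proof -
    \<comment> \<open>The exponent n + d stays fixed while the size varies, so at size m + 1 the
      surplus is what remains of it.\<close>
    define d' where "d' = n + d - Suc m"
    have T: "T = toep (wt (Suc m + d') t) (wt (Suc m + d') t')" using m by (simp add: T_def d'_def)
    note st = toep_det_wt_step[OF t, of m d', folded T x_def]
    have pos: "0 \<le> toep_det (Suc m) T 0"
      using toep_det_wt_bounds(1)[OF _ t, of "Suc m" d' 0, folded T] by simp
    have "(real ((Suc m + d') choose d'))\<^sup>2 * x ^ Suc m \<le> \<epsilon>"
      unfolding \<epsilon>_def
    proof (rule mult_mono)
      have "(Suc m + d') choose d' \<le> (Suc m + d') ^ d'" by (rule binomial_le_pow) simp
      also have "\<dots> = (n + d) ^ d'" using m by (simp add: d'_def)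
      also have "\<dots> \<le> (n + d) ^ d" using m n by (intro power_increasing) (auto simp: d'_def)
      finally have "real ((Suc m + d') choose d') \<le> real ((n + d) ^ d)" by (simp only: of_nat_le_iff)
      hence "(real ((Suc m + d') choose d'))\<^sup>2 \<le> (real ((n + d) ^ d))\<^sup>2" by (intro power_mono) simp_all
      thus "(real ((Suc m + d') choose d'))\<^sup>2 \<le> real (n + d) ^ (2 * d)" by (simp add: power_mult[symmetric] mult.commute)
      show "x ^ Suc m \<le> x ^ n" using m x by (intro power_decreasing) auto
    qed (use x in auto)
    hence "(real ((Suc m + d') choose d'))\<^sup>2 * x ^ Suc m * toep_det (Suc m) T 0 \<le> \<epsilon> * toep_det (Suc m) T 0"
      using pos by (intro mult_right_mono)
    hence "toep_det (Suc m) T 0 \<le> toep_det m T 0 + \<epsilon> * toep_det (Suc m) T 0" using st(2) by linarith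
    hence "(1 - \<epsilon>) * toep_det (Suc m) T 0 \<le> toep_det m T 0" by (simp add: left_diff_distrib)
    thus ?thesis using st(1) pos by blast
  qed
  have "toep_det (n + d - i) T 0 \<le> 1 / (1 - x) ^ (n + d)\<^sup>2 \<and> (1 - \<epsilon>) ^ i * (1 / (1 - x) ^ (n + d)\<^sup>2) \<le> toep_det (n + d - i) T 0"
    if "i \<le> d" for i
    using that
  proof (induction i)
    case 0
    show ?case using full by simp
  next
    case (Suc i)
    define m where "m = n + d - Suc i"
    have m: "n + d - i = Suc m" "n \<le> m" "m < n + d" using Suc.prems n by (auto simp: m_def)
    have IH: "toep_det (Suc m) T 0 \<le> 1 / (1 - x) ^ (n + d)\<^sup>2" "(1 - \<epsilon>) ^ i * (1 / (1 - x) ^ (n + d)\<^sup>2) \<le> toep_det (Suc m) T 0"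
      using Suc.IH Suc.prems unfolding m(1) by simp_all
    note st = step[OF m(2,3)]
    have "(1 - \<epsilon>) * ((1 - \<epsilon>) ^ i * (1 / (1 - x) ^ (n + d)\<^sup>2)) \<le> (1 - \<epsilon>) * toep_det (Suc m) T 0"
      using IH(2) eps by (intro mult_left_mono) simp_all
    hence "(1 - \<epsilon>) ^ Suc i * (1 / (1 - x) ^ (n + d)\<^sup>2) \<le> toep_det m T 0" using st by (simp add: mult.assoc)
    thus ?case using st IH(1) unfolding m_def[symmetric] by linarith
  qed
  from this[of d] show "toep_det n T 0 \<le> 1 / (1 - t * t') ^ (n + d)\<^sup>2"
    and "(1 - real (n + d) ^ (2 * d) * (t * t') ^ n) ^ d / (1 - t * t') ^ (n + d)\<^sup>2 \<le> toep_det n T 0"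
    by (simp_all add: \<epsilon>_def x_def)
qed

lemma power_times_power_tendsto_0:
  fixes y :: real
  assumes y: "0 \<le> y" "y < 1"
  shows "(\<lambda>n. real (n + d) ^ k * y ^ n) \<longlonglongrightarrow> 0"
proof -
  have base: "(\<lambda>n. real n ^ k * y ^ n) \<longlonglongrightarrow> 0"
  proof (cases "k = 0")
    case True
    thus ?thesis using LIMSEQ_realpow_zero[OF y] by simp
  next
    case False
    \<comment> \<open>With a k-th root the expression becomes the k-th power of n z^n, which reduces
      the claim to k = 1.\<close>
    define z where "z = root k y"
    have z: "0 \<le> z" "z < 1" "z ^ k = y" using False y by (simp_all add: z_def)
    have "(\<lambda>n. real n * z ^ n) \<longlonglongrightarrow> 0" using powser_times_n_limit_0[of z] z by simp
    hence "(\<lambda>n. (real n * z ^ n) ^ k) \<longlonglongrightarrow> 0 ^ k" by (rule tendsto_power)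
    moreover have "(real n * z ^ n) ^ k = real n ^ k * y ^ n" for n
      unfolding z(3)[symmetric] by (simp add: power_mult_distrib mult.commute flip: power_mult)
    ultimately show ?thesis using False by (simp add: power_0_left)
  qed
  show ?thesis
  proof (rule tendsto_sandwich[OF _ _ tendsto_const])
    show "(\<lambda>n. (1 + real d) ^ k * (real n ^ k * y ^ n)) \<longlonglongrightarrow> 0" using tendsto_mult_right_zero[OF base] .
    show "\<forall>\<^sub>F n in sequentially. 0 \<le> real (n + d) ^ k * y ^ n" using y by simp
    show "\<forall>\<^sub>F n in sequentially. real (n + d) ^ k * y ^ n \<le> (1 + real d) ^ k * (real n ^ k * y ^ n)"
    proof (rule eventually_sequentiallyI[of 1])
      fix n :: nat assume n: "1 \<le> n"
      have "real d * 1 \<le> real d * real n" using n by (intro mult_left_mono) simp_all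
      hence "real (n + d) \<le> (1 + real d) * real n" by (simp add: algebra_simps)
      hence "real (n + d) ^ k \<le> ((1 + real d) * real n) ^ k" by (intro power_mono) simp_all
      hence "real (n + d) ^ k * y ^ n \<le> ((1 + real d) * real n) ^ k * y ^ n" using y by (intro mult_right_mono) simp_all
      thus "real (n + d) ^ k * y ^ n \<le> (1 + real d) ^ k * (real n ^ k * y ^ n)" by (simp add: power_mult_distrib mult.assoc)
    qed
  qed
qed

section \<open>The Hilbert series\<close>

lemma suminf_le_geometric:
  fixes f :: "nat \<Rightarrow> real"
  assumes "summable f" "0 \<le> q" "q < 1" "\<And>k. f k \<le> q ^ k * c"
  shows "(\<Sum>k. f k) \<le> c / (1 - q)"
proof -
  have g: "(\<lambda>k. q ^ k * c) sums (1 / (1 - q) * c)"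
    by (rule sums_mult2[OF geometric_sums]) (use assms in simp)
  have "(\<Sum>k. f k) \<le> (\<Sum>k. q ^ k * c)"
    by (rule suminf_le[OF assms(4) assms(1) sums_summable[OF g]])
  thus ?thesis unfolding sums_unique[OF g, symmetric] by simp
qed

lemma wt_series:
  fixes w z :: complex
  assumes "a > 0" "0 \<le> t" "t < 1" "norm z = 1"
  shows "(\<Sum>m. of_real (wt a t m) * z ^ m) = 1 / (1 - of_real t * z) ^ a"
proof -
  have "norm (of_real t * z) < 1" using assms by (simp add: norm_mult)
  from sums_unique[OF negbin_sums[OF this, of "a - 1"]] assms(1)
  show ?thesis by (simp add: wt_def power_mult_distrib mult_ac)
qed

context haar begin

lemma hilbert_series_eq_toep_det:
  fixes d :: nat and t t' :: real
  assumes n: "n > 0" and t: "0 \<le> t" "t < 1" "0 \<le> t'" "t' < 1"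
  defines "T \<equiv> toep (wt (n + d) t) (wt (n + d) t')"
  shows "summable (\<lambda>k. toep_det n T (int k))"
    and "summable (\<lambda>k. toep_det n T (- 1 - int k))"
    and "hilbert_series M (n + d) t t' =
      of_real ((\<Sum>k. toep_det n T (int k)) + (\<Sum>k. toep_det n T (- 1 - int k)))"
proof -
  let ?u = "wt (n + d) t" and ?v = "wt (n + d) t'"
  have a: "n + d > 0" using n by simp
  obtain C r where Cr: "0 < r" "r < 1" "0 \<le> C" "\<And>m. \<bar>?u m\<bar> \<le> C * r ^ (2 * m)" "\<And>m. \<bar>?v m\<bar> \<le> C * r ^ (2 * m)"
    using wt_bound[OF a t] by metis
  note ip = integral_prod_eigenvalues_series[of r C ?u ?v, OF n Cr, folded T_def]
  show "summable (\<lambda>k. toep_det n T (int k))" "summable (\<lambda>k. toep_det n T (- 1 - int k))"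
    by (rule ip(1), rule ip(2))
  have "hilbert_series M (n + d) t t' =
    (LINT A|M. (\<Prod>z\<in>#eigenvalue_mset A. (\<Sum>m. of_real (?u m) * (1 / z) ^ m) * (\<Sum>m. of_real (?v m) * z ^ m)))"
    unfolding hilbert_series_def
  proof (rule Bochner_Integration.integral_cong[OF refl])
    fix A assume "A \<in> space M"
    hence A: "A \<in> SU n" unfolding space_M .
    obtain zs where zs: "eigenvalue_mset A = mset zs" "\<And>z. z \<in> set zs \<Longrightarrow> norm z = 1"
      using SU_eigenvalues[OF A] by metis
    have "1 / ((1 - of_real t / z) ^ (n + d) * (1 - of_real t' * z) ^ (n + d)) =
      (\<Sum>m. of_real (?u m) * (1 / z) ^ m) * (\<Sum>m. of_real (?v m) * z ^ m)" if "z \<in> set zs" for z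
    proof -
      have z: "norm z = 1" "norm (1 / z) = 1" using zs(2)[OF that] by (simp_all add: norm_divide)
      show ?thesis unfolding wt_series[OF a t(1,2) z(2)] wt_series[OF a t(3,4) z(1)] by simp
    qed
    thus "(\<Prod>z\<in>#eigenvalue_mset A. 1 / ((1 - of_real t / z) ^ (n + d) * (1 - of_real t' * z) ^ (n + d))) =
      (\<Prod>z\<in>#eigenvalue_mset A. (\<Sum>m. of_real (?u m) * (1 / z) ^ m) * (\<Sum>m. of_real (?v m) * z ^ m))"
      unfolding zs(1) by (intro arg_cong[of _ _ prod_mset] image_mset_cong) simp
  qed
  thus "hilbert_series M (n + d) t t' =
      of_real ((\<Sum>k. toep_det n T (int k)) + (\<Sum>k. toep_det n T (- 1 - int k)))"
    unfolding ip(3) .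
qed

text \<open>The lower bound keeps the term at shift 0 alone. The upper bound sums one geometric
  series per half-line; the negative one starts with the first power of its ratio. The power (n +
  d)^d is a cruder substitute for the binomial coefficient.\<close>

lemma hilbert_series_bounds:
  fixes t t' :: real
  assumes n: "n > 0" and t: "0 \<le> t" "t < 1" "0 \<le> t'" "t' < 1"
    and q: "real (n + d) ^ d * t ^ n < 1" and q': "real (n + d) ^ d * t' ^ n < 1"
    and e: "real (n + d) ^ (2 * d) * (t * t') ^ n \<le> 1"
  obtains \<rho> where "hilbert_series M (n + d) t t' = of_real (\<rho> / (1 - t * t') ^ (n + d)\<^sup>2)"
    "(1 - real (n + d) ^ (2 * d) * (t * t') ^ n) ^ d \<le> \<rho>"
    "\<rho> \<le> 1 / (1 - real (n + d) ^ d * t' ^ n) + real (n + d) ^ d * t ^ n / (1 - real (n + d) ^ d * t ^ n)"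
proof -
  define q where "q = real (n + d) ^ d * t ^ n"
  define q' where "q' = real (n + d) ^ d * t' ^ n"
  have q1: "0 \<le> q" "q < 1" "0 \<le> q'" "q' < 1" using assms by (simp_all add: q_def q'_def)
  define D where "D = toep_det n (toep (wt (n + d) t) (wt (n + d) t'))"
  define S1 where "S1 = (\<Sum>k. D (int k))"
  define S2 where "S2 = (\<Sum>k. D (- 1 - int k))"
  define W where "W = (1 - t * t') ^ (n + d)\<^sup>2"
  have "t * t' < 1" using mult_strict_mono'[of t 1 t' 1] t by simp
  hence W: "W > 0" by (simp add: W_def)
  note hs = hilbert_series_eq_toep_det[OF n t, of d, folded D_def S1_def S2_def]
  note bb = toep_det_wt_bounds[OF n t, of d, folded D_def]
  note b0 = toep_det_wt_0_bounds[OF n t e, folded D_def W_def]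
  have D0: "0 \<le> D 0" using bb(1)[of 0] by simp
  have C: "real ((n + d) choose d) \<le> real (n + d) ^ d"
    using binomial_le_pow[of d "n + d"] unfolding of_nat_power[symmetric] of_nat_le_iff by simp
  have up: "D (int k) \<le> q' ^ k * D 0" for k
  proof (rule order.trans[OF bb(2)[of k] mult_right_mono[OF power_mono D0]])
    show "real ((n + d) choose d) * t' ^ n \<le> q'" unfolding q'_def using C t by (intro mult_right_mono) simp_all
  qed (use t in simp)
  have un: "D (- int k) \<le> q ^ k * D 0" for k
  proof (rule order.trans[OF bb(4)[of k] mult_right_mono[OF power_mono D0]])
    show "real ((n + d) choose d) * t ^ n \<le> q" unfolding q_def using C t by (intro mult_right_mono) simp_all
  qed (use t in simp)
  have m: "- 1 - int k = - int (Suc k)" for k by simp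
  have "S1 \<le> D 0 / (1 - q')"
    unfolding S1_def by (rule suminf_le_geometric[OF hs(1) q1(3,4) up])
  moreover have "S2 \<le> (q * D 0) / (1 - q)"
    unfolding S2_def
  proof (rule suminf_le_geometric[OF hs(2) q1(1,2)])
    show "D (- 1 - int k) \<le> q ^ k * (q * D 0)" for k using un[of "Suc k"] unfolding m by (simp add: mult_ac)
  qed
  ultimately have "S1 + S2 \<le> (1 / (1 - q') + q / (1 - q)) * D 0" by (simp add: algebra_simps)
  also have "\<dots> \<le> (1 / (1 - q') + q / (1 - q)) * (1 / W)" using b0(1) q1 by (intro mult_left_mono) simp_all
  finally have U: "(S1 + S2) * W \<le> 1 / (1 - q') + q / (1 - q)" using W by (simp add: pos_le_divide_eq)
  have "D 0 \<le> S1"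
    using sum_le_suminf[OF hs(1), of "{0}"] bb(1) unfolding S1_def by simp
  moreover have "0 \<le> S2"
    unfolding S2_def by (rule suminf_nonneg[OF hs(2)]) (unfold m, rule bb(3))
  ultimately have "(1 - real (n + d) ^ (2 * d) * (t * t') ^ n) ^ d / W \<le> S1 + S2" using b0(2) by linarith
  hence L: "(1 - real (n + d) ^ (2 * d) * (t * t') ^ n) ^ d \<le> (S1 + S2) * W" using W by (simp add: pos_divide_le_eq)
  have "hilbert_series M (n + d) t t' = of_real ((S1 + S2) * W / W)" using hs(3) W by simp
  from that[OF this[unfolded W_def] L[unfolded W_def] U[unfolded W_def q_def q'_def]] show thesis .
qed

end

lemma binomial_times_power_tendsto_0:
  fixes y c :: real
  assumes y: "0 \<le> y" "y < 1"
  shows "(\<lambda>n. real ((n + d) choose n) * c * y ^ n) \<longlonglongrightarrow> 0"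
proof -
  have "(\<lambda>n. real ((n + d) choose n) * y ^ n) \<longlonglongrightarrow> 0"
  proof (rule tendsto_sandwich[OF _ _ tendsto_const power_times_power_tendsto_0[OF y, of d d]])
    have "(n + d) choose n \<le> (n + d) ^ d" for n
      using binomial_symmetric[of n "n + d"] binomial_le_pow[of d "n + d"] by simp
    hence "real ((n + d) choose n) \<le> real (n + d) ^ d" for n by (metis of_nat_le_iff of_nat_power)
    thus "\<forall>\<^sub>F n in sequentially. real ((n + d) choose n) * y ^ n \<le> real (n + d) ^ d * y ^ n"
      using y by (intro always_eventually allI mult_right_mono) simp_all
  qed (use y in simp)
  from tendsto_mult_right_zero[OF this, of c] show ?thesis by (simp add: mult_ac)
qed

lemma binomial_sq_times_power_tendsto_0:
  fixes y c :: real
  assumes y: "0 \<le> y" "y < 1"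
  shows "(\<lambda>n. (real ((n + d) choose (n + 1)))\<^sup>2 * c * y ^ (n + 1)) \<longlonglongrightarrow> 0"
proof -
  have "(\<lambda>n. (real ((n + d) choose (n + 1)))\<^sup>2 * y ^ n) \<longlonglongrightarrow> 0"
  proof (rule tendsto_sandwich[OF _ _ tendsto_const power_times_power_tendsto_0[OF y, of d "2 * d"]])
    have "(n + d) choose (n + 1) \<le> (n + d) ^ d" if n: "1 \<le> n" for n
    \<comment> \<open>For d = 0 the binomial coefficient is 0; otherwise symmetry turns its lower
      index into d - 1.\<close>
    proof (cases d)
      case (Suc e)
      have "(n + d) choose (n + 1) = (n + d) choose e" using binomial_symmetric[of "n + 1" "n + d"] Suc by simp
      also have "\<dots> \<le> (n + d) ^ e" by (rule binomial_le_pow) (simp add: Suc)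
      also have "\<dots> \<le> (n + d) ^ d" using Suc n by (intro power_increasing) simp_all
      finally show ?thesis .
    qed (simp add: binomial_eq_0)
    hence "real ((n + d) choose (n + 1)) \<le> real (n + d) ^ d" if "1 \<le> n" for n
      using that by (metis of_nat_le_iff of_nat_power)
    hence "(real ((n + d) choose (n + 1)))\<^sup>2 \<le> (real (n + d) ^ d)\<^sup>2" if "1 \<le> n" for n
      using that by (intro power_mono) simp_all
    thus "\<forall>\<^sub>F n in sequentially. (real ((n + d) choose (n + 1)))\<^sup>2 * y ^ n \<le> real (n + d) ^ (2 * d) * y ^ n"
      using y by (intro eventually_sequentiallyI[of 1] mult_right_mono) (simp_all add: power_mult mult.commute[of 2] )
  qed (use y in simp)
  from tendsto_mult_right_zero[OF this, of "c * y"] show ?thesis by (simp add: mult_ac)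
qed

theorem mainTheorem13:
  fixes \<delta> :: nat and t t' :: real and \<mu> :: "nat \<Rightarrow> complex mat measure"
  assumes "0 \<le> t" "t < 1" "0 \<le> t'" "t' < 1"
    and "\<And>N. N \<ge> 1 \<Longrightarrow> normalised_haar_SU N (\<mu> N)"
  shows "(\<lambda>N. hilbert_series (\<mu> N) (N + \<delta>) t t' /
      complex_of_real
       (1 / (1 - t * t') ^ ((N + \<delta>)\<^sup>2) *
        (1 + real ((N + \<delta>) choose N) * (1 - t * t') ^ \<delta> * (t ^ N + t' ^ N)
           - (real ((N + \<delta>) choose (N + 1)))\<^sup>2
               * (1 - t * t') powi (2 * (int \<delta> - 1)) * (t * t') ^ (N + 1))))
    \<longlonglongrightarrow> 1"
proof -
  note t = assms(1-4)
  have x: "0 \<le> t * t'" "t * t' < 1" using mult_strict_mono'[of t 1 t' 1] t by simp_all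
  define br where "br N = 1 + real ((N + \<delta>) choose N) * (1 - t * t') ^ \<delta> * (t ^ N + t' ^ N)
    - (real ((N + \<delta>) choose (N + 1)))\<^sup>2 * (1 - t * t') powi (2 * (int \<delta> - 1)) * (t * t') ^ (N + 1)" for N
  \<comment> \<open>The real part gives a definition valid for every N; the integral is shown to be
    real only for large N.\<close>
  define \<rho> where "\<rho> N = Re (hilbert_series (\<mu> N) (N + \<delta>) t t') * (1 - t * t') ^ (N + \<delta>)\<^sup>2" for N
  define q where "q N = real (N + \<delta>) ^ \<delta> * t ^ N" for N
  define q' where "q' N = real (N + \<delta>) ^ \<delta> * t' ^ N" for N
  define e where "e N = real (N + \<delta>) ^ (2 * \<delta>) * (t * t') ^ N" for N
  have lq: "q \<longlonglongrightarrow> 0" "q' \<longlonglongrightarrow> 0" "e \<longlonglongrightarrow> 0"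
    unfolding q_def[abs_def] q'_def[abs_def] e_def[abs_def]
    by (rule power_times_power_tendsto_0[OF t(1,2)] power_times_power_tendsto_0[OF t(3,4)] power_times_power_tendsto_0[OF x])+
  have ev: "\<forall>\<^sub>F N in sequentially. 1 \<le> N \<and> q N < 1 \<and> q' N < 1 \<and> e N < 1"
    using lq by (intro eventually_conj eventually_ge_at_top order_tendstoD(2)[of _ 0]) simp_all
  have main: "\<forall>\<^sub>F N in sequentially. hilbert_series (\<mu> N) (N + \<delta>) t t' = of_real (\<rho> N / (1 - t * t') ^ (N + \<delta>)\<^sup>2) \<and>
    (1 - e N) ^ \<delta> \<le> \<rho> N \<and> \<rho> N \<le> 1 / (1 - q' N) + q N / (1 - q N)"
    using ev
  proof eventually_elim
    case (elim N)
    interpret haar N "\<mu> N" by unfold_locales (use elim assms(5) in simp)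
    obtain r where r: "hilbert_series (\<mu> N) (N + \<delta>) t t' = of_real (r / (1 - t * t') ^ (N + \<delta>)\<^sup>2)"
      "(1 - e N) ^ \<delta> \<le> r" "r \<le> 1 / (1 - q' N) + q N / (1 - q N)"
      using hilbert_series_bounds[OF _ t, of \<delta>] elim unfolding q_def q'_def e_def by auto
    have "\<rho> N = r" unfolding \<rho>_def r(1) using x by simp
    thus ?case using r by simp
  qed
  have "\<rho> \<longlonglongrightarrow> 1"
  proof (rule tendsto_sandwich)
    show "\<forall>\<^sub>F N in sequentially. (1 - e N) ^ \<delta> \<le> \<rho> N" using main by eventually_elim blast
    show "\<forall>\<^sub>F N in sequentially. \<rho> N \<le> 1 / (1 - q' N) + q N / (1 - q N)" using main by eventually_elim blast
    have "(\<lambda>N. (1 - e N) ^ \<delta>) \<longlonglongrightarrow> (1 - 0) ^ \<delta>" using lq by (intro tendsto_intros)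
    thus "(\<lambda>N. (1 - e N) ^ \<delta>) \<longlonglongrightarrow> 1" by simp
    have "(\<lambda>N. 1 / (1 - q' N) + q N / (1 - q N)) \<longlonglongrightarrow> 1 / (1 - 0) + 0 / (1 - 0)"
      using lq by (intro tendsto_intros) simp_all
    thus "(\<lambda>N. 1 / (1 - q' N) + q N / (1 - q N)) \<longlonglongrightarrow> 1" by simp
  qed
  \<comment> \<open>For \<delta> = 0 the last power of 1 - t t' has a negative exponent, but it is
    still a constant in N.\<close>
  moreover have br: "br \<longlonglongrightarrow> 1"
  proof -
    have "br \<longlonglongrightarrow> 1 + (0 + 0) - 0"
      unfolding br_def[abs_def] distrib_left
      by (intro tendsto_add tendsto_diff tendsto_const binomial_times_power_tendsto_0 binomial_sq_times_power_tendsto_0 t x)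
    thus ?thesis by simp
  qed
  ultimately have "(\<lambda>N. \<rho> N / br N) \<longlonglongrightarrow> 1 / 1" by (intro tendsto_divide) simp_all
  hence "(\<lambda>N. complex_of_real (\<rho> N / br N)) \<longlonglongrightarrow> complex_of_real (1 / 1)"
    by (rule tendsto_of_real)
  hence "(\<lambda>N. complex_of_real (\<rho> N / br N)) \<longlonglongrightarrow> 1" by simp
  moreover have "\<forall>\<^sub>F N in sequentially. complex_of_real (\<rho> N / br N) =
    hilbert_series (\<mu> N) (N + \<delta>) t t' / complex_of_real (1 / (1 - t * t') ^ (N + \<delta>)\<^sup>2 * br N)"
    using main
  proof eventually_elim
    case (elim N)
    have "hilbert_series (\<mu> N) (N + \<delta>) t t' = of_real (\<rho> N / (1 - t * t') ^ (N + \<delta>)\<^sup>2)" using elim by blast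
    moreover have "\<rho> N / br N = (\<rho> N / W) / (1 / W * br N)" if "W \<noteq> 0" for W using that by simp
    ultimately show ?case using x by (simp only: of_real_divide[symmetric]) simp
  qed
  ultimately show ?thesis unfolding br_def by (rule Lim_transform_eventually)
qed

end
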